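(* (Precise form of Theorem B for hyperbolic elements.) Let $f\in\mathcal L^H$ (resp. $f\in\mathcal L_{\mathfrak D}^H$) be hyperbolic. Then there exists a unique formal vector field $X=\xi\frac{\mathrm d}{\mathrm dx}$, $\xi\in\mathcal L$ (resp. $\xi\in\mathcal L_{\mathfrak D}$), such that $f$ embeds in the $\mathcal C^1$-flow of $X$ as its time-one map. Moreover, $f=\exp(X)\cdot\mathrm{id}$. Here $\mathrm{ord}(\xi)=(1,0)$, and $\exp(X)=\sum_{n\ge0}\frac1{n!}X^n$ is a weakly well-defined operator on $\mathcal L$ (resp. $\mathcal L_{\mathfrak D}$).
   Context: Write $\boldsymbol\ell=-1/\log x$. Let $\preceq$ be the lexicographic order on $\mathbb R\times\mathbb Z$. $\mathcal L$ is the set of formal series $f=\sum_{(\alpha,k)}[f]_{\alpha,k}x^\alpha\boldsymbol\ell^k$ with real coefficients whose support $\mathcal S(f)=\{(\alpha,k):[f]_{\alpha,k}\neq0\}$ is a $\preceq$-well-ordered subset of $\mathbb R_{>0}\times\mathbb Z$. $\mathrm{ord}(f)=\min\mathcal S(f)$; "h.o.t." stands for terms of strictly larger order. $\mathcal L_{\mathfrak D}\subset\mathcal L$ consists of the $f$ whose support is contained in an additive semigroup generated by $(0,1)$ and finitely many elements of $\mathbb R_{>0}\times\mathbb Z$. $\mathcal L^H$ is the set of $f\in\mathcal L$ of the form $f=\lambda x^\alpha+\text{h.o.t.}$ with $\lambda,\alpha>0$; $\mathcal L^H_{\mathfrak D}=\mathcal L^H\cap\mathcal L_{\mathfrak D}$.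 Such an $f$ is hyperbolic if $\alpha=1,\lambda\ne1$. Composition: for $f=ax^\lambda(1+\varepsilon)\in\mathcal L^H$ ($\varepsilon$ containing only monomials of order $\succ(0,0)$), set $x^\alpha\circ f=a^\alpha x^{\lambda\alpha}\sum_{j\ge0}\binom{\alpha}{j}\varepsilon^j$ and $\boldsymbol\ell\circ f=-1/\log f$ with $\log f=\log a+\lambda\log x+\sum_{j\ge1}\frac{(-1)^{j+1}}{j}\varepsilon^j$, expanded in powers of $\boldsymbol\ell$ and $\varepsilon$; then $\big(\sum c_{\alpha,k}x^\alpha\boldsymbol\ell^k\big)\circ f=\sum c_{\alpha,k}(x^\alpha\circ f)(\boldsymbol\ell\circ f)^k$. $\mathcal L^H$ and $\mathcal L^H_{\mathfrak D}$ are groups for composition; $\mathrm{id}$ denotes the series $x$. A family $(f^t)_{t\in\mathbb R}$ in $\mathcal L^H$ is a flow if $f^0=\mathrm{id}$ and $f^s\circ f^t=f^{s+t}$ for all $s,t$; $f$ embeds in it (as its time-one map) if $f=f^1$. It is a $\mathcal C^1$-flow if moreover (i) there is a well-ordered $S\subset\mathbb R_{>0}\times\mathbb Z$ with $\mathcal S(f^t)\subseteq S$ for all $t$, and (ii) $t\mapsto[f^t]_{\alpha,m}$ is $\mathcal C^1$ on $\mathbb R$ for every $(\alpha,m)\in S$. In that case, with $\xi=\frac{\mathrm df^t}{\mathrm dt}\big|_{t=0}\in\mathcal L$ (coefficientwise), $(f^t)$ is the $\mathcal C^1$-flow of $X=\xi\frac{\mathrm d}{\mathrm dx}$. Differentiation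 is termwise, $(x^\alpha\boldsymbol\ell^k)'=\alpha x^{\alpha-1}\boldsymbol\ell^k+kx^{\alpha-1}\boldsymbol\ell^{k+1}$, and $X\cdot g=\xi g'$. An operator on $\mathcal L$ (resp. $\mathcal L_{\mathfrak D}$) is a strongly linear self-map $B$, i.e. $B(\sum c_{\alpha,k}x^\alpha\boldsymbol\ell^k)=\sum c_{\alpha,k}B(x^\alpha\boldsymbol\ell^k)$. An operator $B$ is weakly well-defined by a series of operators $\sum_jB_j$ if for every $g$ the partial sums $\sum_{j\le N}B_j\cdot g$ converge to $B\cdot g$ in the weak topology, i.e. the coefficient of every monomial converges in $\mathbb R$ to the corresponding coefficient of $B\cdot g$. *)

theory Defs
  imports "HOL-Analysis.Analysis"
begin

(* The pair (\<alpha>, k) stands for the monomial x^\<alpha> l^k, where l = -1 / log x; the product of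
   monomials is the componentwise sum of pairs.  A series is its coefficient function.  Exponents
   range over all of real \<times> int, because \<epsilon>, log f and g' leave the positive range. *)

type_synonym pl_monom = "real \<times> int"
type_synonym pl_series = "pl_monom \<Rightarrow> real"

(* The library order on pairs is the componentwise one, so the lexicographic order is a relation. *)
definition lex_le :: "pl_monom rel" where
  "lex_le = {((\<alpha>, k), (\<beta>, m)). \<alpha> < \<beta> \<or> (\<alpha> = \<beta> \<and> k \<le> m)}"

definition lex_well_ordered :: "pl_monom set \<Rightarrow> bool" where
  "lex_well_ordered S \<longleftrightarrow> well_order_on S (Restr lex_le S)"

definition positive_monoms :: "pl_monom set" where
  "positive_monoms = {0<..} \<times> UNIV"

definition supp :: "pl_series \<Rightarrow> pl_monom set" where
  "supp f = {p. f p \<noteq> 0}"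

definition pl_L :: "pl_series set" where
  "pl_L = {f. lex_well_ordered (supp f) \<and> supp f \<subseteq> positive_monoms}"

inductive_set add_semigroup :: "pl_monom set \<Rightarrow> pl_monom set" for G where
  gen: "p \<in> G \<Longrightarrow> p \<in> add_semigroup G"
| add: "p \<in> add_semigroup G \<Longrightarrow> q \<in> add_semigroup G \<Longrightarrow> p + q \<in> add_semigroup G"

definition pl_LD :: "pl_series set" where
  "pl_LD = {f \<in> pl_L. \<exists>G. finite G \<and> G \<subseteq> positive_monoms \<and> supp f \<subseteq> add_semigroup (insert (0, 1) G)}"

(* A relation, because the zero series has no order. *)
definition has_ord :: "pl_series \<Rightarrow> pl_monom \<Rightarrow> bool" where
  "has_ord f p \<longleftrightarrow> p \<in> supp f \<and> (\<forall>q\<in>supp f. (p, q) \<in> lex_le)"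

definition pl_LH :: "pl_series set" where
  "pl_LH = {f \<in> pl_L. \<exists>\<alpha>>0. has_ord f (\<alpha>, 0) \<and> f (\<alpha>, 0) > 0}"

definition hyperbolic :: "pl_series \<Rightarrow> bool" where
  "hyperbolic f \<longleftrightarrow> has_ord f (1, 0) \<and> f (1, 0) \<noteq> 1"


definition term_of :: "real \<Rightarrow> pl_monom \<Rightarrow> pl_series" where
  "term_of c p = (\<lambda>q. if q = p then c else 0)"

definition pl_id :: pl_series where
  "pl_id = term_of 1 (1, 0)"

definition pl_add :: "pl_series \<Rightarrow> pl_series \<Rightarrow> pl_series" where
  "pl_add f g = (\<lambda>p. f p + g p)"

definition pl_scale :: "real \<Rightarrow> pl_series \<Rightarrow> pl_series" where
  "pl_scale c f = (\<lambda>p. c * f p)"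

(* The index set is finite whenever both supports are well-ordered. *)
definition pl_mult :: "pl_series \<Rightarrow> pl_series \<Rightarrow> pl_series" where
  "pl_mult f g = (\<lambda>p. \<Sum>q | f q \<noteq> 0 \<and> g (p - q) \<noteq> 0. f q * g (p - q))"

definition pl_power :: "pl_series \<Rightarrow> nat \<Rightarrow> pl_series" where
  "pl_power f n = (pl_mult f ^^ n) (term_of 1 (0, 0))"

definition strongly_summable :: "('i \<Rightarrow> pl_series) \<Rightarrow> bool" where
  "strongly_summable F \<longleftrightarrow>
     lex_well_ordered (\<Union>i. supp (F i)) \<and> (\<forall>p. finite {i. F i p \<noteq> 0})"

definition strong_sum :: "('i \<Rightarrow> pl_series) \<Rightarrow> pl_series" where
  "strong_sum F = (\<lambda>p. \<Sum>i | F i p \<noteq> 0. F i p)"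


(* For f in pl_LH: f = a x^\<lambda> (1 + \<epsilon>), with \<lambda> = lead_exp f, a = lead_coeff_of f, \<epsilon> = eps_of f. *)

definition lead_exp :: "pl_series \<Rightarrow> real" where
  "lead_exp f = (THE \<mu>. has_ord f (\<mu>, 0))"

definition lead_coeff_of :: "pl_series \<Rightarrow> real" where
  "lead_coeff_of f = f (lead_exp f, 0)"

definition eps_of :: "pl_series \<Rightarrow> pl_series" where
  "eps_of f = (\<lambda>p. if p = (0, 0) then 0 else f (p + (lead_exp f, 0)) / lead_coeff_of f)"

definition x_powr_comp :: "real \<Rightarrow> pl_series \<Rightarrow> pl_series" where
  "x_powr_comp \<alpha> f =
     pl_mult (term_of (lead_coeff_of f powr \<alpha>) (lead_exp f * \<alpha>, 0))
             (strong_sum (\<lambda>j::nat. pl_scale (\<alpha> gchoose j) (pl_power (eps_of f) j)))"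

(* log a + log (1 + \<epsilon>) *)
definition log_tail :: "pl_series \<Rightarrow> pl_series" where
  "log_tail f =
     pl_add (term_of (ln (lead_coeff_of f)) (0, 0))
            (strong_sum (\<lambda>j::nat. pl_scale ((-1) ^ j / real (Suc j)) (pl_power (eps_of f) (Suc j))))"

(* log x = - l^(-1) *)
definition pl_log :: "pl_series \<Rightarrow> pl_series" where
  "pl_log f = pl_add (term_of (- lead_exp f) (0, -1)) (log_tail f)"

(* - log f = \<lambda> l^(-1) (1 - u) with u = (l / \<lambda>) (log a + log (1 + \<epsilon>)), so that
   -1 / log f = (l / \<lambda>) (1 + u + u^2 + ...). *)
definition ell_comp :: "pl_series \<Rightarrow> pl_series" where
  "ell_comp f =
     (let h = term_of (1 / lead_exp f) (0, 1)
      in pl_mult h (strong_sum (\<lambda>j::nat. pl_power (pl_mult h (log_tail f)) j)))"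

(* Negative powers are powers of the inverse - log f. *)
definition ell_powi_comp :: "int \<Rightarrow> pl_series \<Rightarrow> pl_series" where
  "ell_powi_comp k f =
     (if k \<ge> 0 then pl_power (ell_comp f) (nat k)
      else pl_power (pl_scale (-1) (pl_log f)) (nat (- k)))"

(* pl_comp g f is g \<circ> f *)
definition pl_comp :: "pl_series \<Rightarrow> pl_series \<Rightarrow> pl_series" where
  "pl_comp g f =
     strong_sum (\<lambda>(\<alpha>, k). pl_scale (g (\<alpha>, k)) (pl_mult (x_powr_comp \<alpha> f) (ell_powi_comp k f)))"


definition is_flow :: "(real \<Rightarrow> pl_series) \<Rightarrow> bool" where
  "is_flow F \<longleftrightarrow>
     (\<forall>t. F t \<in> pl_LH) \<and> F 0 = pl_id \<and> (\<forall>s t. pl_comp (F s) (F t) = F (s + t))"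

definition is_C1_flow :: "(real \<Rightarrow> pl_series) \<Rightarrow> bool" where
  "is_C1_flow F \<longleftrightarrow> is_flow F \<and>
     (\<exists>S. lex_well_ordered S \<and> S \<subseteq> positive_monoms \<and> (\<forall>t. supp (F t) \<subseteq> S) \<and>
          (\<forall>p\<in>S. (\<lambda>t. F t p) C1_differentiable_on UNIV))"

(* A vector field \<xi> d/dx is represented by \<xi>. *)
definition is_C1_flow_of :: "pl_series \<Rightarrow> (real \<Rightarrow> pl_series) \<Rightarrow> bool" where
  "is_C1_flow_of \<xi> F \<longleftrightarrow> is_C1_flow F \<and> \<xi> = (\<lambda>p. deriv (\<lambda>t. F t p) 0)"

definition embeds_in_C1_flow_of :: "pl_series \<Rightarrow> pl_series \<Rightarrow> bool" where
  "embeds_in_C1_flow_of f \<xi> \<longleftrightarrow> (\<exists>F. is_C1_flow_of \<xi> F \<and> F 1 = f)"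


(* The monomial x^\<beta> l^k of g' comes from x^(\<beta>+1) l^k and from x^(\<beta>+1) l^(k-1). *)
definition pl_deriv :: "pl_series \<Rightarrow> pl_series" where
  "pl_deriv g = (\<lambda>(\<beta>, k). (\<beta> + 1) * g (\<beta> + 1, k) + of_int (k - 1) * g (\<beta> + 1, k - 1))"

definition vf_apply :: "pl_series \<Rightarrow> pl_series \<Rightarrow> pl_series" where
  "vf_apply \<xi> g = pl_mult \<xi> (pl_deriv g)"

definition is_operator :: "pl_series set \<Rightarrow> (pl_series \<Rightarrow> pl_series) \<Rightarrow> bool" where
  "is_operator D B \<longleftrightarrow>
     (\<forall>g\<in>D. B g \<in> D \<and>
        strongly_summable (\<lambda>p. pl_scale (g p) (B (term_of 1 p))) \<and>
        B g = strong_sum (\<lambda>p. pl_scale (g p) (B (term_of 1 p))))"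

(* Convergence of partial sums in the weak topology is coefficientwise convergence in the reals. *)
definition weakly_well_defined_by ::
    "pl_series set \<Rightarrow> (pl_series \<Rightarrow> pl_series) \<Rightarrow> (nat \<Rightarrow> pl_series \<Rightarrow> pl_series) \<Rightarrow> bool" where
  "weakly_well_defined_by D B Bs \<longleftrightarrow>
     is_operator D B \<and> (\<forall>j. is_operator D (Bs j)) \<and>
     (\<forall>g\<in>D. \<forall>p. (\<lambda>j. Bs j g p) sums B g p)"

definition vf_exp_term :: "pl_series \<Rightarrow> nat \<Rightarrow> pl_series \<Rightarrow> pl_series" where
  "vf_exp_term \<xi> n g = pl_scale (1 / fact n) ((vf_apply \<xi> ^^ n) g)"

definition vf_exp :: "pl_series \<Rightarrow> pl_series \<Rightarrow> pl_series" where
  "vf_exp \<xi> g = (\<lambda>p. \<Sum>n. vf_exp_term \<xi> n g p)"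

end

theory Submission
  imports Defs
begin

text \<open>All supports that occur lie in finitely many translates of a well-ordered additive monoid \<open>T\<close> of
  nonnegative monomials, so operators become triangular matrices with finite intervals, and every
  coefficient identity involves finitely many terms.

  Existence: the coefficients of the iterates of \<open>f\<close> satisfy triangular linear recurrences, hence are
  exponential polynomials in the number \<open>n\<close> of iterations. Replacing \<open>n\<close> by a real \<open>t\<close> gives a
  family \<open>f\<^sup>t\<close>. The flow identities hold for natural numbers, both sides are exponential
  polynomials in either parameter, and an exponential polynomial vanishing on the natural numbers is 0.
  The same interpolation principle yields the power laws needed for the associativity of composition.

  Uniqueness: differentiating \<open>f\<^sup>s \<circ> f\<^sup>t = f\<^sup>s\<^sup>+\<^sup>t\<close> in \<open>t\<close> at 0 gives the triangular linear system
  \<open>d/dt f\<^sup>t = X f\<^sup>t\<close>. At the first coefficient where the fields of two flows through \<open>f\<close> differ, Rolle's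
  theorem gives a contradiction. Taylor's theorem for this system gives \<open>f = exp(X) id\<close>.\<close>

subsection \<open>Well-ordered sets of monomials\<close>

text \<open>Interpolating the iterates f^n in n is ambiguous in general: sin (\<pi> t) vanishes at
  all integers. What rescues it is that composition with f = a x (1 + e) has the positive diagonal
  entries a^\<alpha>, so that only real exponents arise in the recurrences, and a nonzero
  exponential polynomial with real exponents has zeros that are bounded above. The entry a^\<alpha>
  is the same for all powers of \<ell>; this is why resonances, and with them polynomial factors in
  t, may occur. Two features of the definitions shape the rest. A C1-flow is not assumed to have
  leading exponent 1: the common well-ordered support enforces it, and only then is composition
  triangular. And \<open>pl_L\<close> and \<open>pl_LD\<close> are treated by the same argument with
  different monoids \<open>T\<close>; for \<open>pl_LD\<close> the monoid has to be finitely
  generated and still contain the support of f after division by x.\<close>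

locale linordered_group = linorder le lt
  for le :: "'a::ab_group_add \<Rightarrow> 'a \<Rightarrow> bool" (infix "\<sqsubseteq>" 50) and lt (infix "\<sqsubset>" 50) +
  assumes le_add_right_cancel [simp]: "p + r \<sqsubseteq> q + r \<longleftrightarrow> p \<sqsubseteq> q"
begin

lemma le_add_left_cancel [simp]: "r + p \<sqsubseteq> r + q \<longleftrightarrow> p \<sqsubseteq> q"
  using le_add_right_cancel[of p r q] by (simp only: add.commute)

lemma lt_add_right_cancel [simp]: "p + r \<sqsubset> q + r \<longleftrightarrow> p \<sqsubset> q"
  by (simp add: less_le)

lemma le_iff_diff: "p \<sqsubseteq> q \<longleftrightarrow> 0 \<sqsubseteq> q - p"
  using le_add_right_cancel[of 0 p "q - p"] by simp

lemma lt_iff_diff: "p \<sqsubset> q \<longleftrightarrow> 0 \<sqsubset> q - p"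
  using lt_add_right_cancel[of 0 p "q - p"] by simp

lemma le_diff_left_cancel [simp]: "r - p \<sqsubseteq> r - q \<longleftrightarrow> q \<sqsubseteq> p"
  using le_iff_diff[of "r - p" "r - q"] le_iff_diff[of q p] by (simp only: diff_diff_eq2 diff_add_cancel algebra_simps) simp

lemma add_mono_le: "p \<sqsubseteq> q \<Longrightarrow> r \<sqsubseteq> s \<Longrightarrow> p + r \<sqsubseteq> q + s"
  using order_trans[of "p + r" "q + r" "q + s"] by simp

lemma add_increasing_le: "0 \<sqsubseteq> r \<Longrightarrow> p \<sqsubseteq> p + r"
  using le_add_left_cancel[of p 0 r] by simp

text \<open>Stated through least elements because restrictions, unions and sums of sets are then
  handled directly; \<open>lex_well_ordered_iff\<close> links it with
  \<open>lex_well_ordered\<close>.\<close>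

definition WO :: "'a set \<Rightarrow> bool" where
  "WO S \<longleftrightarrow> (\<forall>C\<subseteq>S. C \<noteq> {} \<longrightarrow> (\<exists>m\<in>C. \<forall>c\<in>C. m \<sqsubseteq> c))"

lemma WO_Ex: "WO S \<Longrightarrow> C \<subseteq> S \<Longrightarrow> C \<noteq> {} \<Longrightarrow> \<exists>m\<in>C. \<forall>c\<in>C. m \<sqsubseteq> c"
  by (simp add: WO_def)

lemma WO_least:
  assumes "WO S" "x \<in> S" "P x"
  shows "\<exists>m\<in>S. P m \<and> (\<forall>c\<in>S. P c \<longrightarrow> m \<sqsubseteq> c)"
proof -
  have "{s \<in> S. P s} \<subseteq> S" "{s \<in> S. P s} \<noteq> {}" using assms by auto
  then have "\<exists>m\<in>{s \<in> S. P s}. \<forall>c\<in>{s \<in> S. P s}. m \<sqsubseteq> c"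
    using assms(1)[unfolded WO_def, rule_format, of "{s \<in> S. P s}"] by metis
  then show ?thesis by blast
qed

lemma WO_subset: "WO S \<Longrightarrow> R \<subseteq> S \<Longrightarrow> WO R"
  unfolding WO_def by (meson subset_trans)

lemma WO_empty [simp]: "WO {}"
  by (simp add: WO_def)

lemma WO_singleton [simp]: "WO {p}"
  by (auto simp: WO_def)

lemma WO_Un:
  assumes "WO S" "WO R" shows "WO (S \<union> R)"
  unfolding WO_def
proof (intro allI impI)
  fix C assume C: "C \<subseteq> S \<union> R" "C \<noteq> {}"
  show "\<exists>m\<in>C. \<forall>c\<in>C. m \<sqsubseteq> c"
  proof (cases "C \<inter> S = {} \<or> C \<inter> R = {}")
    case True
    then have "C \<subseteq> S \<or> C \<subseteq> R" using C by blast
    then show ?thesis using WO_Ex[OF assms(1)] WO_Ex[OF assms(2)] C(2) by metis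
  next
    case False
    obtain m where m: "m \<in> C \<inter> S" "\<And>c. c \<in> C \<inter> S \<Longrightarrow> m \<sqsubseteq> c"
      using WO_Ex[OF assms(1), of "C \<inter> S"] False by blast
    obtain n where n: "n \<in> C \<inter> R" "\<And>c. c \<in> C \<inter> R \<Longrightarrow> n \<sqsubseteq> c"
      using WO_Ex[OF assms(2), of "C \<inter> R"] False by blast
    show ?thesis
    proof (cases "m \<sqsubseteq> n")
      case True
      then have "m \<sqsubseteq> c" if "c \<in> C" for c
        using that C(1) m(2)[of c] n(2)[of c] order_trans[of m n c] by auto
      then show ?thesis using m(1) by (intro bexI[of _ m]) auto
    next
      case False
      then have "n \<sqsubseteq> m" using linear by blast
      then have "n \<sqsubseteq> c" if "c \<in> C" for c
        using that C(1) m(2)[of c] n(2)[of c] order_trans[of n m c] by auto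
      then show ?thesis using n(1) by (intro bexI[of _ n]) auto
    qed
  qed
qed

lemma WO_finite: "finite S \<Longrightarrow> WO S"
proof (induction S rule: finite_induct)
  case (insert p S)
  then show ?case using WO_Un[of "{p}" S] by simp
qed simp

lemma WO_image:
  assumes "WO S" "\<And>p q. p \<sqsubseteq> q \<Longrightarrow> f p \<sqsubseteq> f q" shows "WO (f ` S)"
  unfolding WO_def
proof (intro allI impI)
  fix C assume C: "C \<subseteq> f ` S" "C \<noteq> {}"
  then obtain x where "x \<in> S" "f x \<in> C" by blast
  then obtain m where m: "m \<in> S" "f m \<in> C" "\<forall>c\<in>S. f c \<in> C \<longrightarrow> m \<sqsubseteq> c"
    using WO_least[OF assms(1), of x "\<lambda>s. f s \<in> C"] by blast
  have "\<forall>c\<in>C. f m \<sqsubseteq> c"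
  proof
    fix c assume "c \<in> C"
    with C obtain s where "s \<in> S" "c = f s" by blast
    then show "f m \<sqsubseteq> c" using m(3) assms(2) \<open>c \<in> C\<close> by blast
  qed
  then show "\<exists>m\<in>C. \<forall>c\<in>C. m \<sqsubseteq> c" using m(2) by blast
qed

lemma WO_induct [consumes 2, case_names less]:
  assumes "WO S" "x \<in> S"
    and step: "\<And>x. x \<in> S \<Longrightarrow> (\<And>y. y \<in> S \<Longrightarrow> y \<sqsubset> x \<Longrightarrow> P y) \<Longrightarrow> P x"
  shows "P x"
proof (rule ccontr)
  assume "\<not> P x"
  then obtain m where m: "m \<in> S" "\<not> P m" "\<forall>c\<in>S. \<not> P c \<longrightarrow> m \<sqsubseteq> c"
    using WO_least[OF assms(1,2), of "\<lambda>y. \<not> P y"] by blast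
  then show False using step[of m] leD by blast
qed

definition sumset :: "'a set \<Rightarrow> 'a set \<Rightarrow> 'a set" where
  "sumset A B = {a + b |a b. a \<in> A \<and> b \<in> B}"

lemma sumsetI: "a \<in> A \<Longrightarrow> b \<in> B \<Longrightarrow> a + b \<in> sumset A B"
  by (auto simp: sumset_def)

text \<open>Choose a pair (a, b) with least first entry. A pair with a smaller sum has first entry
  at least a, hence second entry below b, so improving the pair is an induction on b inside
  \<open>B\<close>.\<close>

lemma WO_sumset:
  assumes "WO A" "WO B" shows "WO (sumset A B)"
proof -
  have key: "\<exists>(a, b)\<in>R. \<forall>(c, d)\<in>R. a + b \<sqsubseteq> c + d"
    if "b \<in> B" "R \<subseteq> A \<times> B" "(a, b) \<in> R" "\<And>c d. (c, d) \<in> R \<Longrightarrow> a \<sqsubseteq> c" for a b R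
    using assms(2) that
  proof (induction b arbitrary: a R rule: WO_induct)
    case (less b)
    define R' where "R' = {(c, d) \<in> R. c + d \<sqsubset> a + b}"
    show ?case
    proof (cases "R' = {}")
      case True
      then have "\<forall>(c, d)\<in>R. a + b \<sqsubseteq> c + d" unfolding R'_def by (auto simp: not_less[symmetric])
      then show ?thesis using less.prems by blast
    next
      case False
      then obtain c0 d0 where "(c0, d0) \<in> R'" by auto
      moreover have sub: "R' \<subseteq> A \<times> B" using less.prems(1) by (auto simp: R'_def)
      ultimately obtain c where c: "\<exists>d. (c, d) \<in> R'" "\<forall>c'\<in>A. (\<exists>d. (c', d) \<in> R') \<longrightarrow> c \<sqsubseteq> c'"
        using WO_least[OF assms(1), of c0 "\<lambda>c. \<exists>d. (c, d) \<in> R'"] by blast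
      then obtain d where d: "(c, d) \<in> R'" by blast
      then have cd: "(c, d) \<in> R" "c + d \<sqsubset> a + b" "a \<sqsubseteq> c" using less.prems by (auto simp: R'_def)
      then have "d \<sqsubset> b" by (meson add_mono_le leD not_le)
      moreover have "d \<in> B" using sub d by blast
      moreover have "c \<sqsubseteq> c'" if "(c', d') \<in> R'" for c' d' using c(2) that sub by blast
      ultimately have "\<exists>(u, v)\<in>R'. \<forall>(c, d)\<in>R'. u + v \<sqsubseteq> c + d"
        using less.IH[of d R' c] d sub by blast
      then obtain u v where uv: "(u, v) \<in> R'" "\<forall>(c, d)\<in>R'. u + v \<sqsubseteq> c + d" by blast
      have "u + v \<sqsubseteq> c' + d'" if "(c', d') \<in> R" for c' d'
      proof (cases "(c', d') \<in> R'")
        case False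
        then have "a + b \<sqsubseteq> c' + d'" using that by (auto simp: R'_def)
        moreover have "u + v \<sqsubset> a + b" using uv by (auto simp: R'_def)
        ultimately show ?thesis by (meson less_imp_le order_trans)
      qed (use uv in auto)
      then show ?thesis using uv(1) by (intro bexI[of _ "(u, v)"]) (auto simp: R'_def)
    qed
  qed
  show ?thesis unfolding WO_def
  proof (intro allI impI)
    fix C assume C: "C \<subseteq> sumset A B" "C \<noteq> {}"
    define R where "R = {(a, b). a \<in> A \<and> b \<in> B \<and> a + b \<in> C}"
    obtain a0 b0 where "(a0, b0) \<in> R" using C by (force simp: R_def sumset_def)
    moreover have sub: "R \<subseteq> A \<times> B" by (auto simp: R_def)
    ultimately obtain a where a: "\<exists>b. (a, b) \<in> R" "\<forall>c\<in>A. (\<exists>b. (c, b) \<in> R) \<longrightarrow> a \<sqsubseteq> c"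
      using WO_least[OF assms(1), of a0 "\<lambda>a. \<exists>b. (a, b) \<in> R"] by blast
    then obtain b where b: "(a, b) \<in> R" by blast
    have "a \<sqsubseteq> c" if "(c, d) \<in> R" for c d using a(2) that sub by blast
    then have "\<exists>(u, v)\<in>R. \<forall>(c, d)\<in>R. u + v \<sqsubseteq> c + d"
      using key[of b R a] b sub by blast
    then obtain u v where uv: "(u, v) \<in> R" "\<forall>(c, d)\<in>R. u + v \<sqsubseteq> c + d" by blast
    have "u + v \<sqsubseteq> c" if "c \<in> C" for c
    proof -
      have "c \<in> sumset A B" using that C by blast
      then obtain c1 c2 where "c = c1 + c2" "c1 \<in> A" "c2 \<in> B" by (auto simp: sumset_def)
      then show ?thesis using uv(2) that by (auto simp: R_def)
    qed
    then show "\<exists>m\<in>C. \<forall>c\<in>C. m \<sqsubseteq> c" using uv(1) by (intro bexI[of _ "u + v"]) (auto simp: R_def)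
  qed
qed

text \<open>The set of decompositions inherits least elements from \<open>A\<close> and, by reflection, greatest ones
  from \<open>B\<close>.\<close>
lemma finite_decomp:
  assumes "WO A" "WO B" shows "finite {a \<in> A. p - a \<in> B}"
proof -
  define S where "S = {a \<in> A. p - a \<in> B}"
  have greatest: "\<exists>m\<in>C. \<forall>c\<in>C. c \<sqsubseteq> m" if C: "C \<subseteq> S" "C \<noteq> {}" for C
  proof -
    have "(\<lambda>c. p - c) ` C \<subseteq> B" "(\<lambda>c. p - c) ` C \<noteq> {}" using C by (auto simp: S_def)
    then have "\<exists>m\<in>(\<lambda>c. p - c) ` C. \<forall>c\<in>(\<lambda>c. p - c) ` C. m \<sqsubseteq> c"
      using assms(2)[unfolded WO_def, rule_format, of "(\<lambda>c. p - c) ` C"] by metis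
    then show ?thesis by simp
  qed
  have wo: "WO S" using assms(1) by (rule WO_subset) (auto simp: S_def)
  \<comment> \<open>An element of \<open>S\<close> that is not least has an immediate predecessor z,
    the greatest element below it; its initial segment is that of z with one point added.\<close>
  have fin: "finite {y \<in> S. y \<sqsubseteq> x}" if "x \<in> S" for x
    using wo that
  proof (induction x rule: WO_induct)
    case (less x)
    have eq: "{y \<in> S. y \<sqsubseteq> x} = insert x {y \<in> S. y \<sqsubset> x}" using less by (auto simp: le_less)
    have "finite {y \<in> S. y \<sqsubset> x}"
    proof (cases "{y \<in> S. y \<sqsubset> x} = {}")
      case True
      then show ?thesis by (simp only: finite.emptyI)
    next
      case False
      then have "\<exists>m\<in>{y \<in> S. y \<sqsubset> x}. \<forall>c\<in>{y \<in> S. y \<sqsubset> x}. c \<sqsubseteq> m" by (intro greatest) auto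
      then obtain z where z: "z \<in> S" "z \<sqsubset> x" "\<forall>y\<in>S. y \<sqsubset> x \<longrightarrow> y \<sqsubseteq> z" by blast
      then have "{y \<in> S. y \<sqsubset> x} \<subseteq> {y \<in> S. y \<sqsubseteq> z}" by blast
      then show ?thesis using less.IH[OF z(1,2)] finite_subset by blast
    qed
    then show ?case unfolding eq by (rule finite.insertI)
  qed
  show ?thesis
  proof (cases "S = {}")
    case False
    then obtain x where "x \<in> S" "\<forall>y\<in>S. y \<sqsubseteq> x" using greatest[of S] by blast
    then have "{y \<in> S. y \<sqsubseteq> x} = S" by auto
    then show ?thesis using fin[OF \<open>x \<in> S\<close>] by (simp flip: S_def)
  qed (simp flip: S_def)
qed

end

definition lle :: "pl_monom \<Rightarrow> pl_monom \<Rightarrow> bool" (infix "\<sqsubseteq>" 50) where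
  "p \<sqsubseteq> q \<longleftrightarrow> fst p < fst q \<or> (fst p = fst q \<and> snd p \<le> snd q)"

definition llt :: "pl_monom \<Rightarrow> pl_monom \<Rightarrow> bool" (infix "\<sqsubset>" 50) where
  "p \<sqsubset> q \<longleftrightarrow> fst p < fst q \<or> (fst p = fst q \<and> snd p < snd q)"

interpretation lex: linordered_group lle llt
  by unfold_locales (auto simp: lle_def llt_def prod_eq_iff)

lemma lle_antisym: "p \<sqsubseteq> q \<Longrightarrow> q \<sqsubseteq> p \<Longrightarrow> p = q"
  by (auto simp: lle_def prod_eq_iff)

lemma in_lex_le_iff: "(p, q) \<in> lex_le \<longleftrightarrow> p \<sqsubseteq> q"
  by (cases p; cases q) (auto simp: lex_le_def lle_def)

abbreviation "WO \<equiv> lex.WO"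
abbreviation "sumset \<equiv> lex.sumset"

lemma lex_well_ordered_iff: "lex_well_ordered S \<longleftrightarrow> WO S"
proof
  assume "lex_well_ordered S"
  then have wf: "wf (Restr lex_le S - Id)"
    by (simp add: lex_well_ordered_def well_order_on_def)
  show "WO S" unfolding lex.WO_def
  proof (intro allI impI)
    fix C assume C: "C \<subseteq> S" "C \<noteq> {}"
    obtain m where "m \<in> C" and m: "\<And>y. (y, m) \<in> Restr lex_le S - Id \<Longrightarrow> y \<notin> C"
      using wf C(2) unfolding wf_eq_minimal by (metis ex_in_conv)
    have "m \<sqsubseteq> c" if "c \<in> C" for c
    proof (rule ccontr)
      assume "\<not> m \<sqsubseteq> c"
      then have "c \<sqsubseteq> m" "c \<noteq> m" using lex.linear by auto
      then have "(c, m) \<in> Restr lex_le S - Id"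
        using that \<open>m \<in> C\<close> C(1) by (auto simp: in_lex_le_iff)
      then show False using m that by blast
    qed
    then show "\<exists>m\<in>C. \<forall>c\<in>C. m \<sqsubseteq> c" using \<open>m \<in> C\<close> by blast
  qed
next
  assume wo: "WO S"
  have "wf (Restr lex_le S - Id)"
    unfolding wf_eq_minimal
  proof (intro allI impI)
    fix Q :: "pl_monom set" and x assume "x \<in> Q"
    show "\<exists>z\<in>Q. \<forall>y. (y, z) \<in> Restr lex_le S - Id \<longrightarrow> y \<notin> Q"
    proof (cases "Q \<inter> S = {}")
      case True
      then show ?thesis using \<open>x \<in> Q\<close> by blast
    next
      case False
      then obtain m where m: "m \<in> Q \<inter> S" "\<And>c. c \<in> Q \<inter> S \<Longrightarrow> m \<sqsubseteq> c"
        using lex.WO_Ex[OF wo, of "Q \<inter> S"] by (metis inf_le2)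
      have "y \<notin> Q" if "(y, m) \<in> Restr lex_le S - Id" for y
        using that m(2)[of y] lle_antisym[of y m] unfolding Diff_iff Int_iff in_lex_le_iff by blast
      then show ?thesis using m(1) by blast
    qed
  qed
  moreover have "refl_on S (Restr lex_le S)" "total_on S (Restr lex_le S)"
    using lex.linear by (auto simp: refl_on_def total_on_def in_lex_le_iff)
  moreover have "trans (Restr lex_le S)"
    unfolding trans_def Int_iff in_lex_le_iff by (blast intro: lex.order_trans)
  moreover have "antisym (Restr lex_le S)"
    unfolding antisym_def Int_iff in_lex_le_iff using lle_antisym by blast
  moreover have "Restr lex_le S \<subseteq> S \<times> S" by blast
  ultimately show "lex_well_ordered S"
    by (simp add: lex_well_ordered_def well_order_on_def linear_order_on_def partial_order_on_def
        preorder_on_def)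
qed

subsection \<open>Monoids of nonnegative monomials\<close>

text \<open>\<open>WO_T\<close> leaves a monomial finitely many divisors in \<open>T\<close>, and
  \<open>nonneg_T\<close> makes multiplication by \<open>T\<close> move upwards in the order;
  together they give triangularity. \<open>ell_T\<close> is there because both \<ell> \<circ> f and
  differentiation bring in additional factors \<ell>.\<close>

locale supp_monoid =
  fixes T :: "pl_monom set"
  assumes WO_T: "WO T" and zero_T: "0 \<in> T" and ell_T: "(0, 1) \<in> T"
    and add_T: "\<And>p q. p \<in> T \<Longrightarrow> q \<in> T \<Longrightarrow> p + q \<in> T"
    and nonneg_T: "\<And>p. p \<in> T \<Longrightarrow> 0 \<sqsubseteq> p"

text \<open>Built from \<open>add_semigroup\<close> and \<open>(0, 1)\<close> to match
  \<open>pl_LD\<close>, so that finitely generated supports stay recognizable.\<close>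

definition gen_monoid :: "pl_monom set \<Rightarrow> pl_monom set" where
  "gen_monoid P = insert 0 (add_semigroup (insert (0, 1) P))"

lemma gen_monoid_add: "p \<in> gen_monoid P \<Longrightarrow> q \<in> gen_monoid P \<Longrightarrow> p + q \<in> gen_monoid P"
  by (auto simp: gen_monoid_def intro: add_semigroup.add)

lemma gen_monoid_gen: "p \<in> P \<Longrightarrow> p \<in> gen_monoid P" "(0, 1) \<in> gen_monoid P"
  by (auto simp: gen_monoid_def intro: add_semigroup.gen)

text \<open>Generators with vanishing exponent of \<open>x\<close> are powers of \<open>\<ell>\<close> and are absorbed in \<open>m\<close>.\<close>
lemma gen_monoid_normal_form:
  assumes "\<And>p. p \<in> P \<Longrightarrow> 0 \<sqsubset> p" "s \<in> gen_monoid P"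
  obtains xs m where "set xs \<subseteq> {p \<in> P. 0 < fst p}" "s = sum_list xs + (0, int m)"
proof -
  have "\<exists>xs m. set xs \<subseteq> {p \<in> P. 0 < fst p} \<and> s = sum_list xs + (0, int m)"
    if "s \<in> add_semigroup (insert (0, 1) P)"
    using that
  proof (induction rule: add_semigroup.induct)
    case (gen p)
    show ?case
    proof (cases "p \<in> P \<and> 0 < fst p")
      case True
      then show ?thesis by (intro exI[of _ "[p]"] exI[of _ 0]) (auto simp: prod_eq_iff)
    next
      case False
      then have "fst p = 0" "0 < snd p" using gen assms(1)[of p] by (auto simp: llt_def)
      then show ?thesis by (intro exI[of _ "[]"] exI[of _ "nat (snd p)"]) (auto simp: prod_eq_iff)
    qed
  next
    case (add p q)
    then obtain xs m ys n where "set xs \<subseteq> {p \<in> P. 0 < fst p}" "p = sum_list xs + (0, int m)"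
      "set ys \<subseteq> {p \<in> P. 0 < fst p}" "q = sum_list ys + (0, int n)" by blast
    then show ?case by (intro exI[of _ "xs @ ys"] exI[of _ "m + n"]) (auto simp: prod_eq_iff)
  qed
  moreover have "\<exists>xs m. set xs \<subseteq> {p \<in> P. 0 < fst p} \<and> (0::pl_monom) = sum_list xs + (0, int m)"
    by (intro exI[of _ "[]"] exI[of _ 0]) (auto simp: prod_eq_iff)
  ultimately show thesis using that assms(2) by (auto simp: gen_monoid_def)
qed

lemma fst_sum_list_ge:
  fixes xs :: "pl_monom list"
  assumes "\<And>p. p \<in> set xs \<Longrightarrow> a \<le> fst p" shows "real (length xs) * a \<le> fst (sum_list xs)"
  using assms by (induction xs) (fastforce simp: algebra_simps)+

text \<open>Below a given exponent of \<open>x\<close> only sums of a bounded number of generators occur, because the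
  positive exponents of the generators have a positive minimum.\<close>
lemma supp_monoid_gen_monoid:
  assumes "WO P" "\<And>p. p \<in> P \<Longrightarrow> 0 \<sqsubset> p"
  shows "supp_monoid (gen_monoid P)"
proof
  define P' where "P' = {p \<in> P. 0 < fst p}"
  have woP': "WO P'" using assms(1) by (rule lex.WO_subset) (auto simp: P'_def)
  obtain a where a: "0 < a" "\<And>p. p \<in> P' \<Longrightarrow> a \<le> fst p"
  proof (cases "P' = {}")
    case False
    then obtain m where m: "m \<in> P'" "\<And>c. c \<in> P' \<Longrightarrow> m \<sqsubseteq> c" using lex.WO_Ex[OF woP', of P'] by blast
    show thesis
    proof (rule that[of "fst m"])
      show "0 < fst m" using m(1) by (simp add: P'_def)
      show "fst m \<le> fst p" if "p \<in> P'" for p using m(2)[OF that] by (auto simp: lle_def)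
    qed
  qed (use that[of 1] in auto)
  define V where "V n = {sum_list xs |xs. set xs \<subseteq> P' \<and> length xs \<le> n}" for n
  have woV: "WO (V n)" for n
  proof (induction n)
    case 0
    then show ?case by (simp add: V_def)
  next
    case (Suc n)
    have "V (Suc n) \<subseteq> V n \<union> sumset P' (V n)"
    proof
      fix v assume "v \<in> V (Suc n)"
      then obtain xs where xs: "v = sum_list xs" "set xs \<subseteq> P'" "length xs \<le> Suc n" by (auto simp: V_def)
      then show "v \<in> V n \<union> sumset P' (V n)"
      proof (cases xs)
        case Nil
        then show ?thesis using xs by (auto simp: V_def intro!: exI[of _ "[]"])
      next
        case (Cons y ys)
        then have "sum_list ys \<in> V n" using xs by (auto simp: V_def)
        then show ?thesis using Cons xs by (auto intro: lex.sumsetI)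
      qed
    qed
    then show ?case by (rule lex.WO_subset[OF lex.WO_Un[OF Suc lex.WO_sumset[OF woP' Suc]]])
  qed
  define N where "N = (\<lambda>m. (0::real, int m)) ` UNIV"
  have woN: "WO N" unfolding lex.WO_def
  proof (intro allI impI)
    fix C assume C: "C \<subseteq> N" "C \<noteq> {}"
    define m where "m = (LEAST m. (0, int m) \<in> C)"
    obtain m0 where "(0, int m0) \<in> C" using C by (auto simp: N_def)
    then have "(0, int m) \<in> C" unfolding m_def by (rule LeastI)
    moreover have "(0, int m) \<sqsubseteq> c" if "c \<in> C" for c
      using C that Least_le[of "\<lambda>m. (0, int m) \<in> C"] by (fastforce simp: N_def m_def lle_def)
    ultimately show "\<exists>m\<in>C. \<forall>c\<in>C. m \<sqsubseteq> c" by blast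
  qed
  have repr: "s \<in> sumset (V n) N" if s: "s \<in> gen_monoid P" and n: "fst s \<le> real n * a" for s n
  proof -
    obtain xs m where xs: "set xs \<subseteq> P'" "s = sum_list xs + (0, int m)"
      using gen_monoid_normal_form[OF assms(2) s] unfolding P'_def by metis
    have "real (length xs) * a \<le> fst (sum_list xs)" using a xs by (intro fst_sum_list_ge) auto
    then have "real (length xs) * a \<le> real n * a" using xs n by simp
    then have "length xs \<le> n" using a by simp
    then show ?thesis using xs by (auto simp: V_def N_def intro!: lex.sumsetI)
  qed
  show "WO (gen_monoid P)" unfolding lex.WO_def
  proof (intro allI impI)
    fix C assume C: "C \<subseteq> gen_monoid P" "C \<noteq> {}"
    then obtain c where c: "c \<in> C" by blast
    obtain n where n: "fst c \<le> real n * a" using a(1) by (metis reals_Archimedean3 less_imp_le)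
    \<comment> \<open>A least element of \<open>C\<close> has exponent of x at most that of c, and
      such elements are sums of at most n generators of positive exponent and a power of
      \<ell>.\<close>
    define C' where "C' = {d \<in> C. fst d \<le> fst c}"
    have "C' \<subseteq> sumset (V n) N" using C n by (auto simp: C'_def intro!: repr)
    moreover have "c \<in> C'" using c by (simp add: C'_def)
    then have "C' \<noteq> {}" by blast
    moreover have "WO (sumset (V n) N)" using woV woN by (rule lex.WO_sumset)
    ultimately obtain m where m: "m \<in> C'" "\<And>d. d \<in> C' \<Longrightarrow> m \<sqsubseteq> d"
      using lex.WO_Ex by metis
    have "m \<sqsubseteq> d" if "d \<in> C" for d
      using m that by (cases "fst d \<le> fst c") (auto simp: C'_def lle_def)
    then show "\<exists>m\<in>C. \<forall>c\<in>C. m \<sqsubseteq> c" using m(1) unfolding C'_def by blast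
  qed
  show "0 \<sqsubseteq> s" if s: "s \<in> gen_monoid P" for s
  proof -
    obtain xs m where xs: "set xs \<subseteq> P'" "s = sum_list xs + (0, int m)"
      using gen_monoid_normal_form[OF assms(2) s] unfolding P'_def by metis
    have "real (length xs) * a \<le> fst (sum_list xs)" using a xs by (intro fst_sum_list_ge) auto
    moreover have "0 < real (length xs) * a" if "xs \<noteq> []" using that a by simp
    ultimately show ?thesis using xs by (cases "xs = []") (auto simp: lle_def)
  qed
qed (auto simp: gen_monoid_def intro: add_semigroup.gen add_semigroup.add)

text \<open>Dividing by \<open>x\<close>: the shortest initial part of a sum of generators whose exponent of \<open>x\<close> exceeds 1
  has bounded length.\<close>
lemma finitely_generated_shift:
  assumes "finite G" "G \<subseteq> positive_monoms"
  obtains G' where "finite G'" "G' \<subseteq> positive_monoms"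
    "\<And>s. s \<in> add_semigroup (insert (0, 1) G) \<Longrightarrow> (1, 0) \<sqsubseteq> s \<Longrightarrow> s - (1, 0) \<in> gen_monoid G'"
proof -
  obtain a where a: "0 < a" "\<And>p. p \<in> G \<Longrightarrow> a \<le> fst p"
  proof (cases "G = {}")
    case False
    show thesis
    proof (rule that[of "Min (fst ` G)"])
      have "Min (fst ` G) \<in> fst ` G" using False assms by (intro Min_in) auto
      then show "0 < Min (fst ` G)" using assms by (auto simp: positive_monoms_def)
    qed (use assms in auto)
  qed (use that[of 1] in auto)
  obtain K :: nat where K: "1 < real K * a" using a(1) reals_Archimedean3 by blast
  \<comment> \<open>Before the critical generator the exponent is at most 1 < K a, so at most K
    generators reach beyond 1. The finitely many overshoots, divided by x, become new
    generators.\<close>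
  define H where "H = {zs. set zs \<subseteq> G \<and> length zs \<le> K \<and> 1 < fst (sum_list zs)}"
  define G' where "G' = G \<union> (\<lambda>zs. sum_list zs - (1, 0)) ` H"
  have "H \<subseteq> {zs. set zs \<subseteq> G \<and> length zs \<le> K}" by (auto simp: H_def)
  then have finH: "finite H" using finite_lists_length_le[OF assms(1)] finite_subset by blast
  have elt: "sum_list ws \<in> gen_monoid G'" if "set ws \<subseteq> G" for ws
    using that
  proof (induction ws)
    case Nil
    then show ?case by (simp add: gen_monoid_def)
  next
    case (Cons w ws)
    then have "w \<in> gen_monoid G'" by (intro gen_monoid_gen) (simp add: G'_def)
    then show ?case using Cons gen_monoid_add by simp
  qed
  have ell: "(0, int m) \<in> gen_monoid G'" for m
  proof (induction m)
    case 0
    then show ?case by (simp add: gen_monoid_def zero_prod_def)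
  next
    case (Suc m)
    then show ?case using gen_monoid_add[OF gen_monoid_gen(2) Suc] by (simp add: add_ac)
  qed
  have pos: "\<And>p. p \<in> G \<Longrightarrow> 0 \<sqsubset> p" using assms(2) by (auto simp: positive_monoms_def llt_def)
  have "s - (1, 0) \<in> gen_monoid G'"
    if s: "s \<in> add_semigroup (insert (0, 1) G)" and ge: "(1, 0) \<sqsubseteq> s" for s
  proof -
    have sG: "s \<in> gen_monoid G" using s by (simp add: gen_monoid_def)
    obtain xs m where "set xs \<subseteq> {p \<in> G. 0 < fst p}" and s_eq: "s = sum_list xs + (0, int m)"
      by (rule gen_monoid_normal_form[OF pos sG])
    then have xs: "set xs \<subseteq> G" "s = sum_list xs + (0, int m)" by auto
    show ?thesis
    proof (cases "1 < fst s")
      \<comment> \<open>The exponent of x is exactly 1 here, so only a nonnegative power of \<ell>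
        remains.\<close>
      case False
      then have "s - (1, 0) = (0, int (nat (snd s)))" using ge by (auto simp: lle_def prod_eq_iff)
      then show ?thesis using ell by metis
    next
      case True
      then have ex: "1 < fst (sum_list (take (length xs) xs))" using xs by simp
      define n where "n = (LEAST n. 1 < fst (sum_list (take n xs)))"
      have n: "1 < fst (sum_list (take n xs))" "n \<le> length xs"
        unfolding n_def using ex by (rule LeastI, rule Least_le)
      have "n \<noteq> 0" using n by (intro notI) simp
      have "\<not> 1 < fst (sum_list (take (n - 1) xs))"
        using not_less_Least[of "n - 1"] \<open>n \<noteq> 0\<close> unfolding n_def by (metis diff_less less_one neq0_conv)
      moreover have "real (length (take (n - 1) xs)) * a \<le> fst (sum_list (take (n - 1) xs))"
        using a xs by (intro fst_sum_list_ge) (auto dest!: in_set_takeD)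
      ultimately have "real (n - 1) * a < real K * a" using K n by (simp add: min_def split: if_splits)
      then have "n \<le> K" using a by auto
      then have "take n xs \<in> H" using n xs by (auto simp: H_def dest: in_set_takeD)
      then have "sum_list (take n xs) - (1, 0) \<in> gen_monoid G'"
        by (intro gen_monoid_gen) (auto simp: G'_def)
      moreover have "sum_list (drop n xs) \<in> gen_monoid G'" using xs by (intro elt) (auto dest: in_set_dropD)
      moreover have "sum_list xs = sum_list (take n xs) + sum_list (drop n xs)"
        by (metis append_take_drop_id sum_list_append)
      then have "s - (1, 0) = (sum_list (take n xs) - (1, 0)) + sum_list (drop n xs) + (0, int m)"
        using xs by (simp add: prod_eq_iff)
      ultimately show ?thesis using ell by (metis gen_monoid_add)
    qed
  qed
  moreover have "finite G'" using assms finH by (simp add: G'_def)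
  moreover have "0 < fst (sum_list zs - (1, 0))" if "zs \<in> H" for zs using that by (simp add: H_def)
  then have "G' \<subseteq> positive_monoms"
    using assms(2) unfolding G'_def by (fastforce simp: positive_monoms_def mem_Times_iff)
  ultimately show thesis using that by blast
qed

subsection \<open>The ring of generalized power series\<close>

text \<open>The Hahn series ring over the group of all monomials, negative exponents included, since
  \<epsilon>, log f and derivatives leave \<open>positive_monoms\<close>. Being a type, it can be
  made an instance of \<open>comm_ring_1\<close>.\<close>

typedef hahn = "{f :: pl_series. WO (supp f)}" morphisms coef Hahn
  by (rule exI[of _ "\<lambda>_. 0"]) (simp add: supp_def)

lemma WO_supp_coef [simp]: "WO (supp (coef f))"
  using coef[of f] by simp

lemma coef_Hahn: "WO S \<Longrightarrow> supp f \<subseteq> S \<Longrightarrow> coef (Hahn f) = f"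
  using lex.WO_subset by (intro Hahn_inverse) auto

lemma hahn_eqI: "(\<And>p. coef f p = coef g p) \<Longrightarrow> f = g"
  using coef_inject by blast

lemma in_supp_iff: "p \<in> supp f \<longleftrightarrow> f p \<noteq> 0"
  by (simp add: supp_def)

lemma finite_decomp_supp: "finite {q \<in> supp (coef f). p - q \<in> supp (coef g)}"
  by (rule lex.finite_decomp) simp_all

lemma pl_mult_eq_sum:
  assumes "finite Q" "{q \<in> supp f. p - q \<in> supp g} \<subseteq> Q"
  shows "pl_mult f g p = (\<Sum>q\<in>Q. f q * g (p - q))"
  unfolding pl_mult_def
  by (rule sum.mono_neutral_left) (use assms in \<open>auto simp: supp_def\<close>)

lemma supp_pl_mult: "supp (pl_mult f g) \<subseteq> sumset (supp f) (supp g)"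
proof
  fix p assume "p \<in> supp (pl_mult f g)"
  then have "(\<Sum>q | f q \<noteq> 0 \<and> g (p - q) \<noteq> 0. f q * g (p - q)) \<noteq> 0"
    by (simp add: supp_def pl_mult_def)
  then have "{q. f q \<noteq> 0 \<and> g (p - q) \<noteq> 0} \<noteq> {}" by (metis sum.empty)
  then obtain q where "f q \<noteq> 0" "g (p - q) \<noteq> 0" by blast
  then show "p \<in> sumset (supp f) (supp g)"
    using lex.sumsetI[of q "supp f" "p - q" "supp g"] by (simp add: in_supp_iff)
qed

instantiation hahn :: comm_ring_1
begin

definition "0 = Hahn (\<lambda>_. 0)"
definition "1 = Hahn (term_of 1 0)"
definition "f + g = Hahn (\<lambda>p. coef f p + coef g p)"
definition "f - g = Hahn (\<lambda>p. coef f p - coef g p)"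
definition "- f = Hahn (\<lambda>p. - coef f p)"
definition "f * g = Hahn (pl_mult (coef f) (coef g))"

lemma coef_zero [simp]: "coef 0 p = 0"
  by (simp add: zero_hahn_def coef_Hahn[of "{}"] supp_def)

lemma coef_one: "coef 1 = term_of 1 0"
  by (simp add: one_hahn_def coef_Hahn[of "{0}"] supp_def term_of_def)

lemma coef_add [simp]: "coef (f + g) p = coef f p + coef g p"
  unfolding plus_hahn_def
  by (subst coef_Hahn[OF lex.WO_Un[OF WO_supp_coef[of f] WO_supp_coef[of g]]]) (auto simp: supp_def)

lemma coef_diff [simp]: "coef (f - g) p = coef f p - coef g p"
  unfolding minus_hahn_def
  by (subst coef_Hahn[OF lex.WO_Un[OF WO_supp_coef[of f] WO_supp_coef[of g]]]) (auto simp: supp_def)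

lemma coef_uminus [simp]: "coef (- f) p = - coef f p"
  unfolding uminus_hahn_def by (subst coef_Hahn[OF WO_supp_coef[of f]]) (auto simp: supp_def)

lemma coef_mult: "coef (f * g) = pl_mult (coef f) (coef g)"
  unfolding times_hahn_def by (rule coef_Hahn[OF _ supp_pl_mult]) (simp add: lex.WO_sumset)

lemma coef_mult_eq_sum:
  assumes "finite Q" "\<And>q. coef f q \<noteq> 0 \<Longrightarrow> coef g (p - q) \<noteq> 0 \<Longrightarrow> q \<in> Q"
  shows "coef (f * g) p = (\<Sum>q\<in>Q. coef f q * coef g (p - q))"
  unfolding coef_mult by (rule pl_mult_eq_sum) (use assms in \<open>auto simp: supp_def\<close>)

lemma coef_mult_sum: "coef (f * g) p = (\<Sum>q\<in>{q \<in> supp (coef f). p - q \<in> supp (coef g)}. coef f q * coef g (p - q))"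
  by (rule coef_mult_eq_sum[OF finite_decomp_supp]) (simp add: supp_def)

text \<open>A sum over exactly the index pairs with nonzero factors is invariant under cyclic
  rotation of f, g, h up to renaming; together with commutativity this yields associativity.\<close>

lemma coef_mult3:
  defines "K \<equiv> (\<lambda>f g h p. {(q, r). coef f q \<noteq> 0 \<and> coef g r \<noteq> 0 \<and> coef h (p - q - r) \<noteq> 0})"
  shows "coef (f * (g * h)) p = (\<Sum>(q, r)\<in>K f g h p. coef f q * coef g r * coef h (p - q - r))"
proof -
  define A where "A = {q \<in> supp (coef f). p - q \<in> sumset (supp (coef g)) (supp (coef h))}"
  define R where "R q = {r \<in> supp (coef g). p - q - r \<in> supp (coef h)}" for q
  have finA: "finite A" unfolding A_def by (intro lex.finite_decomp lex.WO_sumset WO_supp_coef)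
  have finR: "finite (R q)" for q unfolding R_def by (rule finite_decomp_supp)
  have K: "K f g h p = Sigma A R"
  proof (intro set_eqI)
    fix z :: "pl_monom \<times> pl_monom"
    obtain q r where z: "z = (q, r)" by (rule prod.exhaust)
    have "p - q \<in> sumset (supp (coef g)) (supp (coef h))" if "coef g r \<noteq> 0" "coef h (p - q - r) \<noteq> 0"
      using lex.sumsetI[of r "supp (coef g)" "p - q - r" "supp (coef h)"] that by (simp add: in_supp_iff)
    then show "z \<in> K f g h p \<longleftrightarrow> z \<in> Sigma A R"
      unfolding z K_def A_def R_def by (simp add: in_supp_iff) blast
  qed
  have "coef (f * (g * h)) p = (\<Sum>q\<in>A. coef f q * coef (g * h) (p - q))"
    using supp_pl_mult[of "coef g" "coef h"]
    by (intro coef_mult_eq_sum[OF finA]) (simp add: A_def in_supp_iff coef_mult subset_iff del: split_paired_All)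
  also have "\<dots> = (\<Sum>q\<in>A. \<Sum>r\<in>R q. coef f q * coef g r * coef h (p - q - r))"
    unfolding coef_mult_sum R_def by (simp add: sum_distrib_left mult.assoc)
  also have "\<dots> = (\<Sum>(q, r)\<in>Sigma A R. coef f q * coef g r * coef h (p - q - r))"
    using finA finR by (intro sum.Sigma) auto
  finally show ?thesis by (simp add: K)
qed

instance
proof
  fix f g h :: hahn
  show comm: "f * g = g * f" for f g :: hahn
  proof (rule hahn_eqI)
    fix p
    show "coef (f * g) p = coef (g * f) p"
      unfolding coef_mult_sum
      by (rule sum.reindex_bij_witness[of _ "\<lambda>q. p - q" "\<lambda>q. p - q"]) (auto simp: mult.commute)
  qed
  have "f * (g * h) = h * (f * g)"
  proof (rule hahn_eqI)
    fix p
    show "coef (f * (g * h)) p = coef (h * (f * g)) p"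
      unfolding coef_mult3
      by (rule sum.reindex_bij_witness[of _ "\<lambda>(c, a). (a, p - c - a)" "\<lambda>(q, r). (p - q - r, q)"])
        (auto simp: algebra_simps)
  qed
  then show "f * g * h = f * (g * h)" by (simp add: comm[of "f * g" h])
  show "1 * f = f"
  proof (rule hahn_eqI)
    fix p
    have "coef (1 * f) p = (\<Sum>q\<in>{0}. coef 1 q * coef f (p - q))"
      by (rule coef_mult_eq_sum) (auto simp: coef_one term_of_def split: if_splits)
    then show "coef (1 * f) p = coef f p" by (simp add: coef_one term_of_def)
  qed
  show "(f + g) * h = f * h + g * h"
  proof (rule hahn_eqI)
    fix p
    define Q where "Q = {q \<in> supp (coef f) \<union> supp (coef g). p - q \<in> supp (coef h)}"
    have "finite Q" unfolding Q_def by (intro lex.finite_decomp lex.WO_Un WO_supp_coef)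
    moreover have "q \<in> Q" if "coef h (p - q) \<noteq> 0" "coef f q \<noteq> 0 \<or> coef g q \<noteq> 0" for q
      using that by (simp add: Q_def in_supp_iff)
    ultimately have "coef ((f + g) * h) p = (\<Sum>q\<in>Q. coef (f + g) q * coef h (p - q))"
      "coef (f * h) p = (\<Sum>q\<in>Q. coef f q * coef h (p - q))"
      "coef (g * h) p = (\<Sum>q\<in>Q. coef g q * coef h (p - q))"
      by (intro coef_mult_eq_sum; force)+
    then show "coef ((f + g) * h) p = coef (f * h + g * h) p"
      by (simp add: sum.distrib algebra_simps)
  qed
  show "(0::hahn) \<noteq> 1"
  proof
    assume "(0::hahn) = 1"
    then have "coef 0 0 = coef 1 0" by simp
    then show False by (simp add: coef_one term_of_def)
  qed
qed (auto intro!: hahn_eqI)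

end

definition C :: "real \<Rightarrow> hahn" where
  "C c = Hahn (term_of c 0)"

definition M :: "pl_monom \<Rightarrow> hahn" where
  "M p = Hahn (term_of 1 p)"

lemma coef_term_of: "coef (Hahn (term_of c p)) = term_of c p"
  by (rule coef_Hahn[of "{p}"]) (auto simp: supp_def term_of_def)

lemma coef_C: "coef (C c) = term_of c 0"
  by (simp add: C_def coef_term_of)

lemma coef_M: "coef (M p) = term_of 1 p"
  by (simp add: M_def coef_term_of)

lemma coef_C_mult [simp]: "coef (C c * f) p = c * coef f p"
proof -
  have "coef (C c * f) p = (\<Sum>q\<in>{0}. coef (C c) q * coef f (p - q))"
    by (rule coef_mult_eq_sum) (auto simp: coef_C term_of_def split: if_splits)
  then show ?thesis by (simp add: coef_C term_of_def)
qed

lemma coef_M_mult [simp]: "coef (M q * f) p = coef f (p - q)"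
proof -
  have "coef (M q * f) p = (\<Sum>r\<in>{q}. coef (M q) r * coef f (p - r))"
    by (rule coef_mult_eq_sum) (auto simp: coef_M term_of_def split: if_splits)
  then show ?thesis by (simp add: coef_M term_of_def)
qed

lemma C_0 [simp]: "C 0 = 0" and C_1 [simp]: "C 1 = 1"
  and C_add: "C (a + b) = C a + C b"
  and C_mult: "C (a * b) = C a * C b" and C_uminus: "C (- a) = - C a"
  by (rule hahn_eqI; simp add: coef_C term_of_def coef_one)+

lemma M_0 [simp]: "M 0 = 1" and M_add: "M (p + q) = M p * M q"
  by (rule hahn_eqI; simp add: coef_M coef_one term_of_def algebra_simps)+

lemma Hahn_term_of: "Hahn (term_of c p) = C c * M p"
  by (rule hahn_eqI, unfold coef_C_mult coef_term_of coef_M) (simp add: term_of_def)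

lemma pl_power_coef: "pl_power (coef f) n = coef (f ^ n)"
  by (induction n) (simp_all add: pl_power_def coef_one coef_mult zero_prod_def)

lemma pl_scale_coef: "pl_scale c (coef f) = coef (C c * f)"
  by (simp add: pl_scale_def fun_eq_iff)

lemma pl_add_coef: "pl_add (coef f) (coef g) = coef (f + g)"
  by (simp add: pl_add_def fun_eq_iff)

subsection \<open>Series supported in a monoid of nonnegative monomials\<close>

context supp_monoid
begin

definition A :: "hahn set" where
  "A = {f. supp (coef f) \<subseteq> T}"

text \<open>As 0 is the least element of \<open>T\<close>, these are the series in \<open>A\<close>
  with all monomials above 0, the ones that can be substituted into formal power series.\<close>

definition I :: "hahn set" where
  "I = {f \<in> A. coef f 0 = 0}"

text \<open>The divisors of p within \<open>T\<close>. Their number serves as truncation length; by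
  \<open>card_decomp_mono\<close> the length chosen for p suffices for each divisor of p.\<close>

definition decomp :: "pl_monom \<Rightarrow> pl_monom set" where
  "decomp p = {q \<in> T. p - q \<in> T}"

lemma finite_decomp [simp]: "finite (decomp p)"
  unfolding decomp_def by (rule lex.finite_decomp[OF WO_T WO_T])

lemma decomp_zero: "decomp 0 = {0}"
proof -
  have "q = 0" if "q \<in> T" "- q \<in> T" for q
    using nonneg_T[OF that(1)] nonneg_T[OF that(2)] by (auto simp: lle_def prod_eq_iff)
  then show ?thesis using zero_T by (auto simp: decomp_def)
qed

lemma card_decomp_mono: "q \<in> decomp p \<Longrightarrow> card (decomp q) \<le> card (decomp p)"
proof (rule card_mono[OF finite_decomp], rule subsetI)
  fix r assume "q \<in> decomp p" "r \<in> decomp q"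
  then have "(p - q) + (q - r) \<in> T" "r \<in> T" using add_T[of "p - q" "q - r"] by (simp_all add: decomp_def)
  then show "r \<in> decomp p" by (simp add: decomp_def)
qed

lemma decomp_sym: "q \<in> decomp p \<Longrightarrow> p - q \<in> decomp p"
  by (simp add: decomp_def)

lemma A_coef: "f \<in> A \<Longrightarrow> p \<notin> T \<Longrightarrow> coef f p = 0"
  by (auto simp: A_def supp_def)

lemma A_I: "(\<And>p. p \<notin> T \<Longrightarrow> coef f p = 0) \<Longrightarrow> f \<in> A"
  by (auto simp: A_def supp_def)

lemma I_A: "f \<in> I \<Longrightarrow> f \<in> A"
  by (simp add: I_def)

lemma coef_A_mult:
  "f \<in> A \<Longrightarrow> g \<in> A \<Longrightarrow> coef (f * g) p = (\<Sum>q\<in>decomp p. coef f q * coef g (p - q))"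
  by (rule coef_mult_eq_sum[OF finite_decomp]) (auto simp: decomp_def dest: A_coef)

lemma A_zero [simp]: "0 \<in> A" and A_one [simp]: "1 \<in> A" and A_C [simp]: "C c \<in> A"
  by (rule A_I; use zero_T in \<open>auto simp: coef_one coef_C term_of_def\<close>)+

lemma A_M: "p \<in> T \<Longrightarrow> M p \<in> A"
  by (rule A_I) (auto simp: coef_M term_of_def)

lemma A_add [intro]: "f \<in> A \<Longrightarrow> g \<in> A \<Longrightarrow> f + g \<in> A"
  and A_diff [intro]: "f \<in> A \<Longrightarrow> g \<in> A \<Longrightarrow> f - g \<in> A"
  and A_uminus [intro]: "f \<in> A \<Longrightarrow> - f \<in> A"
  by (rule A_I; simp add: A_coef)+

lemma A_mult [intro]:
  assumes "f \<in> A" "g \<in> A" shows "f * g \<in> A"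
proof (rule A_I)
  fix p assume "p \<notin> T"
  then have "decomp p = {}" using add_T[of _ "p - _"] by (force simp: decomp_def)
  then show "coef (f * g) p = 0" by (simp add: coef_A_mult assms)
qed

lemma A_power [intro]: "f \<in> A \<Longrightarrow> f ^ n \<in> A"
  by (induction n) auto

lemma coef_mult_zero: "f \<in> A \<Longrightarrow> g \<in> A \<Longrightarrow> coef (f * g) 0 = coef f 0 * coef g 0"
  by (simp add: coef_A_mult decomp_zero)

lemma I_add [intro]: "f \<in> I \<Longrightarrow> g \<in> I \<Longrightarrow> f + g \<in> I"
  and I_uminus [intro]: "f \<in> I \<Longrightarrow> - f \<in> I"
  and I_mult_left [intro]: "h \<in> A \<Longrightarrow> f \<in> I \<Longrightarrow> h * f \<in> I"
  and I_mult_right [intro]: "f \<in> I \<Longrightarrow> h \<in> A \<Longrightarrow> f * h \<in> I"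
  by (auto simp: I_def coef_mult_zero)

lemma I_zero [simp]: "0 \<in> I"
  by (simp add: I_def)

abbreviation ell :: hahn where "ell \<equiv> M (0, 1)"

lemma ell_in_I [simp]: "ell \<in> I"
  using ell_T by (simp add: I_def A_M coef_M term_of_def zero_prod_def)

text \<open>The partial sums of a decomposition of \<open>p\<close> into \<open>j\<close> nonzero elements of \<open>T\<close> are \<open>j + 1\<close>
  distinct elements of \<open>decomp p\<close>.\<close>
lemma coef_power_I:
  assumes "e \<in> I" "card (decomp p) \<le> j" shows "coef (e ^ j) p = 0"
proof -
  have "j < card (decomp p)" if "coef (e ^ j) p \<noteq> 0"
    using that
  proof (induction j arbitrary: p)
    case 0
    then have "p = 0" by (simp add: coef_one term_of_def split: if_splits)
    then show ?case by (simp add: decomp_zero)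
  next
    case (Suc j)
    have "(\<Sum>q\<in>decomp p. coef e q * coef (e ^ j) (p - q)) \<noteq> 0"
      using Suc.prems assms(1) by (simp add: coef_A_mult I_A A_power)
    then obtain q where q: "q \<in> decomp p" "coef e q \<noteq> 0" "coef (e ^ j) (p - q) \<noteq> 0"
      by (metis (mono_tags, lifting) mult_eq_0_iff sum.neutral)
    have "q \<noteq> 0" using q assms(1) by (auto simp: I_def)
    have qT: "q \<in> T" "p - q \<in> T" using q by (auto simp: decomp_def)
    then have "0 \<sqsubset> q" using nonneg_T[of q] \<open>q \<noteq> 0\<close> by (simp add: lex.less_le)
    have sub: "insert 0 ((\<lambda>r. q + r) ` decomp (p - q)) \<subseteq> decomp p"
      using qT add_T[of q] add_T[OF qT] zero_T by (auto simp: decomp_def algebra_simps)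
    have "0 \<notin> (\<lambda>r. q + r) ` decomp (p - q)"
    proof
      assume "0 \<in> (\<lambda>r. q + r) ` decomp (p - q)"
      then obtain r where "r \<in> T" "0 = q + r" by (auto simp: decomp_def)
      then show False using nonneg_T[of r] \<open>0 \<sqsubset> q\<close> lex.add_increasing_le[of r q] lex.leD by metis
    qed
    then have "card (insert 0 ((\<lambda>r. q + r) ` decomp (p - q))) = Suc (card (decomp (p - q)))"
      by (simp add: card_image inj_on_def)
    then have "Suc (card (decomp (p - q))) \<le> card (decomp p)"
      using card_mono[OF finite_decomp sub] by simp
    then show ?case using Suc.IH[OF q(3)] by simp
  qed
  then show ?thesis using assms(2) by (meson not_le)
qed

text \<open>Substitution of e into the power series c. For e in \<open>I\<close> the cut-off drops
  only zero terms, by \<open>coef_power_I\<close>.\<close>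

definition ev :: "real fps \<Rightarrow> hahn \<Rightarrow> hahn" where
  "ev c e = Hahn (\<lambda>p. \<Sum>j<card (decomp p). fps_nth c j * coef (e ^ j) p)"

lemma coef_ev_card:
  assumes "e \<in> I" shows "coef (ev c e) p = (\<Sum>j<card (decomp p). fps_nth c j * coef (e ^ j) p)"
proof -
  have "supp (\<lambda>p. \<Sum>j<card (decomp p). fps_nth c j * coef (e ^ j) p) \<subseteq> T"
    using A_coef[OF A_power[OF I_A[OF assms]]] unfolding supp_def by fastforce
  then show ?thesis unfolding ev_def using coef_Hahn[OF WO_T] by simp
qed

lemma coef_ev:
  assumes "e \<in> I" "card (decomp p) \<le> N"
  shows "coef (ev c e) p = (\<Sum>j<N. fps_nth c j * coef (e ^ j) p)"
  unfolding coef_ev_card[OF assms(1)]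
  by (rule sum.mono_neutral_left) (use assms coef_power_I in auto)

lemma ev_A [intro]: "e \<in> I \<Longrightarrow> ev c e \<in> A"
  using A_coef[OF A_power[OF I_A]] by (intro A_I) (simp add: coef_ev_card)

lemma coef_ev_zero: "e \<in> I \<Longrightarrow> coef (ev c e) 0 = fps_nth c 0"
  by (simp add: coef_ev_card decomp_zero coef_one term_of_def)

lemma ev_add: "e \<in> I \<Longrightarrow> ev (c + d) e = ev c e + ev d e"
  by (rule hahn_eqI) (simp add: coef_ev_card sum.distrib algebra_simps)

lemma ev_const: "e \<in> I \<Longrightarrow> ev (fps_const r) e = C r"
proof (rule hahn_eqI)
  fix p assume e: "e \<in> I"
  have "coef (ev (fps_const r) e) p = (\<Sum>j<Suc (card (decomp p)). fps_nth (fps_const r) j * coef (e ^ j) p)"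
    using e by (intro coef_ev) auto
  also have "\<dots> = coef (C r) p"
    by (subst sum.lessThan_Suc_shift) (simp add: coef_one coef_C term_of_def)
  finally show "coef (ev (fps_const r) e) p = coef (C r) p" .
qed

lemma ev_1: "e \<in> I \<Longrightarrow> ev 1 e = 1"
  using ev_const[of e 1] by simp

lemma ev_X: "e \<in> I \<Longrightarrow> ev fps_X e = e"
proof (rule hahn_eqI)
  fix p assume e: "e \<in> I"
  have "coef (ev fps_X e) p = (\<Sum>j<Suc (Suc (card (decomp p))). fps_nth fps_X j * coef (e ^ j) p)"
    using e by (intro coef_ev) auto
  also have "\<dots> = coef e p"
    by (subst sum.lessThan_Suc_shift, subst sum.lessThan_Suc_shift) (simp add: fps_X_def)
  finally show "coef (ev fps_X e) p = coef e p" .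
qed

text \<open>The truncation length N of p works for both factors at all divisors of p. In the
  resulting square of index pairs only the triangle i + j < N contributes, since higher powers of e
  vanish at p. This transfers identities of formal power series to \<open>hahn\<close>.\<close>

lemma ev_mult:
  assumes e: "e \<in> I" shows "ev (c * d) e = ev c e * ev d e"
proof (rule hahn_eqI)
  fix p
  define N where "N = card (decomp p)"
  let ?E = "\<lambda>j p. coef (e ^ j) p"
  have "coef (ev c e * ev d e) p = (\<Sum>q\<in>decomp p. coef (ev c e) q * coef (ev d e) (p - q))"
    using e by (simp add: coef_A_mult ev_A)
  also have "\<dots> = (\<Sum>q\<in>decomp p. (\<Sum>i<N. fps_nth c i * ?E i q) * (\<Sum>j<N. fps_nth d j * ?E j (p - q)))"
    unfolding N_def using e card_decomp_mono decomp_sym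
    by (intro sum.cong refl arg_cong2[where f = "(*)"] coef_ev) auto
  also have "\<dots> = (\<Sum>i<N. \<Sum>j<N. fps_nth c i * fps_nth d j * (\<Sum>q\<in>decomp p. ?E i q * ?E j (p - q)))"
    unfolding sum_product
    by (subst sum.swap, rule sum.cong[OF refl], subst sum.swap) (simp add: sum_distrib_left algebra_simps)
  also have "\<dots> = (\<Sum>i<N. \<Sum>j<N. fps_nth c i * fps_nth d j * ?E (i + j) p)"
    using e by (simp add: power_add coef_A_mult A_power I_A)
  also have "\<dots> = (\<Sum>(i, j)\<in>{..<N} \<times> {..<N}. fps_nth c i * fps_nth d j * ?E (i + j) p)"
    by (simp add: sum.cartesian_product)
  also have "\<dots> = (\<Sum>(i, j)\<in>{(i, j). i + j < N}. fps_nth c i * fps_nth d j * ?E (i + j) p)"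
  proof (intro sum.mono_neutral_right ballI)
    fix z assume "z \<in> {..<N} \<times> {..<N} - {(i, j). i + j < N}"
    then obtain i j where "z = (i, j)" "N \<le> i + j" by (cases z) auto
    then show "(case z of (i, j) \<Rightarrow> fps_nth c i * fps_nth d j * ?E (i + j) p) = 0"
      using coef_power_I[OF e, of p "i + j"] by (simp add: N_def)
  qed auto
  also have "\<dots> = (\<Sum>k<N. \<Sum>i\<le>k. fps_nth c i * fps_nth d (k - i) * ?E (i + (k - i)) p)"
    by (rule sum.triangle_reindex)
  also have "\<dots> = coef (ev (c * d) e) p"
    using e by (simp add: coef_ev_card N_def fps_mult_nth sum_distrib_right atLeast0AtMost)
  finally show "coef (ev (c * d) e) p = coef (ev c e * ev d e) p" by simp
qed

lemma ev_power: "e \<in> I \<Longrightarrow> ev (c ^ n) e = ev c e ^ n"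
  by (induction n) (simp_all add: ev_1 ev_mult)

end

subsection \<open>Exponential polynomials\<close>

text \<open>Exponential polynomials, presented as the functions annihilated by a product of operators
  \<open>d/dt - c\<close> with real \<open>c\<close>.\<close>
inductive EP :: "(real \<Rightarrow> real) \<Rightarrow> bool" where
  EP_zero: "EP (\<lambda>_. 0)"
| EP_step: "EP h \<Longrightarrow> (\<And>t. (e has_real_derivative c * e t + h t) (at t)) \<Longrightarrow> EP e"

lemma exp_integrating_factor:
  assumes "\<And>t. (e has_real_derivative c * e t + h t) (at t)"
  shows "((\<lambda>t. exp (- c * t) * e t) has_real_derivative exp (- c * t) * h t) (at t)"
  by (rule derivative_eq_intros assms refl)+ (simp add: algebra_simps)

lemma linear_ode_homogeneous:
  assumes "\<And>t. (e has_real_derivative c * e t) (at t)"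
  shows "e t = e 0 * exp (c * t)"
proof -
  have "((\<lambda>t. exp (- c * t) * e t) has_real_derivative 0) (at t)" for t
    using exp_integrating_factor[of e c "\<lambda>_. 0"] assms by simp
  then have "exp (- c * t) * e t = exp (- c * 0) * e 0"
    using DERIV_isconst_all[of "\<lambda>t. exp (- c * t) * e t"] by blast
  then show ?thesis by (simp add: exp_minus field_simps)
qed

text \<open>By Rolle's theorem, applied to \<open>exp (- c t) e t\<close>, the zeros of \<open>e' - c e\<close> are unbounded
  if those of \<open>e\<close> are.\<close>
lemma EP_eq_zero:
  assumes "EP e" "\<And>N. \<exists>t>N. e t = 0" shows "e t = 0"
  using assms
proof (induction arbitrary: t rule: EP.induct)
  case (EP_step h e c)
  have "\<exists>t>N. h t = 0" for N
  proof -
    obtain a where a: "a > N" "e a = 0" using EP_step.prems by blast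
    obtain b where b: "b > a" "e b = 0" using EP_step.prems by blast
    have "\<exists>z>a. z < b \<and> exp (- c * b) * e b - exp (- c * a) * e a = (b - a) * (exp (- c * z) * h z)"
      using b(1) exp_integrating_factor[OF EP_step.hyps(2)]
      by (intro MVT2[where f = "\<lambda>t. exp (- c * t) * e t"]) auto
    then obtain z where "a < z" "exp (- c * z) * h z = 0" using a b by auto
    then show ?thesis using a by (intro exI[of _ z]) auto
  qed
  then have "h t = 0" for t using EP_step.IH by blast
  then have hom: "e t = e 0 * exp (c * t)" for t
    using EP_step.hyps(2) by (intro linear_ode_homogeneous) simp
  obtain s where "e s = 0" using EP_step.prems by blast
  then have "e 0 = 0" using hom[of s] by simp
  then show ?case using hom[of t] by simp
qed simp

text \<open>The added multiple of e is what sums need: d/dt - c sends e + f to h + (f' - c f), whose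
  first summand is simpler.\<close>

lemma EP_deriv:
  assumes "EP e"
  obtains e' where "\<And>t. (e has_real_derivative e' t) (at t)" "\<And>d. EP (\<lambda>t. e' t + d * e t)"
proof -
  have "\<exists>e'. (\<forall>t. (e has_real_derivative e' t) (at t)) \<and> (\<forall>d. EP (\<lambda>t. e' t + d * e t))"
    using assms
  proof (induction rule: EP.induct)
    case EP_zero
    show ?case by (rule exI[of _ "\<lambda>_. 0"]) (simp add: EP.EP_zero)
  next
    case (EP_step h e c)
    then obtain h' where h': "\<And>t. (h has_real_derivative h' t) (at t)" "\<And>d. EP (\<lambda>t. h' t + d * h t)"
      by blast
    have "EP (\<lambda>t. (c * e t + h t) + d * e t)" for d
    proof (rule EP.EP_step[OF h'(2)])
      show "((\<lambda>t. c * e t + h t + d * e t) has_real_derivative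
          c * (c * e t + h t + d * e t) + (h' t + d * h t)) (at t)" for t
        by (rule derivative_eq_intros EP_step.hyps(2) h'(1) refl)+ (simp add: algebra_simps)
    qed
    then show ?case using EP_step.hyps(2) by (intro exI[of _ "\<lambda>t. c * e t + h t"]) blast
  qed
  then show thesis using that by blast
qed

lemma EP_cmult: "EP e \<Longrightarrow> EP (\<lambda>t. k * e t)"
proof (induction rule: EP.induct)
  case (EP_step h e c)
  show ?case
    by (rule EP.EP_step[OF EP_step.IH, of _ c])
      (rule derivative_eq_intros EP_step.hyps(2) refl | simp add: algebra_simps)+
qed (simp add: EP.EP_zero)

lemma EP_add: "EP e \<Longrightarrow> EP f \<Longrightarrow> EP (\<lambda>t. e t + f t)"
proof (induction arbitrary: f rule: EP.induct)
  case (EP_step h e c)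
  obtain f' where f': "\<And>t. (f has_real_derivative f' t) (at t)" "\<And>d. EP (\<lambda>t. f' t + d * f t)"
    using EP_deriv[OF EP_step.prems] by metis
  show ?case
    by (rule EP.EP_step[OF EP_step.IH[OF f'(2)[of "- c"]], of _ c])
      (rule derivative_eq_intros EP_step.hyps(2) f'(1) refl | simp add: algebra_simps)+
qed simp

text \<open>If e' = c e + h and f' = d f + k, then (e f)' = (c + d) e f + (h f + e k), and each of
  the last two products has one simpler factor; hence the nested induction.\<close>

lemma EP_mult: "EP e \<Longrightarrow> EP f \<Longrightarrow> EP (\<lambda>t. e t * f t)"
proof (induction arbitrary: f rule: EP.induct)
  case (EP_step h e c)
  note e = EP_step.hyps(2) and h = EP_step.IH
  show ?case using EP_step.prems
  proof (induction rule: EP.induct)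
    case (EP_step k f d)
    have "EP (\<lambda>t. h t * f t + e t * k t)"
      by (rule EP_add[OF h[OF EP.EP_step[OF EP_step.hyps]] EP_step.IH])
    then show ?case
      by (rule EP.EP_step[of _ _ "c + d"])
        (rule derivative_eq_intros e EP_step.hyps(2) refl | simp add: algebra_simps)+
  qed (simp add: EP.EP_zero)
qed (simp add: EP.EP_zero)

lemma EP_exp: "EP (\<lambda>t. exp (c * t))"
  by (rule EP_step[OF EP_zero, of _ c]) (rule derivative_eq_intros refl | simp)+

lemma EP_const: "EP (\<lambda>_. k)"
  using EP_cmult[OF EP_exp[of 0], of k] by simp

lemma EP_ident: "EP (\<lambda>t. t)"
  by (rule EP_step[OF EP_const[of 1], of _ 0]) simp

lemma EP_uminus: "EP e \<Longrightarrow> EP (\<lambda>t. - e t)"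
  using EP_cmult[of e "-1"] by simp

lemma EP_diff: "EP e \<Longrightarrow> EP f \<Longrightarrow> EP (\<lambda>t. e t - f t)"
  using EP_add[OF _ EP_uminus] by fastforce

lemma EP_sum: "(\<And>i. i \<in> J \<Longrightarrow> EP (e i)) \<Longrightarrow> EP (\<lambda>t. \<Sum>i\<in>J. e i t)"
  by (induction J rule: infinite_finite_induct) (auto intro: EP_zero EP_add)

lemma EP_prod: "(\<And>i. i \<in> J \<Longrightarrow> EP (e i)) \<Longrightarrow> EP (\<lambda>t. \<Prod>i\<in>J. e i t)"
  by (induction J rule: infinite_finite_induct) (auto intro: EP_const EP_mult)

lemma EP_gbinomial: "EP (\<lambda>t. t gchoose j)"
  unfolding gbinomial_prod_rev divide_inverse
  by (intro EP_mult EP_prod EP_diff EP_ident EP_const)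

lemma EP_powr: "a > 0 \<Longrightarrow> EP (\<lambda>t. a powr (c * t))"
  using EP_exp[of "ln a * c"] by (simp add: powr_def mult_ac)

text \<open>The interpolation principle: the natural numbers are unbounded, so
  \<open>EP_eq_zero\<close> applies to the difference.\<close>

lemma EP_eqI:
  assumes "EP e" "EP f" "\<And>n::nat. e (real n) = f (real n)" shows "e t = f t"
proof -
  have "\<exists>s>N. e s - f s = 0" for N
    using assms(3) reals_Archimedean2[of N] by auto
  then show ?thesis using EP_eq_zero[OF EP_diff[OF assms(1,2)]] by simp
qed

lemma EP_continuous: "EP e \<Longrightarrow> continuous_on UNIV e"
  by (rule EP_deriv) (auto intro!: continuous_at_imp_continuous_on DERIV_isCont)

lemma EP_C1: assumes "EP e" shows "e C1_differentiable_on UNIV"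
proof -
  obtain e' where e': "\<And>t. (e has_real_derivative e' t) (at t)" "\<And>d. EP (\<lambda>t. e' t + d * e t)"
    using EP_deriv[OF assms] by metis
  then show ?thesis
    using EP_continuous[OF e'(2)[of 0]]
    by (auto simp: C1_differentiable_on_def has_real_derivative_iff_has_vector_derivative intro!: exI[of _ e'])
qed

text \<open>Undetermined coefficients, with the resonant case \<open>exp d = c\<close>.\<close>
lemma EP_recurrence_exp:
  assumes "c > 0" obtains v where "EP v" "\<And>t. v (t + 1) = c * v t + exp (d * t)"
proof (cases "exp d = c")
  case True
  show thesis
  proof (rule that[of "\<lambda>t. t * exp (d * t) / c"])
    show "EP (\<lambda>t. t * exp (d * t) / c)"
      unfolding divide_inverse by (intro EP_mult EP_ident EP_exp EP_const)
    show "(t + 1) * exp (d * (t + 1)) / c = c * (t * exp (d * t) / c) + exp (d * t)" for t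
      using assms unfolding True[symmetric] by (simp add: distrib_left exp_add field_simps)
  qed
next
  case False
  show thesis
  proof (rule that[of "\<lambda>t. exp (d * t) / (exp d - c)"])
    show "EP (\<lambda>t. exp (d * t) / (exp d - c))"
      unfolding divide_inverse by (intro EP_mult EP_exp EP_const)
    show "exp (d * (t + 1)) / (exp d - c) = c * (exp (d * t) / (exp d - c)) + exp (d * t)" for t
      using False by (simp add: distrib_left exp_add field_simps)
  qed
qed

lemma EP_antiderivative:
  assumes "EP e" obtains G where "\<And>t. (G has_real_derivative e t) (at t)"
proof -
  have "\<exists>G. \<forall>x::real. -\<infinity> < ereal x \<longrightarrow> ereal x < \<infinity> \<longrightarrow> (G has_vector_derivative e x) (at x)"
    using EP_continuous[OF assms]
    by (intro einterval_antiderivative) (auto simp: continuous_on_eq_continuous_at)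
  then show thesis using that by (auto simp: has_real_derivative_iff_has_vector_derivative)
qed

text \<open>Induction on e with e' = d e + h. If z solves the recurrence for h, any y with y' = d y
  + z has a defect w = y(t + 1) - c y(t) - e(t) satisfying w' = d w. So w is a multiple of exp (d
  t), which \<open>EP_recurrence_exp\<close> removes.\<close>

lemma EP_recurrence:
  assumes "c > 0" "EP e"
  obtains y where "EP y" "y 0 = y0" "\<And>t. y (t + 1) = c * y t + e t"
proof -
  have "\<exists>y. EP y \<and> (\<forall>t. y (t + 1) = c * y t + e t)"
    using assms(2)
  proof (induction rule: EP.induct)
    case EP_zero
    show ?case by (rule exI[of _ "\<lambda>_. 0"]) (simp add: EP.EP_zero)
  next
    case (EP_step h e d)
    obtain z where z: "EP z" "\<And>t. z (t + 1) = c * z t + h t" using EP_step.IH by blast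
    obtain G where G: "\<And>t. (G has_real_derivative exp (- d * t) * z t) (at t)"
      using EP_antiderivative[OF EP_mult[OF EP_exp z(1)]] by metis
    define y where "y t = exp (d * t) * G t" for t
    have y': "(y has_real_derivative d * y t + z t) (at t)" for t
      unfolding y_def
      by (rule derivative_eq_intros G refl)+ (simp add: exp_minus)
    define w where "w t = y (t + 1) - c * y t - e t" for t
    have ys: "((\<lambda>t. y (t + 1)) has_real_derivative d * y (t + 1) + z (t + 1)) (at t)" for t
      using DERIV_shift[of y "d * y (t + 1) + z (t + 1)" t 1] y' by simp
    have "(w has_real_derivative d * w t) (at t)" for t
      unfolding w_def
      by (rule derivative_eq_intros ys y' EP_step.hyps(2) refl)+ (simp add: z(2)[of t] right_diff_distrib distrib_left mult.left_commute mult.commute)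
    then have w: "w t = w 0 * exp (d * t)" for t by (rule linear_ode_homogeneous)
    obtain v where v: "EP v" "\<And>t. v (t + 1) = c * v t + exp (d * t)"
      using EP_recurrence_exp[OF assms(1), where d = d] by metis
    have "EP y" using EP.EP_step[OF z(1) y'] .
    moreover have "y (t + 1) - w 0 * v (t + 1) = c * (y t - w 0 * v t) + e t" for t
      using w[of t] by (simp add: w_def[of t] v(2)[of t] right_diff_distrib distrib_left)
    ultimately show ?case
      using v(1) by (intro exI[of _ "\<lambda>t. y t - w 0 * v t"]) (auto intro: EP_diff EP_cmult)
  qed
  then obtain y where y: "EP y" "\<And>t. y (t + 1) = c * y t + e t" by blast
  show thesis
  \<comment> \<open>The homogeneous solution c^t adjusts the value at 0; for real t it relies on c >
    0.\<close>
  proof (rule that[of "\<lambda>t. y t + (y0 - y 0) * c powr (1 * t)"])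
    show "EP (\<lambda>t. y t + (y0 - y 0) * c powr (1 * t))"
      using assms(1) by (intro EP_add EP_cmult EP_powr y(1))
  qed (use assms(1) y(2) in \<open>auto simp: powr_add algebra_simps\<close>)
qed

subsection \<open>One-parameter families of series\<close>

context supp_monoid
begin

definition EPfam :: "(real \<Rightarrow> hahn) \<Rightarrow> bool" where
  "EPfam g \<longleftrightarrow> (\<forall>t. g t \<in> A) \<and> (\<forall>p. EP (\<lambda>t. coef (g t) p))"

lemma EPfam_const: "g \<in> A \<Longrightarrow> EPfam (\<lambda>_. g)"
  by (simp add: EPfam_def EP_const)

lemma EPfam_C: "EP e \<Longrightarrow> EPfam (\<lambda>t. C (e t))"
proof -
  assume "EP e"
  then have "EP (\<lambda>t. coef (C (e t)) p)" for p
    using EP_zero by (cases "p = 0") (simp_all add: coef_C term_of_def)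
  then show ?thesis by (simp add: EPfam_def)
qed

lemma EPfam_add: "EPfam g \<Longrightarrow> EPfam h \<Longrightarrow> EPfam (\<lambda>t. g t + h t)"
  and EPfam_diff: "EPfam g \<Longrightarrow> EPfam h \<Longrightarrow> EPfam (\<lambda>t. g t - h t)"
  and EPfam_uminus: "EPfam g \<Longrightarrow> EPfam (\<lambda>t. - g t)"
  by (auto simp: EPfam_def intro: EP_add EP_diff EP_uminus)

lemma EPfam_mult: "EPfam g \<Longrightarrow> EPfam h \<Longrightarrow> EPfam (\<lambda>t. g t * h t)"
  by (auto simp: EPfam_def coef_A_mult simp del: split_paired_All intro!: EP_sum EP_mult)

lemma EPfam_power: "EPfam g \<Longrightarrow> EPfam (\<lambda>t. g t ^ n)"
  by (induction n) (auto intro: EPfam_mult EPfam_const)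

lemma EPfam_ev: "EPfam g \<Longrightarrow> (\<And>t. g t \<in> I) \<Longrightarrow> EPfam (\<lambda>t. ev c (g t))"
  using EPfam_power[of g] ev_A
  by (simp add: EPfam_def coef_ev_card EP_sum EP_cmult del: split_paired_All)

lemma EPfam_eqI:
  assumes "EPfam g" "EPfam h" "\<And>n::nat. g (real n) = h (real n)" shows "g t = h t"
proof (rule hahn_eqI)
  fix p
  show "coef (g t) p = coef (h t) p"
  proof (rule EP_eqI[of "\<lambda>t. coef (g t) p" "\<lambda>t. coef (h t) p"])
    show "EP (\<lambda>t. coef (g t) p)" "EP (\<lambda>t. coef (h t) p)"
      using assms(1,2) by (simp_all only: EPfam_def)
  qed (simp add: assms(3))
qed

text \<open>Derivatives are taken at 0 only; the flow law carries them to all other times.\<close>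

definition DER :: "(real \<Rightarrow> hahn) \<Rightarrow> hahn \<Rightarrow> bool" where
  "DER g g' \<longleftrightarrow> (\<forall>t. g t \<in> A) \<and> g' \<in> A \<and>
     (\<forall>p. ((\<lambda>t. coef (g t) p) has_real_derivative coef g' p) (at 0))"

lemma DER_coef: "DER g g' \<Longrightarrow> ((\<lambda>t. coef (g t) p) has_real_derivative coef g' p) (at 0)"
  by (simp only: DER_def)

lemma DER_const: "g \<in> A \<Longrightarrow> DER (\<lambda>_. g) 0"
  by (simp add: DER_def)

lemma DER_C: "(e has_real_derivative e') (at 0) \<Longrightarrow> DER (\<lambda>t. C (e t)) (C e')"
  by (auto simp: DER_def coef_C term_of_def)

lemma DER_add: "DER g g' \<Longrightarrow> DER h h' \<Longrightarrow> DER (\<lambda>t. g t + h t) (g' + h')"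
  and DER_uminus: "DER g g' \<Longrightarrow> DER (\<lambda>t. - g t) (- g')"
  by (auto simp: DER_def intro: DERIV_add DERIV_diff DERIV_minus)

lemma DER_mult:
  assumes "DER g g'" "DER h h'" shows "DER (\<lambda>t. g t * h t) (g' * h 0 + g 0 * h')"
proof -
  have A: "g t \<in> A" "h t \<in> A" "g' \<in> A" "h' \<in> A" for t using assms by (simp_all add: DER_def)
  have "((\<lambda>t. coef (g t * h t) p) has_real_derivative coef (g' * h 0 + g 0 * h') p) (at 0)" for p
  proof -
    have d: "((\<lambda>t. coef (g t) q * coef (h t) (p - q)) has_real_derivative
        coef g' q * coef (h 0) (p - q) + coef (g 0) q * coef h' (p - q)) (at 0)" for q
      using DERIV_mult[of "\<lambda>t. coef (g t) q" "coef g' q" 0 UNIV "\<lambda>t. coef (h t) (p - q)" "coef h' (p - q)"]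
        DER_coef[OF assms(1)] DER_coef[OF assms(2)] by (simp add: add.commute mult.commute)
    have "((\<lambda>t. \<Sum>q\<in>decomp p. coef (g t) q * coef (h t) (p - q)) has_real_derivative
        (\<Sum>q\<in>decomp p. coef g' q * coef (h 0) (p - q) + coef (g 0) q * coef h' (p - q))) (at 0)"
      using d by (rule DERIV_sum)
    then show ?thesis by (simp add: coef_A_mult A sum.distrib)
  qed
  then show ?thesis using A by (simp add: DER_def A_mult A_add)
qed

lemma DER_power:
  assumes "DER g g'" "g 0 = 0" shows "DER (\<lambda>t. g t ^ j) (if j = 1 then g' else 0)"
proof -
  consider "j = 0" | "j = 1" | i where "j = Suc (Suc i)" by (metis One_nat_def not0_implies_Suc)
  then show ?thesis
  proof cases
    case (3 i)
    \<comment> \<open>Existence is enough: the product rule multiplies this derivative by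
      \<open>g 0 = 0\<close>.\<close>
    have "\<exists>h'. DER (\<lambda>t. g t ^ n) h'" for n
    proof (induction n)
      case 0
      show ?case using DER_const[OF A_one] by auto
    next
      case (Suc n)
      then show ?case using DER_mult[OF assms(1)] by auto
    qed
    then obtain h' where "DER (\<lambda>t. g t ^ Suc i) h'" by blast
    from DER_mult[OF assms(1) this] show ?thesis using assms(2) 3 by simp
  qed (use assms DER_const in auto)
qed

lemma DER_ev:
  assumes "DER g g'" "g 0 = 0" "\<And>t. g t \<in> I"
  shows "DER (\<lambda>t. ev c (g t)) (C (fps_nth c 1) * g')"
proof -
  have "((\<lambda>t. coef (ev c (g t)) p) has_real_derivative coef (C (fps_nth c 1) * g') p) (at 0)" for p
  proof -
    let ?N = "Suc (Suc (card (decomp p)))"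
    have "((\<lambda>t. \<Sum>j<?N. fps_nth c j * coef (g t ^ j) p) has_real_derivative
        (\<Sum>j<?N. fps_nth c j * coef (if j = 1 then g' else 0) p)) (at 0)"
      by (intro DERIV_sum DERIV_cmult DER_coef DER_power[OF assms(1,2)])
    moreover have "(\<Sum>j<?N. fps_nth c j * coef (if j = 1 then g' else 0) p) = fps_nth c 1 * coef g' p"
      by (subst sum.lessThan_Suc_shift, subst sum.lessThan_Suc_shift) simp
    moreover have "coef (ev c (g t)) p = (\<Sum>j<?N. fps_nth c j * coef (g t ^ j) p)" for t
      using assms(3) by (intro coef_ev) auto
    ultimately show ?thesis by simp
  qed
  then show ?thesis using assms by (simp add: DER_def A_mult ev_A)
qed

subsection \<open>Real powers and logarithms of series with constant term 1\<close>

text \<open>The real power (1 + e)^a, as a binomial series.\<close>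

definition pw :: "real \<Rightarrow> hahn \<Rightarrow> hahn" where
  "pw a e = ev (fps_binomial a) e"

text \<open>This is log (1 + e): \<open>fps_ln 1\<close> is the series of log (1 + X).\<close>

definition lg :: "hahn \<Rightarrow> hahn" where
  "lg e = ev (fps_ln 1) e"

lemma pw_A: "e \<in> I \<Longrightarrow> pw a e \<in> A"
  by (auto simp: pw_def)

lemma coef_pw_zero: "e \<in> I \<Longrightarrow> coef (pw a e) 0 = 1"
  by (simp add: pw_def coef_ev_zero)

lemma pw_0: "e \<in> I \<Longrightarrow> pw 0 e = 1"
  by (simp add: pw_def ev_1)

lemma pw_of_nat: "e \<in> I \<Longrightarrow> pw (real n) e = (1 + e) ^ n"
  by (simp add: pw_def fps_binomial_of_nat ev_power ev_add ev_1 ev_X)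

lemma pw_1: "e \<in> I \<Longrightarrow> pw 1 e = 1 + e"
  using pw_of_nat[of e 1] by simp

lemma pw_add: "e \<in> I \<Longrightarrow> pw (a + b) e = pw a e * pw b e"
  by (simp add: pw_def fps_binomial_add_mult ev_mult)

lemma pw_minus: "e \<in> I \<Longrightarrow> pw (- a) e * pw a e = 1"
  by (simp flip: pw_add add: pw_0)

lemma EPfam_pw_exponent: "e \<in> I \<Longrightarrow> EPfam (\<lambda>a. pw a e)"
  by (auto simp: EPfam_def pw_def coef_ev_card simp del: split_paired_All
      intro!: EP_sum EP_mult EP_gbinomial EP_const)

lemma one_plus_mult_in_I: "e \<in> I \<Longrightarrow> d \<in> I \<Longrightarrow> e + d + e * d \<in> I"
  by (intro I_add I_mult_left I_A)

text \<open>Both sides are polynomial in the exponent, so that natural exponents suffice.\<close>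
lemma pw_mult:
  assumes "e \<in> I" "d \<in> I" shows "pw a e * pw a d = pw a (e + d + e * d)"
proof (rule EPfam_eqI[where g = "\<lambda>a. pw a e * pw a d"])
  have "(1 + e) * (1 + d) = 1 + (e + d + e * d)" by (simp add: algebra_simps)
  then show "pw (real n) e * pw (real n) d = pw (real n) (e + d + e * d)" for n
    using assms one_plus_mult_in_I by (simp add: pw_of_nat flip: power_mult_distrib)
qed (use assms one_plus_mult_in_I in \<open>auto intro!: EPfam_mult EPfam_pw_exponent\<close>)

text \<open>Coefficientwise form of log (1 + X) = d/dt (1 + X)^t at t = 0. For j > 0, splitting off
  t / j from the binomial leaves the value of (t - 1 choose j - 1) at t = 0, which is a
  sign.\<close>

lemma gbinomial_deriv_zero:
  "((\<lambda>t::real. t gchoose j) has_real_derivative fps_nth (fps_ln 1) j) (at 0)"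
proof (cases j)
  case (Suc i)
  obtain h' where h': "((\<lambda>t::real. t gchoose i) has_real_derivative h') (at (-1))"
    using EP_deriv[OF EP_gbinomial[of i]] by metis
  then have "((\<lambda>t. (t - 1) gchoose i) has_real_derivative h') (at 0)"
    using DERIV_shift[of "\<lambda>t::real. t gchoose i" h' 0 "-1"] by simp
  then have "((\<lambda>t. t / real (Suc i) * ((t - 1) gchoose i)) has_real_derivative
      ((0 - 1) gchoose i) / real (Suc i)) (at 0)"
    by (auto intro!: derivative_eq_intros)
  moreover have "(t::real) gchoose j = t / real (Suc i) * ((t - 1) gchoose i)" for t
    using gbinomial_absorption[of i t] by (simp add: Suc field_simps)
  moreover have "((- 1 :: real) gchoose i) = (- 1) ^ i"
    using gbinomial_minus[of "1::real" i] by (simp flip: binomial_gbinomial)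
  ultimately show ?thesis by (simp add: Suc fps_ln_nth)
qed simp

lemma DER_pw_exponent: "e \<in> I \<Longrightarrow> DER (\<lambda>a. pw a e) (lg e)"
  unfolding DER_def pw_def lg_def
  using gbinomial_deriv_zero
  by (auto simp: coef_ev_card simp del: split_paired_All intro!: DERIV_sum DERIV_cmult_right)

lemma DER_unique: "DER g g' \<Longrightarrow> DER g h' \<Longrightarrow> g' = h'"
  by (rule hahn_eqI) (auto simp: DER_def simp del: split_paired_All intro: DERIV_unique)

text \<open>Differentiate (1 + e)^a (1 + d)^a = ((1 + e) (1 + d))^a at a = 0; e + d + e d is (1 + e)
  (1 + d) - 1.\<close>

lemma lg_mult:
  assumes "e \<in> I" "d \<in> I" shows "lg (e + d + e * d) = lg e + lg d"
proof -
  have "DER (\<lambda>a. pw a e * pw a d) (lg e * pw 0 d + pw 0 e * lg d)"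
    by (intro DER_mult DER_pw_exponent assms)
  moreover have "DER (\<lambda>a. pw a e * pw a d) (lg (e + d + e * d))"
    unfolding pw_mult[OF assms] by (intro DER_pw_exponent one_plus_mult_in_I assms)
  ultimately show ?thesis using DER_unique assms by (fastforce simp: pw_0)
qed

end

subsection \<open>Strongly linear operators shifting supports by the monoid\<close>

lemma M_power: "M (0, k) ^ n = M (0, int n * k)"
  by (induction n) (simp_all add: algebra_simps zero_prod_def[symmetric] flip: M_add)

lemma M_minus [simp]: "M (- q) * (M q * h) = h" "M q * (M (- q) * h) = h"
  by (simp_all flip: mult.assoc M_add)

lemma C_power: "C c ^ n = C (c ^ n)"
  by (induction n) (simp_all add: C_mult)

context supp_monoid
begin

text \<open>The operator with \<open>M q \<mapsto> M q * B q\<close>.\<close>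
definition act :: "(pl_monom \<Rightarrow> hahn) \<Rightarrow> hahn \<Rightarrow> hahn" where
  "act B g = Hahn (\<lambda>p. \<Sum>q\<in>{q \<in> supp (coef g). p - q \<in> T}. coef g q * coef (B q) (p - q))"

lemma finite_below: "finite {q \<in> supp (coef g). p - q \<in> T}"
  by (rule lex.finite_decomp[OF _ WO_T]) simp

lemma coef_act_raw:
  "coef (act B g) = (\<lambda>p. \<Sum>q\<in>{q \<in> supp (coef g). p - q \<in> T}. coef g q * coef (B q) (p - q))"
  unfolding act_def
proof (rule coef_Hahn[OF lex.WO_sumset[OF WO_supp_coef WO_T]], rule subsetI)
  fix p assume "p \<in> supp (\<lambda>p. \<Sum>q\<in>{q \<in> supp (coef g). p - q \<in> T}. coef g q * coef (B q) (p - q))"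
  then have "{q \<in> supp (coef g). p - q \<in> T} \<noteq> {}" unfolding supp_def by (metis (mono_tags, lifting) mem_Collect_eq sum.empty)
  then obtain q where "q \<in> supp (coef g)" "p - q \<in> T" by blast
  then show "p \<in> sumset (supp (coef g)) T" using lex.sumsetI[of q _ "p - q"] by simp
qed

lemma supp_act: "supp (coef (act B g)) \<subseteq> sumset (supp (coef g)) T"
proof
  fix p assume "p \<in> supp (coef (act B g))"
  then have "{q \<in> supp (coef g). p - q \<in> T} \<noteq> {}"
    unfolding supp_def coef_act_raw by (metis (mono_tags, lifting) mem_Collect_eq sum.empty)
  then obtain q where "q \<in> supp (coef g)" "p - q \<in> T" by blast
  then show "p \<in> sumset (supp (coef g)) T" using lex.sumsetI[of q _ "p - q"] by simp
qed

lemma coef_act: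
  assumes "\<And>q. B q \<in> A" "finite Q" "\<And>q. coef g q \<noteq> 0 \<Longrightarrow> p - q \<in> T \<Longrightarrow> q \<in> Q"
  shows "coef (act B g) p = (\<Sum>q\<in>Q. coef g q * coef (B q) (p - q))"
  unfolding coef_act_raw
proof (rule sum.mono_neutral_left)
  show "{q \<in> supp (coef g). p - q \<in> T} \<subseteq> Q" using assms(3) by (simp add: subset_iff in_supp_iff del: split_paired_All)
  show "\<forall>q\<in>Q - {q \<in> supp (coef g). p - q \<in> T}. coef g q * coef (B q) (p - q) = 0"
    using A_coef[OF assms(1)] by (simp add: Ball_def in_supp_iff del: split_paired_All) blast
qed (fact assms(2))

lemma coef_act_A:
  assumes "\<And>q. B q \<in> A" "g \<in> A"
  shows "coef (act B g) p = (\<Sum>q\<in>decomp p. coef g q * coef (B q) (p - q))"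
  using A_coef[OF assms(2)] by (intro coef_act assms finite_decomp) (auto simp: decomp_def)

lemma act_A: "(\<And>q. B q \<in> A) \<Longrightarrow> g \<in> A \<Longrightarrow> act B g \<in> A"
proof (rule A_I)
  fix p assume *: "\<And>q. B q \<in> A" "g \<in> A" and "p \<notin> T"
  then have "decomp p = {}" using add_T[of _ "p - _"] by (force simp: decomp_def)
  then show "coef (act B g) p = 0" by (simp add: coef_act_A *)
qed

lemma act_I: "(\<And>q. B q \<in> A) \<Longrightarrow> g \<in> I \<Longrightarrow> act B g \<in> I"
  using act_A[of B g] coef_act_A[of B g 0] by (simp add: I_def decomp_zero)

lemma act_M: assumes "\<And>q. B q \<in> A" shows "act B (M q) = M q * B q"
proof (rule hahn_eqI)
  fix p
  have "coef (act B (M q)) p = (\<Sum>r\<in>{q}. coef (M q) r * coef (B r) (p - r))"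
    by (rule coef_act[OF assms]) (auto simp: coef_M term_of_def split: if_splits)
  then show "coef (act B (M q)) p = coef (M q * B q) p" by (simp add: coef_M term_of_def)
qed

lemma act_one: "(\<And>q. B q \<in> A) \<Longrightarrow> act B 1 = B 0"
  using act_M[of B 0] by simp

lemma act_add:
  assumes "\<And>q. B q \<in> A" shows "act B (g + h) = act B g + act B h"
proof (rule hahn_eqI)
  fix p
  define Q where "Q = {q \<in> supp (coef g) \<union> supp (coef h). p - q \<in> T}"
  have fin: "finite Q" unfolding Q_def by (intro lex.finite_decomp lex.WO_Un WO_T WO_supp_coef)
  have "q \<in> Q" if "coef g q \<noteq> 0 \<or> coef h q \<noteq> 0" "p - q \<in> T" for q
    using that by (simp add: Q_def in_supp_iff)
  then have "coef (act B (g + h)) p = (\<Sum>q\<in>Q. coef (g + h) q * coef (B q) (p - q))"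
    "coef (act B g) p = (\<Sum>q\<in>Q. coef g q * coef (B q) (p - q))"
    "coef (act B h) p = (\<Sum>q\<in>Q. coef h q * coef (B q) (p - q))"
    by (intro coef_act[OF assms fin]; force)+
  then show "coef (act B (g + h)) p = coef (act B g + act B h) p"
    by (simp add: sum.distrib algebra_simps)
qed

lemma act_C: "(\<And>q. B q \<in> A) \<Longrightarrow> act B (C c * g) = C c * act B g"
proof (rule hahn_eqI)
  fix p assume *: "\<And>q. B q \<in> A"
  have "coef (act B (C c * g)) p = (\<Sum>q\<in>{q \<in> supp (coef g). p - q \<in> T}. coef (C c * g) q * coef (B q) (p - q))"
    by (rule coef_act[OF * finite_below]) (simp add: in_supp_iff)
  then show "coef (act B (C c * g)) p = coef (C c * act B g) p"
    by (simp add: coef_act_raw sum_distrib_left mult.assoc)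
qed

lemma act_const: assumes "h \<in> A" shows "act (\<lambda>_. h) g = h * g"
proof (rule hahn_eqI)
  fix p
  have "coef (g * h) p = (\<Sum>q\<in>{q \<in> supp (coef g). p - q \<in> T}. coef g q * coef h (p - q))"
    using A_coef[OF assms]
    by (intro coef_mult_eq_sum finite_below) (metis (mono_tags, lifting) in_supp_iff mem_Collect_eq)
  then show "coef (act (\<lambda>_. h) g) p = coef (h * g) p" by (simp add: coef_act_raw mult.commute)
qed

text \<open>Operators of this form are determined by their values on monomials: for fixed p the
  source and the intermediate indices range over finite sets, so the double sum can be
  exchanged.\<close>

lemma act_act:
  assumes B1: "\<And>q. B1 q \<in> A" and B2: "\<And>q. B2 q \<in> A" and B3: "\<And>q. B3 q \<in> A"
    and comp: "\<And>q. act B1 (M q * B2 q) = M q * B3 q"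
  shows "act B1 (act B2 g) = act B3 g"
proof (rule hahn_eqI)
  fix p
  define Q where "Q = {q \<in> supp (coef g). p - q \<in> T}"
  define R where "R = {r \<in> sumset (supp (coef g)) T. p - r \<in> T}"
  have finQ: "finite Q" unfolding Q_def by (rule finite_below)
  have finR: "finite R" unfolding R_def by (intro lex.finite_decomp lex.WO_sumset WO_T WO_supp_coef)
  have "coef (act B1 (act B2 g)) p = (\<Sum>r\<in>R. coef (act B2 g) r * coef (B1 r) (p - r))"
    using supp_act[of B2 g]
    by (intro coef_act[OF B1 finR]) (simp add: R_def in_supp_iff subset_iff del: split_paired_All)
  also have "\<dots> = (\<Sum>r\<in>R. (\<Sum>q\<in>Q. coef g q * coef (B2 q) (r - q)) * coef (B1 r) (p - r))"
  proof (intro sum.cong refl arg_cong2[where f = "(*)"] coef_act[OF B2 finQ])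
    fix r q assume "r \<in> R" "coef g q \<noteq> 0" "r - q \<in> T"
    then show "q \<in> Q" using add_T[of "p - r" "r - q"] by (simp add: Q_def R_def in_supp_iff)
  qed
  also have "\<dots> = (\<Sum>q\<in>Q. \<Sum>r\<in>R. coef g q * (coef (B2 q) (r - q) * coef (B1 r) (p - r)))"
    unfolding sum_distrib_right by (subst sum.swap) (simp add: mult.assoc)
  also have "\<dots> = (\<Sum>q\<in>Q. coef g q * coef (act B1 (M q * B2 q)) p)"
  proof (intro sum.cong refl)
    fix q assume q: "q \<in> Q"
    have "coef (act B1 (M q * B2 q)) p = (\<Sum>r\<in>R. coef (M q * B2 q) r * coef (B1 r) (p - r))"
    proof (rule coef_act[OF B1 finR])
      fix r assume r: "coef (M q * B2 q) r \<noteq> 0" "p - r \<in> T"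
      then have "r - q \<in> T" using A_coef[OF B2, of "r - q" q] by auto
      then show "r \<in> R" using r q lex.sumsetI[of q "supp (coef g)" "r - q" T] by (simp add: R_def Q_def)
    qed
    then show "(\<Sum>r\<in>R. coef g q * (coef (B2 q) (r - q) * coef (B1 r) (p - r))) =
        coef g q * coef (act B1 (M q * B2 q)) p"
      by (simp add: sum_distrib_left)
  qed
  also have "\<dots> = coef (act B3 g) p"
    unfolding comp using coef_act[OF B3 finQ, of g p] by (simp add: Q_def in_supp_iff)
  finally show "coef (act B1 (act B2 g)) p = coef (act B3 g) p" .
qed

section \<open>Multiplicative multipliers: operators that are algebra homomorphisms\<close>

context
  fixes B :: "pl_monom \<Rightarrow> hahn"
  assumes B_A: "\<And>q. B q \<in> A" and B_add: "\<And>p q. B (p + q) = B p * B q" and B_0: "B 0 = 1"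
begin

lemma act_M_mult: assumes "h \<in> A" shows "act B (M q * h) = M q * B q * act B h"
proof (rule hahn_eqI)
  fix p
  have "M q * B q * act B h = M q * act (\<lambda>_. B q) (act B h)"
    by (simp add: act_const B_A mult.assoc)
  also have "act (\<lambda>_. B q) (act B h) = act (\<lambda>u. B (q + u)) h"
    by (rule act_act) (auto simp: B_A B_add act_const mult_ac intro: A_mult)
  finally have "coef (M q * B q * act B h) p = (\<Sum>u\<in>decomp (p - q). coef h u * coef (B (q + u)) (p - q - u))"
    by (simp add: coef_act_A B_A assms)
  also have "\<dots> = (\<Sum>r\<in>(\<lambda>u. q + u) ` decomp (p - q). coef (M q * h) r * coef (B r) (p - r))"
    by (subst sum.reindex) (simp_all add: diff_diff_eq)
  also have "\<dots> = coef (act B (M q * h)) p"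
  proof (rule coef_act[OF B_A, symmetric])
    fix r assume "coef (M q * h) r \<noteq> 0" "p - r \<in> T"
    then have "r - q \<in> decomp (p - q)" using A_coef[OF assms, of "r - q"] by (auto simp: decomp_def)
    then show "r \<in> (\<lambda>u. q + u) ` decomp (p - q)" by (metis add.commute diff_add_cancel image_eqI)
  qed simp
  finally show "coef (act B (M q * h)) p = coef (M q * B q * act B h) p" by simp
qed

text \<open>Both sides are operators applied to g, with a multiplication before or after
  \<open>act B\<close>; \<open>act_act\<close> reduces their equality to monomials.\<close>

lemma act_mult: assumes "h \<in> A" shows "act B (h * g) = act B h * act B g"
proof -
  have "act B (h * g) = act B (act (\<lambda>_. h) g)" by (simp add: act_const assms)
  also have "\<dots> = act (\<lambda>q. B q * act B h) g"
    by (rule act_act) (auto simp: act_M_mult assms B_A act_A mult.assoc intro: A_mult)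
  also have "\<dots> = act (\<lambda>_. act B h) (act B g)"
    by (rule act_act[symmetric]) (auto simp: B_A act_A assms act_const mult_ac intro: A_mult)
  finally show ?thesis by (simp add: act_const act_A B_A assms)
qed

lemma act_one': "act B 1 = 1"
  by (simp add: act_one B_A B_0)

lemma act_C': "act B (C c) = C c"
  using act_C[of B c 1] by (simp add: act_one' B_A)

lemma act_power: "h \<in> A \<Longrightarrow> act B (h ^ n) = act B h ^ n"
  by (induction n) (simp_all add: act_one' act_mult)

text \<open>Multiplicativity alone covers polynomials in e. For power series, a coefficient of
  \<open>act B\<close> at p sees only divisors of p, where one common truncation is valid.\<close>

lemma act_ev: assumes e: "e \<in> I" shows "act B (ev c e) = ev c (act B e)"
proof (rule hahn_eqI)
  fix p
  let ?N = "card (decomp p)"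
  have "coef (act B (ev c e)) p = (\<Sum>q\<in>decomp p. coef (ev c e) q * coef (B q) (p - q))"
    by (simp add: coef_act_A B_A ev_A e)
  also have "\<dots> = (\<Sum>q\<in>decomp p. (\<Sum>j<?N. fps_nth c j * coef (e ^ j) q) * coef (B q) (p - q))"
    by (intro sum.cong refl arg_cong2[where f = "(*)"] coef_ev e card_decomp_mono)
  also have "\<dots> = (\<Sum>j<?N. fps_nth c j * (\<Sum>q\<in>decomp p. coef (e ^ j) q * coef (B q) (p - q)))"
    unfolding sum_distrib_right sum_distrib_left by (subst sum.swap) (simp add: mult.assoc)
  also have "\<dots> = (\<Sum>j<?N. fps_nth c j * coef (act B e ^ j) p)"
    using e by (simp add: coef_act_A B_A A_power I_A flip: act_power)
  finally show "coef (act B (ev c e)) p = coef (ev c (act B e)) p"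
    by (simp add: coef_ev_card act_I B_A e)
qed

end

subsection \<open>Composition\<close>

text \<open>For f = a x^\<mu> (1 + e) this is log f - \<mu> log x.\<close>

definition tail :: "real \<Rightarrow> hahn \<Rightarrow> hahn" where
  "tail a e = C (ln a) + lg e"

lemma tail_A: "e \<in> I \<Longrightarrow> tail a e \<in> A"
  by (auto simp: tail_def lg_def)

text \<open>For \<open>f = a x\<^bsup>\<mu>\<^esup> (1 + e)\<close> the image of \<open>x\<^bsup>\<alpha>\<^esup> \<ell>\<^bsup>k\<^esup>\<close> under composition with \<open>f\<close> is
  \<open>M (\<mu> \<alpha>, k) * compB \<mu> a e (\<alpha>, k)\<close>, because \<open>\<ell> \<circ> f = (\<ell> / \<mu>) / (1 - u)\<close> with
  \<open>u = (\<ell> / \<mu>) (log a + log (1 + e))\<close>.\<close>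
definition compB :: "real \<Rightarrow> real \<Rightarrow> hahn \<Rightarrow> pl_monom \<Rightarrow> hahn" where
  "compB \<mu> a e = (\<lambda>(\<alpha>, k). C (a powr \<alpha> * inverse \<mu> powi k) * pw \<alpha> e *
     pw (- of_int k) (- (C (inverse \<mu>) * ell * tail a e)))"

lemma shift_in_I: "e \<in> I \<Longrightarrow> - (C m * ell * tail a e) \<in> I"
  by (intro I_uminus I_mult_right[OF _ tail_A] I_mult_left) simp_all

lemma compB_A: "e \<in> I \<Longrightarrow> compB \<mu> a e q \<in> A"
  by (auto simp: compB_def split: prod.split intro!: A_mult pw_A shift_in_I)

lemma pw_power: "e \<in> I \<Longrightarrow> pw a e ^ n = pw (real n * a) e"
  by (induction n) (simp_all add: pw_0 distrib_right pw_add)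

lemma pw_minus_one:
  assumes "e \<in> I" "h * (1 + e) = 1" shows "h = pw (- 1) e"
proof -
  have "pw (- 1) e * (1 + e) = 1" using pw_minus[OF assms(1), of 1] by (simp add: pw_1 assms(1))
  then have "h = pw (- 1) e * (1 + e) * h" by simp
  also have "\<dots> = pw (- 1) e * (h * (1 + e))" by (simp only: mult_ac)
  also have "\<dots> = pw (- 1) e" using assms(2) by simp
  finally show ?thesis .
qed

text \<open>Identifies the series 1 + u + u^2 + ... in \<open>ell_comp\<close> with (1 - u)^(-1), so
  that all powers of \<ell> \<circ> f are expressed by \<open>pw\<close>.\<close>

lemma ev_geometric: assumes "u \<in> I" shows "ev (Abs_fps (\<lambda>_. 1)) u = pw (- 1) (- u)"
proof (rule pw_minus_one)
  have "Abs_fps (\<lambda>_. 1) * (1 - fps_X) = (1 :: real fps)"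
    by (rule fps_ext) (simp add: right_diff_distrib mult.commute[of _ fps_X])
  moreover have "ev (1 - fps_X) u = 1 - u"
    using ev_add[OF assms, of "1 - fps_X" fps_X] by (simp add: ev_1 ev_X assms eq_diff_eq)
  ultimately show "ev (Abs_fps (\<lambda>_. 1)) u * (1 + - u) = 1"
    using ev_mult[OF assms, of "Abs_fps (\<lambda>_. 1)" "1 - fps_X"] by (simp add: ev_1 assms)
qed (use assms in auto)

lemma ev_at_zero: "ev c 0 = C (fps_nth c 0)"
proof (rule hahn_eqI)
  fix p
  have "coef (ev c 0) p = (\<Sum>j<Suc (card (decomp p)). fps_nth c j * coef (0 ^ j) p)"
    by (rule coef_ev) auto
  then show "coef (ev c 0) p = coef (C (fps_nth c 0)) p"
    by (simp add: sum.lessThan_Suc_shift coef_one coef_C term_of_def del: sum.lessThan_Suc)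
qed

lemma strong_sum_eq_sum:
  assumes "finite J" "\<And>i. F i p \<noteq> 0 \<Longrightarrow> i \<in> J" shows "strong_sum F p = (\<Sum>i\<in>J. F i p)"
  unfolding strong_sum_def by (rule sum.mono_neutral_left) (use assms in auto)

lemma strong_sum_powers:
  assumes "e \<in> I" shows "strong_sum (\<lambda>j. pl_scale (fps_nth c j) (pl_power (coef e) j)) = coef (ev c e)"
proof
  fix p
  have "strong_sum (\<lambda>j. pl_scale (fps_nth c j) (pl_power (coef e) j)) p =
      (\<Sum>j<card (decomp p). pl_scale (fps_nth c j) (pl_power (coef e) j) p)"
    using coef_power_I[OF assms, of p]
    by (intro strong_sum_eq_sum) (auto simp: pl_scale_def pl_power_coef intro!: leI)
  then show "strong_sum (\<lambda>j. pl_scale (fps_nth c j) (pl_power (coef e) j)) p = coef (ev c e) p"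
    by (simp add: coef_ev_card assms pl_scale_def pl_power_coef)
qed

lemma strong_sum_log:
  assumes "e \<in> I"
  shows "strong_sum (\<lambda>j. pl_scale ((- 1) ^ j / real (Suc j)) (pl_power (coef e) (Suc j))) = coef (lg e)"
proof
  fix p
  let ?F = "\<lambda>j. pl_scale ((- 1) ^ j / real (Suc j)) (pl_power (coef e) (Suc j))"
  have "j < card (decomp p)" if "?F j p \<noteq> 0" for j
  proof (rule ccontr)
    assume "\<not> j < card (decomp p)"
    then show False
      using coef_power_I[OF assms, of p "Suc j"] that
      by (simp add: pl_scale_def pl_power_coef del: power_Suc)
  qed
  then have "strong_sum ?F p = (\<Sum>j<card (decomp p). ?F j p)"
    by (intro strong_sum_eq_sum) auto
  also have "\<dots> = (\<Sum>j<Suc (card (decomp p)). fps_nth (fps_ln 1) j * coef (e ^ j) p)"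
    by (subst sum.lessThan_Suc_shift) (simp add: pl_scale_def pl_power_coef fps_ln_nth del: power_Suc)
  also have "\<dots> = coef (lg e) p" unfolding lg_def using assms by (intro coef_ev[symmetric]) auto
  finally show "strong_sum ?F p = coef (lg e) p" .
qed

section \<open>From the definitions of composition to operators \<open>act\<close>\<close>

context
  fixes f :: pl_series and \<mu> a :: real and e :: hahn
  assumes lead_exp_f: "lead_exp f = \<mu>" and lead_coeff_f: "lead_coeff_of f = a"
    and mu_pos: "\<mu> > 0" and a_pos: "a > 0"
    and eps_f: "eps_of f = coef e" and e_I: "e \<in> I"
begin

lemma term_of_monom: "term_of c p = coef (C c * M p)"
  using coef_term_of[of c p] by (simp add: Hahn_term_of)

lemma x_powr_comp_coef: "x_powr_comp \<alpha> f = coef (C (a powr \<alpha>) * M (\<mu> * \<alpha>, 0) * pw \<alpha> e)"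
  unfolding x_powr_comp_def lead_exp_f lead_coeff_f eps_f pw_def coef_mult[of _ "ev _ _"]
  using strong_sum_powers[OF e_I, of "fps_binomial \<alpha>"] by (simp add: term_of_monom)

lemma log_tail_coef: "log_tail f = coef (tail a e)"
  unfolding log_tail_def lead_coeff_f eps_f strong_sum_log[OF e_I] tail_def
  by (simp flip: pl_add_coef zero_prod_def add: coef_C)

lemma ell_powi_comp_coef:
  "ell_powi_comp k f = coef (C (inverse \<mu> powi k) * M (0, k) *
     pw (- of_int k) (- (C (inverse \<mu>) * ell * tail a e)))"
proof -
  define u where "u = C (inverse \<mu>) * ell * tail a e"
  have uI: "- u \<in> I" unfolding u_def by (rule shift_in_I[OF e_I])
  then have uI': "u \<in> I" using I_uminus by fastforce
  show ?thesis
  proof (cases "k \<ge> 0")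
    case True
    have "ell_comp f = coef (C (inverse \<mu>) * ell * pw (- 1) (- u))"
      unfolding ell_comp_def Let_def lead_exp_f log_tail_coef term_of_monom
      using strong_sum_powers[OF uI', of "Abs_fps (\<lambda>_. 1)"] ev_geometric[OF uI']
      by (simp add: u_def inverse_eq_divide pl_scale_def flip: coef_mult)
    then have "ell_powi_comp k f = coef ((C (inverse \<mu>) * ell * pw (- 1) (- u)) ^ nat k)"
      using True by (simp add: ell_powi_comp_def pl_power_coef)
    then show ?thesis
      using True by (simp add: power_mult_distrib C_power M_power pw_power uI power_int_def flip: u_def)
  next
    case False
    \<comment> \<open>Since - log f = \<mu> \<ell>^(-1) (1 - u), negative powers of \<ell> \<circ> f
      are natural powers of 1 - u.\<close>
    have "C \<mu> * M (0, - 1) * u = C (\<mu> * inverse \<mu>) * (M (0, - 1) * M (0, 1)) * tail a e"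
      by (simp only: u_def C_mult mult_ac)
    also have "\<dots> = tail a e" using mu_pos by (simp flip: M_add zero_prod_def)
    finally have "C \<mu> * M (0, - 1) * (1 + - u) = C \<mu> * M (0, - 1) - tail a e"
      by (simp add: algebra_simps)
    moreover have "C (- 1) * (C (- \<mu>) * M (0, - 1) + tail a e) = C \<mu> * M (0, - 1) - tail a e"
      by (simp add: C_uminus)
    ultimately have "pl_scale (- 1) (pl_log f) = coef (C \<mu> * M (0, - 1) * (1 + - u))"
      by (simp add: pl_log_def lead_exp_f log_tail_coef term_of_monom pl_add_coef pl_scale_coef)
    then have "ell_powi_comp k f = coef ((C \<mu> * M (0, - 1) * (1 + - u)) ^ nat (- k))"
      using False by (simp add: ell_powi_comp_def pl_power_coef)
    also have "(C \<mu> * M (0, - 1) * (1 + - u)) ^ nat (- k) =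
        C (\<mu> ^ nat (- k)) * M (0, k) * pw (real (nat (- k))) (- u)"
      using False by (simp only: power_mult_distrib C_power M_power pw_of_nat[OF uI]) simp
    finally show ?thesis
      using False by (simp add: power_int_def u_def of_nat_nat)
  qed
qed

lemma pl_comp_monom:
  "pl_mult (x_powr_comp \<alpha> f) (ell_powi_comp k f) = coef (M (\<mu> * \<alpha>, k) * compB \<mu> a e (\<alpha>, k))"
proof -
  have "M (\<mu> * \<alpha>, k) = M (\<mu> * \<alpha>, 0) * M (0, k)" by (simp flip: M_add)
  then show ?thesis
    unfolding x_powr_comp_coef ell_powi_comp_coef coef_mult[symmetric] compB_def
    by (simp add: C_mult mult_ac)
qed

text \<open>Kept for arbitrary \<mu> > 0 because flows are not known in advance to have leading
  exponent 1. Only for \<mu> = 1 is each monomial merely shifted by \<open>T\<close>, as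
  \<open>act\<close> requires.\<close>

lemma pl_comp_eq_sum:
  assumes "finite Q" "\<And>q. g q \<noteq> 0 \<Longrightarrow> p - (\<mu> * fst q, snd q) \<in> T \<Longrightarrow> q \<in> Q"
  shows "pl_comp g f p = (\<Sum>q\<in>Q. g q * coef (compB \<mu> a e q) (p - (\<mu> * fst q, snd q)))"
proof -
  have eq: "(case q of (\<alpha>, k) \<Rightarrow> pl_scale (g (\<alpha>, k)) (pl_mult (x_powr_comp \<alpha> f) (ell_powi_comp k f))) p =
      g q * coef (compB \<mu> a e q) (p - (\<mu> * fst q, snd q))" for q
    unfolding pl_comp_monom by (cases q) (simp add: pl_scale_def)
  have "q \<in> Q" if "g q * coef (compB \<mu> a e q) (p - (\<mu> * fst q, snd q)) \<noteq> 0" for q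
  proof (rule assms(2))
    show "g q \<noteq> 0" using that by auto
    show "p - (\<mu> * fst q, snd q) \<in> T" using that A_coef[OF compB_A[OF e_I]] by (metis mult_zero_right)
  qed
  then show ?thesis unfolding pl_comp_def by (subst strong_sum_eq_sum[OF assms(1)]) (simp_all add: eq)
qed

lemma pl_comp_act: assumes "\<mu> = 1" shows "pl_comp (coef g) f = coef (act (compB 1 a e) g)"
proof
  fix p
  let ?Q = "{q \<in> supp (coef g). p - q \<in> T}"
  have "pl_comp (coef g) f p = (\<Sum>q\<in>?Q. coef g q * coef (compB \<mu> a e q) (p - (\<mu> * fst q, snd q)))"
    by (rule pl_comp_eq_sum[OF finite_below]) (simp add: in_supp_iff assms)
  then show "pl_comp (coef g) f p = coef (act (compB 1 a e) g) p"
    by (simp add: coef_act_raw assms)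
qed

end

section \<open>Composition of series with leading exponent 1\<close>

abbreviation tangB :: "real \<Rightarrow> hahn \<Rightarrow> pl_monom \<Rightarrow> hahn" where
  "tangB \<equiv> compB 1"

definition ser :: "real \<Rightarrow> hahn \<Rightarrow> hahn" where
  "ser a e = C a * M (1, 0) * (1 + e)"

lemma tangB_eq: "tangB a e (\<alpha>, k) = C (a powr \<alpha>) * pw \<alpha> e * pw (- of_int k) (- (ell * tail a e))"
  by (simp add: compB_def)

lemma ell_tail_I: "e \<in> I \<Longrightarrow> - (ell * tail a e) \<in> I"
  using shift_in_I[of e 1 a] by simp

lemma tangB_0: "e \<in> I \<Longrightarrow> a > 0 \<Longrightarrow> tangB a e 0 = 1"
  by (simp add: zero_prod_def tangB_eq pw_0 ell_tail_I)

lemma tangB_add: "e \<in> I \<Longrightarrow> a > 0 \<Longrightarrow> tangB a e (p + q) = tangB a e p * tangB a e q"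
proof -
  assume e: "e \<in> I" and a: "a > 0"
  obtain \<alpha> k \<beta> l where [simp]: "p = (\<alpha>, k)" "q = (\<beta>, l)" by (metis surj_pair)
  have "pw (- of_int (k + l)) (- (ell * tail a e)) =
      pw (- of_int k) (- (ell * tail a e)) * pw (- of_int l) (- (ell * tail a e))"
    by (simp add: ell_tail_I e flip: pw_add)
  then show ?thesis using e a by (simp add: tangB_eq powr_add C_mult pw_add mult_ac)
qed

lemma act_ser:
  assumes "e \<in> I" "a > 0" "d \<in> I"
  defines "d' \<equiv> act (tangB a e) d"
  shows "act (tangB a e) (ser b d) = ser (a * b) (e + d' + e * d')"
proof -
  note hom = compB_A[where \<mu> = 1 and a = a, OF assms(1)] tangB_add[OF assms(1,2)] tangB_0[OF assms(1,2)]
  have "act (tangB a e) (ser b d) = act (tangB a e) (M (1, 0) * (C b * (1 + d)))"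
    by (simp add: ser_def mult_ac)
  also have "\<dots> = M (1, 0) * tangB a e (1, 0) * (C b * (1 + d'))"
    using assms hom
    by (simp add: act_M_mult[OF hom] act_C act_add act_one'[OF hom] d'_def A_mult A_add I_A)
  also have "\<dots> = ser (a * b) (e + d' + e * d')"
    using assms by (simp add: tangB_eq pw_0 pw_1 ell_tail_I ser_def C_mult algebra_simps)
  finally show ?thesis .
qed

text \<open>Associativity of composition for f = a x (1 + e) and g = b x (1 + d), checked on
  monomials. The powers of x reduce to \<open>pw_mult\<close>. For \<ell>, let 1 - u, 1 - w and 1 -
  u' be the denominators belonging to f, to g transported by f, and to g \<circ> f: additivity of
  the logarithm gives (1 - u) (1 - w) = 1 - u', and \<open>pw_mult\<close> applies again.\<close>

lemma act_tangB_comp: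
  assumes "e \<in> I" "a > 0" "d \<in> I" "b > 0"
  defines "d' \<equiv> act (tangB a e) d"
  shows "act (tangB a e) (act (tangB b d) h) = act (tangB (a * b) (e + d' + e * d')) h"
proof (rule act_act)
  note hom = compB_A[where \<mu> = 1 and a = a, OF assms(1)] tangB_add[OF assms(1,2)] tangB_0[OF assms(1,2)]
  have d'I: "d' \<in> I" using assms by (simp add: d'_def act_I compB_A)
  show I3: "tangB (a * b) (e + d' + e * d') q \<in> A" for q
    by (intro compB_A one_plus_mult_in_I assms d'I)
  fix q :: pl_monom obtain \<alpha> k where q: "q = (\<alpha>, k)" by (rule prod.exhaust)
  let ?\<phi> = "act (tangB a e)"
  define u where "u = ell * tail a e"
  define w where "w = ?\<phi> (ell * tail b d)"
  define u' where "u' = ell * tail (a * b) (e + d' + e * d')"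
  have uI: "- u \<in> I" unfolding u_def by (rule ell_tail_I[OF assms(1)])
  have ellA: "ell \<in> A" by (simp add: I_A)
  have wI: "- w \<in> I" unfolding w_def
    by (intro I_uminus act_I hom(1) I_mult_right ell_in_I tail_A assms(3))
  have "w = ell * tangB a e (0, 1) * ?\<phi> (tail b d)"
    unfolding w_def by (rule act_M_mult[OF hom]) (rule tail_A[OF assms(3)])
  also have "tangB a e (0, 1) = pw (- 1) (- u)"
    using assms by (simp add: tangB_eq pw_0 u_def)
  also have "?\<phi> (tail b d) = tail b d'"
    unfolding tail_def lg_def by (simp add: act_add hom act_C'[OF hom] act_ev[OF hom] assms d'_def)
  finally have "w * (1 + - u) = ell * tail b d' * (pw (- 1) (- u) * (1 + - u))" by (simp add: mult_ac)
  also have "pw (- 1) (- u) * (1 + - u) = 1" using pw_minus[OF uI, of 1] by (simp add: pw_1 uI)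
  finally have w1: "w * (1 + - u) = ell * tail b d'" by simp
  have "tail (a * b) (e + d' + e * d') = tail a e + tail b d'"
    using assms d'I by (simp add: tail_def lg_mult ln_mult C_add)
  then have "u' = u + w * (1 + - u)" unfolding u'_def w1 by (simp add: u_def distrib_left)
  then have u': "- u + - w + (- u) * (- w) = - u'" by (simp add: algebra_simps)
  have "?\<phi> (M q * tangB b d q) = M q * tangB a e q * ?\<phi> (tangB b d q)"
    by (rule act_M_mult[OF hom compB_A[OF assms(3)]])
  also have "?\<phi> (tangB b d q) = C (b powr \<alpha>) * pw \<alpha> d' * pw (- of_int k) (- w)"
  proof -
    have "?\<phi> (- (ell * tail b d)) = - w"
      using act_C[where B = "tangB a e" and c = "- 1" and g = "ell * tail b d", OF hom(1)] by (simp add: C_uminus w_def)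
    then show ?thesis
      unfolding q tangB_eq pw_def
      using assms ell_tail_I[OF assms(3), of b]
      by (simp add: act_mult[OF hom] act_C'[OF hom] act_ev[OF hom] d'_def A_mult ev_A)
  qed
  also have "M q * tangB a e q * (C (b powr \<alpha>) * pw \<alpha> d' * pw (- of_int k) (- w)) =
      M q * (C ((a * b) powr \<alpha>) * (pw \<alpha> e * pw \<alpha> d') * (pw (- of_int k) (- u) * pw (- of_int k) (- w)))"
    using assms by (simp add: q tangB_eq u_def powr_mult C_mult mult_ac)
  also have "\<dots> = M q * tangB (a * b) (e + d' + e * d') q"
    using assms d'I by (simp only: pw_mult uI wI u') (simp add: q tangB_eq u'_def)
  finally show "?\<phi> (M q * tangB b d q) = M q * tangB (a * b) (e + d' + e * d') q" .
qed (use assms in \<open>auto intro: compB_A\<close>)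

lemma EPfam_tangB:
  assumes "EPfam e" "\<And>t. e t \<in> I" "m > 0"
  shows "EPfam (\<lambda>t. tangB (m powr t) (e t) q)"
proof -
  obtain \<alpha> k where q: "q = (\<alpha>, k)" by (rule prod.exhaust)
  have "EPfam (\<lambda>t. tail (m powr t) (e t))"
    using EPfam_C[OF EP_mult[OF EP_ident EP_const[of "ln m"]]] assms
    by (auto simp: tail_def lg_def intro!: EPfam_add EPfam_ev)
  then have u: "EPfam (\<lambda>t. - (ell * tail (m powr t) (e t)))"
    by (intro EPfam_uminus EPfam_mult EPfam_const) (simp_all add: I_A)
  have "EPfam (\<lambda>t. C ((m powr t) powr \<alpha>))"
    using EPfam_C[OF EP_powr[OF assms(3), of \<alpha>]] by (simp add: powr_powr mult.commute)
  then show ?thesis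
    unfolding q tangB_eq pw_def
    by (intro EPfam_mult EPfam_ev u assms ell_tail_I)
qed

text \<open>The infinitesimal form of composition: x d/dx multiplies x^\<alpha> \<ell>^k by \<alpha>
  + k \<ell>, and a' + e' is the derivative of a (1 + e) at 0.\<close>

lemma DER_tangB:
  assumes "DER e e'" "\<And>t. e t \<in> I" "e 0 = 0"
    and "(a has_real_derivative a') (at 0)" "a 0 = 1"
  shows "DER (\<lambda>t. tangB (a t) (e t) q) ((C (fst q) + C (of_int (snd q)) * ell) * (C a' + e'))"
proof -
  obtain \<alpha> k where q: "q = (\<alpha>, k)" by (rule prod.exhaust)
  have lg: "DER (\<lambda>t. lg (e t)) e'" unfolding lg_def
    using DER_ev[OF assms(1,3,2), of "fps_ln 1"] by (simp add: fps_ln_nth)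
  have "((\<lambda>t. ln (a t)) has_real_derivative a') (at 0)"
    using assms(4,5) by (auto intro!: derivative_eq_intros)
  then have "DER (\<lambda>t. tail (a t) (e t)) (C a' + e')"
    unfolding tail_def by (intro DER_add DER_C lg)
  then have "DER (\<lambda>t. ell * tail (a t) (e t)) (0 * tail (a 0) (e 0) + ell * (C a' + e'))"
    by (intro DER_mult DER_const) (simp_all add: I_A)
  then have u: "DER (\<lambda>t. - (ell * tail (a t) (e t))) (- (ell * (C a' + e')))"
    using DER_uminus by fastforce
  have u0: "- (ell * tail (a 0) (e 0)) = 0"
    by (simp add: tail_def lg_def assms(3,5) ev_at_zero)
  have P: "DER (\<lambda>t. pw (- of_int k) (- (ell * tail (a t) (e t)))) (C (- of_int k) * - (ell * (C a' + e')))"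
    unfolding pw_def using DER_ev[OF u u0 ell_tail_I[OF assms(2)], of "fps_binomial (- of_int k)"] by simp
  have E: "DER (\<lambda>t. pw \<alpha> (e t)) (C \<alpha> * e')"
    unfolding pw_def using DER_ev[OF assms(1,3,2), of "fps_binomial \<alpha>"] by simp
  have "((\<lambda>t. a t powr \<alpha>) has_real_derivative \<alpha> * a') (at 0)"
    using assms(4,5) by (auto intro!: derivative_eq_intros)
  then have D: "DER (\<lambda>t. C (a t powr \<alpha>)) (C (\<alpha> * a'))" by (rule DER_C)
  have one: "pw c 0 = 1" for c
    by (simp add: pw_def ev_at_zero)
  show ?thesis
    unfolding q tangB_eq using DER_mult[OF DER_mult[OF D E] P] 
    by (simp add: assms(3,5) u0[simplified assms(3,5)] one C_mult C_uminus algebra_simps)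
qed

end

subsection \<open>Existence of the flow\<close>

lemma EP_shift: "EP e \<Longrightarrow> EP (\<lambda>t. e (t + s))"
proof (induction rule: EP.induct)
  case (EP_step h e c)
  show ?case
  proof (rule EP.EP_step[OF EP_step.IH])
    show "((\<lambda>t. e (t + s)) has_real_derivative c * e (t + s) + h (t + s)) (at t)" for t
      using DERIV_shift[of e "c * e (t + s) + h (t + s)" t s] EP_step.hyps(2) by simp
  qed
qed (rule EP.EP_zero)

context supp_monoid
begin

lemma coef_act_M_mult:
  assumes "\<And>q. B q \<in> A" "h \<in> A"
  shows "coef (act B (M q * h)) (q + s) = (\<Sum>u\<in>decomp s. coef h u * coef (B (q + u)) (s - u))"
proof -
  have "coef (act B (M q * h)) (q + s) =
      (\<Sum>r\<in>(\<lambda>u. q + u) ` decomp s. coef (M q * h) r * coef (B r) (q + s - r))"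
  proof (rule coef_act[OF assms(1)])
    fix r assume "coef (M q * h) r \<noteq> 0" "q + s - r \<in> T"
    moreover from this have "r - q \<in> T" using A_coef[OF assms(2), of "r - q"] by auto
    moreover have "s - (r - q) = q + s - r" by simp
    ultimately have "r - q \<in> decomp s" by (simp only: decomp_def mem_Collect_eq)
    then show "r \<in> (\<lambda>u. q + u) ` decomp s" by (metis add.commute diff_add_cancel image_eqI)
  qed simp
  also have "\<dots> = (\<Sum>u\<in>decomp s. coef h u * coef (B (q + u)) (s - u))"
    by (subst sum.reindex) simp_all
  finally show ?thesis .
qed

lemma EPfam_shift: "EPfam g \<Longrightarrow> EPfam (\<lambda>t. g (t + s))"
  unfolding EPfam_def by (auto simp del: split_paired_All intro: EP_shift[where e = "\<lambda>t. coef (g t) _"])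

lemma EPfam_act_left:
  assumes "\<And>q. EPfam (\<lambda>t. B t q)" "h \<in> A" shows "EPfam (\<lambda>t. act (B t) h)"
proof -
  have "B t q \<in> A" for t q using assms(1)[of q] by (simp add: EPfam_def)
  then show ?thesis
    using assms by (simp add: EPfam_def act_A coef_act_A EP_sum EP_cmult del: split_paired_All)
qed

lemma EPfam_act_right:
  assumes "\<And>q. B q \<in> A" "EPfam g" shows "EPfam (\<lambda>t. act B (g t))"
  using assms by (simp add: EPfam_def act_A coef_act_A EP_sum EP_mult EP_const del: split_paired_All)

text \<open>These are the diagonal entries of composition with a x (1 + e); they become the factors
  c in \<open>EP_recurrence\<close>.\<close>

lemma coef_tangB_zero: "e \<in> I \<Longrightarrow> coef (tangB a e q) 0 = a powr fst q"
  using ell_tail_I[of e a]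
  by (cases q) (simp add: tangB_eq coef_mult_zero A_mult pw_A coef_pw_zero coef_C term_of_def)

lemma tangB_trivial: "tangB 1 0 q = 1"
proof -
  have "pw c 0 = 1" for c by (simp add: pw_def ev_at_zero)
  moreover have "tail 1 0 = 0" by (simp add: tail_def lg_def ev_at_zero)
  ultimately show ?thesis by (cases q) (simp add: tangB_eq)
qed

lemma decomp_less: "u \<in> decomp s \<Longrightarrow> u \<noteq> s \<Longrightarrow> u \<in> T \<and> u \<sqsubset> s"
  using nonneg_T[of "s - u"] lex.le_iff_diff[of u s] by (simp add: decomp_def lex.less_le)

text \<open>The coefficients of the iterates of \<open>f\<close> solve triangular recurrences, hence are exponential
  polynomials in the number of iterations.\<close>
lemma EP_iterates:
  assumes B: "\<And>q. B q \<in> A" "\<And>q. coef (B q) 0 > 0"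
    and h: "\<And>n. h n \<in> A" "\<And>n. M q * h (Suc n) = act B (M q * h n)"
    and "s \<in> T"
  shows "\<exists>y. EP y \<and> (\<forall>n. y (real n) = coef (h n) s)"
  using WO_T \<open>s \<in> T\<close>
proof (induction s rule: lex.WO_induct)
  case (less s)
  have rec: "coef (h (Suc n)) s = coef (B (q + s)) 0 * coef (h n) s +
      (\<Sum>u\<in>decomp s - {s}. coef (h n) u * coef (B (q + u)) (s - u))" for n
  proof -
    have "coef (h (Suc n)) s = coef (M q * h (Suc n)) (q + s)" by simp
    also have "\<dots> = (\<Sum>u\<in>decomp s. coef (h n) u * coef (B (q + u)) (s - u))"
      unfolding h(2) by (rule coef_act_M_mult[OF B(1) h(1)])
    also have "s \<in> decomp s" using less.hyps zero_T by (simp add: decomp_def)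
    then have "(\<Sum>u\<in>decomp s. coef (h n) u * coef (B (q + u)) (s - u)) = coef (B (q + s)) 0 * coef (h n) s +
      (\<Sum>u\<in>decomp s - {s}. coef (h n) u * coef (B (q + u)) (s - u))"
      by (subst sum.remove[of _ s]) simp_all
    finally show ?thesis .
  qed
  have "\<forall>u\<in>decomp s - {s}. \<exists>y. EP y \<and> (\<forall>n. y (real n) = coef (h n) u)"
    using less.IH decomp_less by blast
  then obtain Y where Y: "\<And>u. u \<in> decomp s - {s} \<Longrightarrow> EP (Y u)"
    "\<And>u n. u \<in> decomp s - {s} \<Longrightarrow> Y u (real n) = coef (h n) u" by metis
  define r where "r t = (\<Sum>u\<in>decomp s - {s}. Y u t * coef (B (q + u)) (s - u))" for t
  have "EP r" unfolding r_def by (intro EP_sum EP_mult EP_const Y(1))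
  then obtain y where y: "EP y" "y 0 = coef (h 0) s" "\<And>t. y (t + 1) = coef (B (q + s)) 0 * y t + r t"
    using EP_recurrence[OF B(2)[of "q + s"]] by metis
  have "y (real n) = coef (h n) s" for n
  proof (induction n)
    case (Suc n)
    have "y (real (Suc n)) = coef (B (q + s)) 0 * coef (h n) s + r (real n)"
      using y(3)[of "real n"] Suc by (simp add: add.commute)
    then show ?case by (simp add: rec r_def Y(2))
  qed (use y in simp)
  then show ?case using y(1) by blast
qed

lemma act_zero: "(\<And>q. B q \<in> A) \<Longrightarrow> act B 0 = 0"
  using act_C[of B 0 0] by simp

lemma act_trivial: "act (\<lambda>_. 1) g = g"
  by (simp add: act_const)

lemma flow_exists:
  assumes e: "e \<in> I" and a: "a > 0"
  obtains E where "EPfam E" "\<And>t. E t \<in> I" "E 0 = 0" "E 1 = e"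
    "\<And>s t. act (tangB (a powr t) (E t)) (ser (a powr s) (E s)) = ser (a powr (s + t)) (E (s + t))"
proof -
  let ?B = "tangB a e"
  let ?\<phi> = "act ?B"
  note hom = compB_A[where \<mu> = 1 and a = a, OF e] tangB_add[OF e a] tangB_0[OF e a]
  \<comment> \<open>\<open>D n\<close> encodes the n-th iterate of f as a^n x (1 + D n).\<close>
  define D where "D = rec_nat 0 (\<lambda>_ d. e + ?\<phi> d + e * ?\<phi> d)"
  have D0: "D 0 = 0" and DSuc: "D (Suc n) = e + ?\<phi> (D n) + e * ?\<phi> (D n)" for n
    by (simp_all add: D_def)
  have DI: "D n \<in> I" for n
    by (induction n) (auto simp: D0 DSuc intro!: one_plus_mult_in_I e act_I hom(1))
  have ser_Suc: "ser (a ^ Suc n) (D (Suc n)) = ?\<phi> (ser (a ^ n) (D n))" for n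
    by (simp add: act_ser[OF e a DI] DSuc)
  have act_Suc: "act (tangB (a ^ Suc n) (D (Suc n))) g = ?\<phi> (act (tangB (a ^ n) (D n)) g)" for n g
    using a by (simp add: act_tangB_comp[OF e a DI] DSuc)
  have nat_flow: "act (tangB (a ^ n) (D n)) (ser (a ^ m) (D m)) = ser (a ^ (m + n)) (D (m + n))" for m n
  proof (induction n)
    case 0
    have "tangB 1 0 = (\<lambda>_. 1)" using tangB_trivial by blast
    then show ?case by (simp add: D0 act_trivial)
  next
    case (Suc n)
    have "act (tangB (a ^ Suc n) (D (Suc n))) (ser (a ^ m) (D m)) = ?\<phi> (ser (a ^ (m + n)) (D (m + n)))"
      by (simp only: act_Suc Suc)
    then show ?case by (simp only: ser_Suc add_Suc_right)
  qed
  define h where "h n = C (a ^ n) * (1 + D n)" for n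
  have ser_h: "ser (a ^ n) (D n) = M (1, 0) * h n" for n by (simp add: ser_def h_def mult_ac)
  have hA: "h n \<in> A" for n unfolding h_def by (intro A_mult A_add A_C A_one I_A[OF DI])
  have "coef (?B q) 0 > 0" for q using a by (simp add: coef_tangB_zero e)
  then have "\<forall>s\<in>T. \<exists>y. EP y \<and> (\<forall>n. y (real n) = coef (h n) s)"
    using EP_iterates[of ?B h "(1, 0)"] hom(1) hA ser_Suc[unfolded ser_h] by blast
  then obtain Y where Y: "\<And>s. s \<in> T \<Longrightarrow> EP (Y s)" "\<And>s n. s \<in> T \<Longrightarrow> Y s (real n) = coef (h n) s"
    by metis
  define H where "H t = Hahn (\<lambda>s. if s \<in> T then Y s t else 0)" for t
  have coef_H: "coef (H t) = (\<lambda>s. if s \<in> T then Y s t else 0)" for t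
    unfolding H_def by (rule coef_Hahn[OF WO_T]) (auto simp: supp_def)
  have H: "EPfam H" unfolding EPfam_def
  proof (intro conjI allI)
    show "EP (\<lambda>t. coef (H t) s)" for s
      using Y(1)[of s] EP_zero by (cases "s \<in> T") (simp_all add: coef_H)
  qed (simp add: A_I coef_H)
  have H_nat: "H (real n) = h n" for n
    using Y(2) A_coef[OF hA] by (intro hahn_eqI) (simp add: coef_H)
  \<comment> \<open>Divides out the leading coefficient a^t. The coefficient at 0 then vanishes at
    natural times and, by interpolation, at all times.\<close>
  define E where "E t = C (a powr (- 1 * t)) * H t - 1" for t
  have E: "EPfam E" unfolding E_def
    by (intro EPfam_diff EPfam_mult EPfam_C EPfam_const EP_powr a H A_one)
  have E_nat: "E (real n) = D n" for n
  proof -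
    have "C (a powr (- 1 * real n)) * C (a ^ n) = 1"
      using a by (simp add: powr_minus powr_realpow flip: C_mult)
    then show ?thesis by (simp add: E_def H_nat h_def flip: mult.assoc)
  qed
  have EI: "E t \<in> I" for t
  proof -
    have "coef (E t) 0 = 0"
    proof (rule EP_eqI[of "\<lambda>t. coef (E t) 0" "\<lambda>_. 0"])
      show "EP (\<lambda>t. coef (E t) 0)" using E by (simp only: EPfam_def)
      show "coef (E (real n)) 0 = 0" for n using DI[of n] by (simp add: E_nat I_def)
    qed (rule EP_zero)
    then show ?thesis using E by (simp add: EPfam_def I_def)
  qed
  have powr_nat: "a powr real n = a ^ n" for n using a by (simp add: powr_realpow)
  have ser_H: "ser (a powr t) (E t) = M (1, 0) * H t" for t
  proof -
    have "ser (a powr t) (E t) = C (a powr t * a powr (- 1 * t)) * (M (1, 0) * H t)"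
      by (simp add: ser_def E_def C_mult mult_ac)
    then show ?thesis using a by (simp flip: powr_add)
  qed
  define B where "B t = tangB (a powr t) (E t)" for t
  have BA: "B t q \<in> A" for t q unfolding B_def by (rule compB_A[OF EI])
  have B: "EPfam (\<lambda>t. B t q)" for q unfolding B_def by (rule EPfam_tangB[OF E EI a])
  have act_B: "act (B t) (M (1, 0) * g) = M (1, 0) * (B t (1, 0) * act (B t) g)" if "g \<in> A" for t g
    using tangB_add[OF EI] tangB_0[OF EI] a that
    by (subst act_M_mult) (simp_all add: BA[unfolded B_def] B_def mult.assoc)
  have HA: "H t \<in> A" for t using H by (simp add: EPfam_def)
  have cancel: "g = g'" if "M (1, 0) * g = M (1, 0) * g'" for g g'
    using that M_minus(1)[of "(1, 0)"] by metis
  have nat_nat: "B (real n) (1, 0) * act (B (real n)) (H (real m)) = H (real m + real n)" for m n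
  proof (rule cancel)
    have "M (1, 0) * (B (real n) (1, 0) * act (B (real n)) (H (real m))) = act (B (real n)) (ser (a ^ m) (D m))"
      by (simp add: act_B HA H_nat ser_h hA)
    also have "\<dots> = ser (a ^ (m + n)) (D (m + n))"
      by (simp add: B_def E_nat powr_nat nat_flow)
    also have "\<dots> = M (1, 0) * H (real m + real n)"
      using H_nat[of "m + n"] by (simp add: ser_h)
    finally show "M (1, 0) * (B (real n) (1, 0) * act (B (real n)) (H (real m))) = M (1, 0) * H (real m + real n)" .
  qed
  \<comment> \<open>The time t enters through the operator \<open>B t\<close>, the time s through
    the series acted on; they are made real one after the other, each with the other one
    fixed.\<close>
  have nat_real: "B t (1, 0) * act (B t) (H (real m)) = H (real m + t)" for m t
  proof (rule EPfam_eqI[of "\<lambda>t. B t (1, 0) * act (B t) (H (real m))" "\<lambda>t. H (real m + t)"])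
    show "EPfam (\<lambda>t. B t (1, 0) * act (B t) (H (real m)))"
      by (intro EPfam_mult B EPfam_act_left HA)
    show "EPfam (\<lambda>t. H (real m + t))"
      using EPfam_shift[OF H, of "real m"] by (simp only: add.commute)
  qed (rule nat_nat)
  have "B t (1, 0) * act (B t) (H s) = H (s + t)" for s t
  proof (rule EPfam_eqI[of "\<lambda>s. B t (1, 0) * act (B t) (H s)" "\<lambda>s. H (s + t)"])
    show "EPfam (\<lambda>s. B t (1, 0) * act (B t) (H s))"
      by (intro EPfam_mult EPfam_const EPfam_act_right H BA)
  qed (rule EPfam_shift[OF H], rule nat_real)
  then have "act (B t) (ser (a powr s) (E s)) = ser (a powr (s + t)) (E (s + t))" for s t
    by (simp add: ser_H act_B HA)
  moreover have "D (Suc 0) = e" by (simp add: DSuc D0 act_zero hom(1))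
  ultimately show thesis using that[of E] E EI E_nat[of 0] E_nat[of 1] D0 by (simp add: B_def)
qed

subsection \<open>The differential equation of a flow\<close>

text \<open>The matrix of X for \<xi> = x \<eta>: X sends x^\<alpha> \<ell>^k to (\<alpha> + k
  \<ell>) \<eta> x^\<alpha> \<ell>^k.\<close>

definition fieldB :: "hahn \<Rightarrow> pl_monom \<Rightarrow> hahn" where
  "fieldB \<eta> q = (C (fst q) + C (of_int (snd q)) * ell) * \<eta>"

lemma fieldB_A: "\<eta> \<in> A \<Longrightarrow> fieldB \<eta> q \<in> A"
  unfolding fieldB_def by (intro A_mult A_add A_C I_A[OF ell_in_I])

lemma coef_fieldB:
  "coef (fieldB \<eta> q) r = fst q * coef \<eta> r + of_int (snd q) * coef \<eta> (r - (0, 1))"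
  by (simp add: fieldB_def distrib_right mult.assoc)

lemma act_Badd:
  assumes "\<And>q. B q \<in> A" "\<And>q. B' q \<in> A" shows "act (\<lambda>q. B q + B' q) g = act B g + act B' g"
  by (rule hahn_eqI) (simp add: coef_act_raw sum.distrib distrib_left)

lemma act_diag: "coef (act (\<lambda>q. C (c q)) g) p = c p * coef g p"
proof -
  let ?Q = "insert p {q \<in> supp (coef g). p - q \<in> T}"
  have fin: "finite ?Q" using finite_below by (rule finite.insertI)
  have "coef (act (\<lambda>q. C (c q)) g) p = (\<Sum>q\<in>?Q. coef g q * coef (C (c q)) (p - q))"
    by (rule coef_act[OF A_C fin]) (simp add: in_supp_iff)
  also have "\<dots> = (\<Sum>q\<in>?Q. if q = p then c p * coef g p else 0)"
    by (intro sum.cong refl) (simp add: coef_C term_of_def)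
  finally show ?thesis using fin by simp
qed

lemma act_mult_const:
  "h \<in> A \<Longrightarrow> (\<And>q. B q \<in> A) \<Longrightarrow> act (\<lambda>q. h * B q) g = h * act B g"
  using act_act[of "\<lambda>_. h" B "\<lambda>q. h * B q" g] by (simp add: act_const A_mult mult_ac)

text \<open>Differentiation lowers the exponent of x and is not of the form \<open>act\<close>, but
  x d/dx is a sum of two diagonal operators, the second multiplied by \<ell>; the factor x of \<xi>
  cancels the division by x.\<close>

lemma vf_apply_coef:
  assumes "\<eta> \<in> A" shows "vf_apply (coef (M (1, 0) * \<eta>)) (coef g) = coef (act (fieldB \<eta>) g)"
proof -
  let ?E = "act (\<lambda>q. C (fst q)) g" and ?L = "act (\<lambda>q. C (of_int (snd q))) g"
  have "pl_deriv (coef g) = coef (M (- 1, 0) * (?E + ell * ?L))"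
  proof
    fix p :: pl_monom obtain \<beta> k where p: "p = (\<beta>, k)" by (rule prod.exhaust)
    show "pl_deriv (coef g) p = coef (M (- 1, 0) * (?E + ell * ?L)) p"
      by (simp add: p pl_deriv_def act_diag)
  qed
  then have "vf_apply (coef (M (1, 0) * \<eta>)) (coef g) = coef ((M (1, 0) * M (- 1, 0)) * (\<eta> * (?E + ell * ?L)))"
    by (simp add: vf_apply_def mult_ac flip: coef_mult)
  also have "M (1, 0) * M (- 1, 0) = 1" by (simp flip: M_add zero_prod_def)
  also have "\<eta> * (?E + ell * ?L) = act (\<lambda>q. \<eta> * (C (fst q) + ell * C (of_int (snd q)))) g"
    using assms by (simp add: act_mult_const act_Badd A_mult A_add I_A)
  also have "(\<lambda>q. \<eta> * (C (fst q) + ell * C (of_int (snd q)))) = fieldB \<eta>"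
    by (simp add: fieldB_def fun_eq_iff mult_ac)
  finally show ?thesis by (simp only: mult_1)
qed

text \<open>Differentiate \<open>F s \<circ> F t = F (s + t)\<close> with respect to \<open>t\<close> at 0.\<close>
lemma flow_ode:
  fixes a :: "real \<Rightarrow> real" and E :: "real \<Rightarrow> hahn"
  defines "F \<equiv> \<lambda>t. ser (a t) (E t)"
  assumes a_pos: "\<And>t. a t > 0" and E_I: "\<And>t. E t \<in> I" and init: "a 0 = 1" "E 0 = 0"
    and flow: "\<And>s t. act (tangB (a t) (E t)) (F s) = F (s + t)"
    and diff: "\<And>p. (\<lambda>t. coef (F t) p) differentiable (at 0)"
  obtains \<eta> where "\<eta> \<in> A" "\<And>p. deriv (\<lambda>t. coef (F t) p) 0 = coef (M (1, 0) * \<eta>) p"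
    "\<And>s p. ((\<lambda>t. coef (F t) p) has_real_derivative coef (act (fieldB \<eta>) (F s)) p) (at s)"
proof -
  define F' where "F' p = deriv (\<lambda>t. coef (F t) p) 0" for p
  have F': "((\<lambda>t. coef (F t) p) has_real_derivative F' p) (at 0)" for p
    unfolding F'_def using diff by (metis DERIV_deriv_iff_real_differentiable)
  have coef_F: "coef (F t) ((1, 0) + s) = a t * (coef 1 s + coef (E t) s)" for t s
    by (simp add: F_def ser_def mult.assoc mult.left_commute[of "C _"])
  have F_A: "coef (F t) ((1, 0) + s) = 0" if "s \<notin> T" for t s
    using A_coef[OF A_one that] A_coef[OF I_A[OF E_I] that] by (simp only: coef_F) simp
  have a_eq: "coef (F t) (1, 0) = a t" for t
    using coef_F[of t 0] E_I[of t] by (simp add: I_def coef_one term_of_def zero_prod_def)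
  have a': "(a has_real_derivative F' (1, 0)) (at 0)"
    using F'[of "(1, 0)"] by (simp add: a_eq)
  define \<eta> where "\<eta> = Hahn (\<lambda>s. F' ((1, 0) + s))"
  have F'_T: "F' ((1, 0) + s) = 0" if "s \<notin> T" for s
    unfolding F'_def using F_A[OF that] by simp
  have coef_\<eta>: "coef \<eta> = (\<lambda>s. F' ((1, 0) + s))"
    unfolding \<eta>_def using F'_T by (intro coef_Hahn[OF WO_T]) (auto simp: supp_def)
  have \<eta>_A: "\<eta> \<in> A" using F'_T by (intro A_I) (simp add: coef_\<eta>)
  \<comment> \<open>The derivative at 0 of E = F / (a x) - 1, by the quotient rule with a 0 = 1 and
    F 0 = x.\<close>
  define e' where "e' = \<eta> - C (F' (1, 0))"
  have "DER E e'" unfolding DER_def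
  proof (intro conjI allI)
    fix s
    have "((\<lambda>t. coef (F t) ((1, 0) + s) / a t - coef 1 s) has_real_derivative
        (F' ((1, 0) + s) * a 0 - coef (F 0) ((1, 0) + s) * F' (1, 0)) / (a 0 * a 0) - 0) (at 0)"
      by (intro DERIV_diff DERIV_divide F' a' DERIV_const) (simp add: init)
    moreover have "coef (F t) ((1, 0) + s) / a t - coef 1 s = coef (E t) s" for t
      using a_pos[of t] by (simp add: coef_F)
    moreover have "coef (F 0) ((1, 0) + s) * F' (1, 0) = coef (C (F' (1, 0))) s"
      by (simp add: coef_F init coef_one coef_C term_of_def)
    ultimately show "((\<lambda>t. coef (E t) s) has_real_derivative coef e' s) (at 0)"
      by (simp add: init e'_def coef_\<eta>)
  qed (auto simp: e'_def E_I I_A \<eta>_A)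
  then have der: "DER (\<lambda>t. tangB (a t) (E t) q) (fieldB \<eta> q)" for q
    using DER_tangB[where e = E and e' = e' and a = a and a' = "F' (1, 0)" and q = q, OF _ E_I init(2) a' init(1)]
    by (simp add: fieldB_def e'_def)
  show thesis
  proof (rule that[OF \<eta>_A])
    show "deriv (\<lambda>t. coef (F t) p) 0 = coef (M (1, 0) * \<eta>) p" for p
      by (simp add: coef_\<eta> F'_def)
    fix s p
    \<comment> \<open>A coefficient of F (s + t) is a finite combination of matrix entries at time t
      with weights taken from F s, so differentiating at t = 0 gives the derivative at time
      s.\<close>
    let ?Q = "{q \<in> supp (coef (F s)). p - q \<in> T}"
    have "((\<lambda>t. \<Sum>q\<in>?Q. coef (F s) q * coef (tangB (a t) (E t) q) (p - q)) has_real_derivative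
        (\<Sum>q\<in>?Q. coef (F s) q * coef (fieldB \<eta> q) (p - q))) (at 0)"
      by (intro DERIV_sum DERIV_cmult DER_coef der)
    then have "((\<lambda>t. coef (F (s + t)) p) has_real_derivative coef (act (fieldB \<eta>) (F s)) p) (at 0)"
      by (simp add: coef_act_raw flip: flow)
    then show "((\<lambda>t. coef (F t) p) has_real_derivative coef (act (fieldB \<eta>) (F s)) p) (at s)"
      using DERIV_shift[of "\<lambda>t. coef (F t) p" "coef (act (fieldB \<eta>) (F s)) p" 0 s] by (simp add: add.commute)
  qed
qed

lemma coef_field_act:
  assumes "\<eta> \<in> A" "h \<in> A"
  shows "coef (act (fieldB \<eta>) (M (1, 0) * h)) ((1, 0) + s) =
    (\<Sum>u\<in>decomp s. coef h u * ((1 + fst u) * coef \<eta> (s - u) + of_int (snd u) * coef \<eta> (s - u - (0, 1))))"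
  by (subst coef_act_M_mult) (simp_all add: fieldB_A assms coef_fieldB)

text \<open>The linear system for h = F / x and \<eta> = \<xi> / x; uniqueness and the exponential
  formula use the group law only through it.\<close>

definition solves :: "hahn \<Rightarrow> (real \<Rightarrow> hahn) \<Rightarrow> bool" where
  "solves \<eta> h \<longleftrightarrow> \<eta> \<in> A \<and> (\<forall>t. h t \<in> A) \<and> h 0 = 1 \<and>
     (\<forall>s p. ((\<lambda>t. coef (M (1, 0) * h t) p) has_real_derivative
       coef (act (fieldB \<eta>) (M (1, 0) * h s)) p) (at s))"

lemma solvesD:
  assumes "solves \<eta> h"
  shows "\<eta> \<in> A" "h t \<in> A" "h 0 = 1"
    "((\<lambda>t. coef (M (1, 0) * h t) p) has_real_derivative coef (act (fieldB \<eta>) (M (1, 0) * h s)) p) (at s)"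
  using assms by (simp_all only: solves_def simp_thms)

text \<open>The lowest equation of the system is scalar. It makes the coefficient of \<eta> at 0 the
  logarithm of the multiplier of the time-one map, which starts the uniqueness induction and settles
  the order of \<xi>.\<close>

lemma lead_exponential:
  assumes "solves \<eta> h"
  shows "coef (h t) 0 = exp (coef \<eta> 0 * t)"
proof -
  have "coef \<eta> (0, - 1) = 0"
    using A_coef[OF solvesD(1)[OF assms], of "(0, - 1)"] nonneg_T[of "(0, - 1)"] by (auto simp: lle_def)
  then have "((\<lambda>t. coef (h t) 0) has_real_derivative coef \<eta> 0 * coef (h t) 0) (at t)" for t
    using solvesD(4)[OF assms, of "(1, 0) + 0" t] unfolding coef_field_act[OF solvesD(1,2)[OF assms]]
    by (simp add: decomp_zero mult.commute[of "coef \<eta> 0"])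
  then show ?thesis using linear_ode_homogeneous[of "\<lambda>t. coef (h t) 0" "coef \<eta> 0" t] solvesD(3)[OF assms]
    by (simp add: coef_one term_of_def)
qed

text \<open>At the first exponent \<open>s\<close> where two flows might differ, the difference \<open>d\<close> of the coefficients
  satisfies \<open>d' = c d + v (\<eta>\<^sub>s - \<theta>\<^sub>s)\<close> with \<open>v > 0\<close>, and vanishes at 0 and 1.\<close>
lemma flow_unique:
  assumes sh: "solves \<eta> h" and sk: "solves \<theta> k" and eq1: "h 1 = k 1"
  shows "\<eta> = \<theta>"
proof -
  note \<eta> = solvesD(1)[OF sh] and h = solvesD(2,3)[OF sh] and ode_h = solvesD(4)[OF sh]
  note \<theta> = solvesD(1)[OF sk] and k = solvesD(2,3)[OF sk] and ode_k = solvesD(4)[OF sk]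
  note h0 = lead_exponential[OF sh] and k0 = lead_exponential[OF sk]
  have e0: "coef \<eta> 0 = coef \<theta> 0" using h0[of 1] k0[of 1] eq1 by simp
  have "coef \<eta> s = coef \<theta> s \<and> (\<forall>t. coef (h t) s = coef (k t) s)" if "s \<in> T" for s
    using WO_T that
  proof (induction s rule: lex.WO_induct)
    case (less s)
    show ?case
    proof (cases "s = 0")
      case True
      then show ?thesis using e0 h0 k0 by simp
    next
      case False
      have below: "coef \<eta> v = coef \<theta> v" if "v \<sqsubset> s" for v
        using less.IH[of v] that A_coef[OF \<eta>, of v] A_coef[OF \<theta>, of v] by (cases "v \<in> T") auto
      have mem: "s \<in> decomp s" "0 \<in> decomp s - {s}" using less.hyps zero_T False by (auto simp: decomp_def)
      define R where "R = decomp s - {s} - {0}"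
      define c where "c = (1 + fst s) * coef \<eta> 0"
      have neg: "(0, - 1) \<notin> T" using nonneg_T[of "(0, - 1)"] by (auto simp: lle_def)
      \<comment> \<open>Isolates u = s, the diagonal term, and u = 0, where the unknown coefficient
        of \<zeta> at s sits. For u in \<open>R\<close> both u and s - u precede s, so the induction
        hypothesis covers the rest.\<close>
      have expand: "coef (act (fieldB \<zeta>) (M (1, 0) * g)) ((1, 0) + s) =
          (1 + fst s) * coef \<zeta> 0 * coef g s + coef g 0 * coef \<zeta> s +
          (\<Sum>u\<in>R. coef g u * ((1 + fst u) * coef \<zeta> (s - u) + of_int (snd u) * coef \<zeta> (s - u - (0, 1))))"
        if "\<zeta> \<in> A" "g \<in> A" for \<zeta> g
        unfolding coef_field_act[OF that] R_def
        using mem A_coef[OF that(1) neg]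
        by (simp add: sum.remove[of "decomp s" s] sum.remove[of "decomp s - {s}" 0])
      define d where "d t = coef (h t) s - coef (k t) s" for t
      have R_eq: "(\<Sum>u\<in>R. coef (h t) u * ((1 + fst u) * coef \<eta> (s - u) + of_int (snd u) * coef \<eta> (s - u - (0, 1)))) =
          (\<Sum>u\<in>R. coef (k t) u * ((1 + fst u) * coef \<theta> (s - u) + of_int (snd u) * coef \<theta> (s - u - (0, 1))))" for t
      proof (intro sum.cong refl)
        fix u assume "u \<in> R"
        then have u: "u \<in> T" "u \<sqsubset> s" "u \<noteq> 0" using decomp_less[of u s] by (auto simp: R_def)
        then have "0 \<sqsubset> u" using nonneg_T[of u] by (simp add: lex.less_le)
        then have "s - u \<sqsubset> s" using lex.lt_add_right_cancel[of 0 "s - u" u] by simp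
        moreover have "s - u - (0, 1) \<sqsubset> s - u" by (simp add: llt_def)
        ultimately have "coef \<eta> (s - u) = coef \<theta> (s - u)" "coef \<eta> (s - u - (0, 1)) = coef \<theta> (s - u - (0, 1))"
          using below lex.less_trans by blast+
        moreover have "coef (h t) u = coef (k t) u" using less.IH[OF u(1,2)] by blast
        ultimately show "coef (h t) u * ((1 + fst u) * coef \<eta> (s - u) + of_int (snd u) * coef \<eta> (s - u - (0, 1))) =
            coef (k t) u * ((1 + fst u) * coef \<theta> (s - u) + of_int (snd u) * coef \<theta> (s - u - (0, 1)))"
          by (simp only:)
      qed
      have d': "(d has_real_derivative c * d t + exp (coef \<eta> 0 * t) * (coef \<eta> s - coef \<theta> s)) (at t)" for t
      proof -
        have "(d has_real_derivative coef (act (fieldB \<eta>) (M (1, 0) * h t)) ((1, 0) + s) -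
            coef (act (fieldB \<theta>) (M (1, 0) * k t)) ((1, 0) + s)) (at t)"
          using DERIV_diff[OF ode_h[where p = "(1, 0) + s" and s = t] ode_k[where p = "(1, 0) + s" and s = t]]
          by (simp add: d_def[abs_def])
        then show ?thesis
          unfolding expand[OF \<eta> h(1)] expand[OF \<theta> k(1)]
          using h0[of t] k0[of t] e0 R_eq[of t] by (simp add: d_def c_def algebra_simps)
      qed
      have d01: "d 0 = 0" "d 1 = 0" using h(2) k(2) eq1 by (simp_all add: d_def)
      have "\<exists>z>0. z < 1 \<and> exp (- c * 1) * d 1 - exp (- c * 0) * d 0 =
          (1 - 0) * (exp (- c * z) * (exp (coef \<eta> 0 * z) * (coef \<eta> s - coef \<theta> s)))"
        by (rule MVT2[where f = "\<lambda>t. exp (- c * t) * d t", OF zero_less_one exp_integrating_factor[OF d']])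
      then have eq: "coef \<eta> s = coef \<theta> s" using d01 by auto
      then have "d t = d 0 * exp (c * t)" for t using d' by (intro linear_ode_homogeneous) simp
      then have "d t = 0" for t using d01 by simp
      then show ?thesis using eq by (simp add: d_def)
    qed
  qed
  then show ?thesis using A_coef[OF \<eta>] A_coef[OF \<theta>] by (intro hahn_eqI) metis
qed

subsection \<open>The exponential of a vector field\<close>

lemma sumset_mono: "S \<subseteq> S' \<Longrightarrow> sumset S T \<subseteq> sumset S' T"
  unfolding lex.sumset_def by blast

lemma sumset_T_closed: "sumset (sumset S T) T \<subseteq> sumset S T"
proof
  fix p assume "p \<in> sumset (sumset S T) T"
  then obtain s t u where "s \<in> S" "t \<in> T" "u \<in> T" "p = s + t + u" by (auto simp: lex.sumset_def)
  then show "p \<in> sumset S T" using lex.sumsetI[of s S "t + u" T] add_T by (simp add: add.assoc)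
qed

lemma subset_sumset_T: "S \<subseteq> sumset S T"
  using lex.sumsetI[of _ S 0 T] zero_T by fastforce

lemma supp_act_iterate:
  assumes "sumset W T \<subseteq> W" "supp (coef g) \<subseteq> W" shows "supp (coef ((act B ^^ n) g)) \<subseteq> W"
proof (induction n)
  case (Suc n)
  have "supp (coef (act B ((act B ^^ n) g))) \<subseteq> sumset (supp (coef ((act B ^^ n) g))) T" by (rule supp_act)
  also have "\<dots> \<subseteq> W" using sumset_mono[OF Suc] assms(1) by (rule subset_trans)
  finally show ?case by simp
qed (simp add: assms)

lemma coef_act_window:
  assumes B: "\<And>q. B q \<in> A" and W: "WO W" "supp (coef g) \<subseteq> W"
    and r: "r \<in> {q \<in> W. p - q \<in> T}"
  shows "coef (act B g) r = (\<Sum>q\<in>{q \<in> W. p - q \<in> T}. coef g q * coef (B q) (r - q))"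
proof (rule coef_act[OF B lex.finite_decomp[OF W(1) WO_T]])
  fix q assume q: "coef g q \<noteq> 0" "r - q \<in> T"
  then have "p - q \<in> T" using add_T[of "p - r" "r - q"] r by simp
  then show "q \<in> {q \<in> W. p - q \<in> T}" using W(2) q by (auto simp: supp_def subset_iff simp del: split_paired_All)
qed

text \<open>The window \<open>Q\<close> is finite and closed: coefficients of \<open>act B g\<close>
  in it depend only on those of g in it. The sum \<open>K\<close> of all absolute matrix entries
  bounds each row sum, so iterates grow at most geometrically, which the factorial later
  beats.\<close>

lemma act_iterate_bound:
  assumes B: "\<And>q. B q \<in> A" and W: "WO W" "sumset W T \<subseteq> W" "supp (coef g) \<subseteq> W"
    and g: "\<And>q. q \<in> W \<Longrightarrow> p - q \<in> T \<Longrightarrow> \<bar>coef g q\<bar> \<le> m"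
  defines "Q \<equiv> {q \<in> W. p - q \<in> T}"
  defines "K \<equiv> \<Sum>r\<in>Q. \<Sum>q\<in>Q. \<bar>coef (B q) (r - q)\<bar>"
  assumes "r \<in> Q"
  shows "\<bar>coef ((act B ^^ n) g) r\<bar> \<le> m * K ^ n"
  using \<open>r \<in> Q\<close>
proof (induction n arbitrary: r)
  case 0
  then show ?case using g W by (simp add: Q_def)
next
  case (Suc n)
  let ?g = "(act B ^^ n) g"
  have finQ: "finite Q" unfolding Q_def by (rule lex.finite_decomp[OF W(1) WO_T])
  have sub: "supp (coef ?g) \<subseteq> W" by (rule supp_act_iterate[OF W(2,3)])
  have m: "0 \<le> m" using g[of r] Suc.prems by (fastforce simp: Q_def)
  have "\<bar>coef (act B ?g) r\<bar> = \<bar>\<Sum>q\<in>Q. coef ?g q * coef (B q) (r - q)\<bar>"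
    using coef_act_window[OF B W(1) sub, of r p] Suc.prems by (simp add: Q_def)
  also have "\<dots> \<le> (\<Sum>q\<in>Q. \<bar>coef ?g q * coef (B q) (r - q)\<bar>)" by (rule sum_abs)
  also have "\<dots> \<le> (\<Sum>q\<in>Q. (m * K ^ n) * \<bar>coef (B q) (r - q)\<bar>)"
    unfolding abs_mult using Suc.IH by (intro sum_mono mult_right_mono) auto
  also have "\<dots> = (m * K ^ n) * (\<Sum>q\<in>Q. \<bar>coef (B q) (r - q)\<bar>)" by (simp add: sum_distrib_left)
  also have "\<dots> \<le> (m * K ^ n) * K"
  proof (rule mult_left_mono)
    show "(\<Sum>q\<in>Q. \<bar>coef (B q) (r - q)\<bar>) \<le> K"
      unfolding K_def using Suc.prems finQ
      by (intro member_le_sum[where f = "\<lambda>r. \<Sum>q\<in>Q. \<bar>coef (B q) (r - q)\<bar>"] sum_nonneg) auto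
    have "0 \<le> K" unfolding K_def by (intro sum_nonneg) auto
    then show "0 \<le> m * K ^ n" using m by simp
  qed
  finally show ?case by (simp add: mult_ac)
qed

lemma act_exp_summable:
  assumes B: "\<And>q. B q \<in> A" shows "summable (\<lambda>n. coef ((act B ^^ n) g) p / fact n)"
proof -
  define W where "W = sumset (supp (coef g)) T"
  have W: "WO W" "sumset W T \<subseteq> W" "supp (coef g) \<subseteq> W"
    unfolding W_def by (simp_all add: lex.WO_sumset WO_T sumset_T_closed subset_sumset_T)
  show ?thesis
  proof (cases "p \<in> W")
    case False
    then have "coef ((act B ^^ n) g) p = 0" for n
      using supp_act_iterate[OF W(2,3)] by (metis in_supp_iff subsetD)
    then show ?thesis by simp
  next
    case True
    define Q where "Q = {q \<in> W. p - q \<in> T}"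
    define K where "K = (\<Sum>r\<in>Q. \<Sum>q\<in>Q. \<bar>coef (B q) (r - q)\<bar>)"
    define m where "m = (\<Sum>q\<in>Q. \<bar>coef g q\<bar>)"
    have finQ: "finite Q" unfolding Q_def by (rule lex.finite_decomp[OF W(1) WO_T])
    have "\<bar>coef g q\<bar> \<le> m" if "q \<in> W" "p - q \<in> T" for q
      unfolding m_def using that finQ
      by (intro member_le_sum[where f = "\<lambda>q. \<bar>coef g q\<bar>"]) (auto simp: Q_def)
    then have bound: "\<bar>coef ((act B ^^ n) g) p\<bar> \<le> m * K ^ n" for n
      using act_iterate_bound[OF B W, of p m p n] True zero_T by (simp add: K_def Q_def)
    have "summable (\<lambda>n. m * (inverse (fact n) * K ^ n))" by (intro summable_mult summable_exp)
    then show ?thesis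
    proof (rule summable_comparison_test'[where N = 0])
      show "norm (coef ((act B ^^ n) g) p / fact n) \<le> m * (inverse (fact n) * K ^ n)" for n
        using bound[of n] by (simp add: field_simps)
    qed
  qed
qed

text \<open>Taylor expansion at 0 of the solution; the remainder is controlled by \<open>act_iterate_bound\<close>.\<close>
lemma flow_eq_exp:
  assumes B: "\<And>q. B q \<in> A" and W: "WO W" "sumset W T \<subseteq> W" "\<And>t. supp (coef (F t)) \<subseteq> W"
    and ode: "\<And>s p. ((\<lambda>t. coef (F t) p) has_real_derivative coef (act B (F s)) p) (at s)"
  shows "(\<lambda>n. coef ((act B ^^ n) (F 0)) p / fact n) sums coef (F 1) p"
proof (cases "p \<in> W")
  case False
  then have "coef ((act B ^^ n) (F 0)) p = 0" "coef (F 1) p = 0" for n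
    using W(3) supp_act_iterate[OF W(2,3)] by (metis in_supp_iff subsetD)+
  then show ?thesis by simp
next
  case True
  define Q where "Q = {q \<in> W. p - q \<in> T}"
  define K where "K = (\<Sum>r\<in>Q. \<Sum>q\<in>Q. \<bar>coef (B q) (r - q)\<bar>)"
  have finQ: "finite Q" unfolding Q_def by (rule lex.finite_decomp[OF W(1) WO_T])
  have pQ: "p \<in> Q" using True zero_T by (simp add: Q_def)
  have sub: "supp (coef ((act B ^^ n) (F t))) \<subseteq> W" for n t
    by (rule supp_act_iterate[OF W(2,3)])
  have der: "((\<lambda>t. coef ((act B ^^ n) (F t)) r) has_real_derivative coef ((act B ^^ Suc n) (F s)) r) (at s)"
    if "r \<in> Q" for n s r
    using that
  proof (induction n arbitrary: r)
    case 0
    then show ?case using ode by simp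
  next
    case (Suc n)
    have win: "coef (act B g) r = (\<Sum>q\<in>Q. coef g q * coef (B q) (r - q))" if "supp (coef g) \<subseteq> W" for g
      unfolding Q_def by (rule coef_act_window[OF B W(1) that]) (use Suc.prems in \<open>simp add: Q_def\<close>)
    have "((\<lambda>t. \<Sum>q\<in>Q. coef ((act B ^^ n) (F t)) q * coef (B q) (r - q)) has_real_derivative
        (\<Sum>q\<in>Q. coef ((act B ^^ Suc n) (F s)) q * coef (B q) (r - q))) (at s)"
      by (intro DERIV_sum DERIV_cmult_right Suc.IH)
    then show ?case using win[OF sub[of n]] win[OF sub[of "Suc n" s]] by simp
  qed
  \<comment> \<open>The intermediate point of the Taylor remainder varies with n, so the bound must
    be uniform in t; compactness gives it for each of the finitely many q.\<close>
  obtain m where m: "\<And>q t. q \<in> Q \<Longrightarrow> \<bar>t\<bar> \<le> 1 \<Longrightarrow> \<bar>coef (F t) q\<bar> \<le> m"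
  proof -
    have "\<exists>m. \<forall>t\<in>{-1..1}. \<bar>coef (F t) q\<bar> \<le> m" for q
    proof -
      have "continuous_on {-1..1} (\<lambda>t. \<bar>coef (F t) q\<bar>)"
        by (intro continuous_on_rabs continuous_at_imp_continuous_on ballI DERIV_isCont[OF ode])
      then have "bounded ((\<lambda>t. \<bar>coef (F t) q\<bar>) ` {-1..1})"
        by (intro compact_imp_bounded compact_continuous_image) auto
      then show ?thesis by (auto simp: bounded_iff)
    qed
    then obtain b where b: "\<And>q t. t \<in> {-1..1} \<Longrightarrow> \<bar>coef (F t) q\<bar> \<le> b q" by metis
    show thesis
    proof (rule that[of "\<Sum>q\<in>Q. b q"])
      fix q t :: _ assume "q \<in> Q" and t: "\<bar>t::real\<bar> \<le> 1"
      have "0 \<le> b r" for r using b[of 0 r] by (simp add: order_trans[OF abs_ge_zero])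
      then have "b q \<le> (\<Sum>q\<in>Q. b q)" using \<open>q \<in> Q\<close> finQ by (intro member_le_sum) auto
      then show "\<bar>coef (F t) q\<bar> \<le> (\<Sum>q\<in>Q. b q)" using b[of t q] t by (simp add: abs_le_iff)
    qed
  qed
  have bound: "\<bar>coef ((act B ^^ n) (F t)) p\<bar> \<le> m * K ^ n" if "\<bar>t\<bar> \<le> 1" for n t
    using act_iterate_bound[OF B W(1,2) W(3), of p t m p n] m[OF _ that] pQ by (simp add: Q_def K_def)
  have rem: "\<bar>coef (F 1) p - (\<Sum>k<n. coef ((act B ^^ k) (F 0)) p / fact k)\<bar> \<le> m * (inverse (fact n) * K ^ n)" for n
  proof -
    obtain t where t: "\<bar>t\<bar> \<le> \<bar>1::real\<bar>" "coef (F 1) p =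
        (\<Sum>k<n. (coef ((act B ^^ k) (F 0)) p / fact k) * 1 ^ k) + (coef ((act B ^^ n) (F t)) p / fact n) * 1 ^ n"
      using Maclaurin_all_le[of "\<lambda>k t. coef ((act B ^^ k) (F t)) p" "\<lambda>t. coef (F t) p" 1 n] der[OF pQ] by auto
    then have "\<bar>coef (F 1) p - (\<Sum>k<n. coef ((act B ^^ k) (F 0)) p / fact k)\<bar> =
        \<bar>coef ((act B ^^ n) (F t)) p\<bar> * inverse (fact n)" by (simp add: divide_inverse abs_mult)
    also have "\<dots> \<le> m * K ^ n * inverse (fact n)"
      using bound[of t n] t(1) by (intro mult_right_mono) simp_all
    finally show ?thesis by (simp add: mult_ac)
  qed
  have "(\<lambda>n. m * (inverse (fact n) * K ^ n)) \<longlonglongrightarrow> 0"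
    by (intro summable_LIMSEQ_zero summable_mult summable_exp)
  then have "(\<lambda>n. coef (F 1) p - (\<Sum>k<n. coef ((act B ^^ k) (F 0)) p / fact k)) \<longlonglongrightarrow> 0"
    by (rule Lim_null_comparison[rotated]) (use rem in auto)
  then have "(\<lambda>n. coef (F 1) p - (coef (F 1) p - (\<Sum>k<n. coef ((act B ^^ k) (F 0)) p / fact k))) \<longlonglongrightarrow> coef (F 1) p - 0"
    by (intro tendsto_diff tendsto_const)
  then show ?thesis by (simp add: sums_def)
qed

text \<open>The multiplier by which the n-th iterate acts on the monomial q; it puts iterates back
  into the form \<open>act\<close>.\<close>

definition powB :: "(pl_monom \<Rightarrow> hahn) \<Rightarrow> nat \<Rightarrow> pl_monom \<Rightarrow> hahn" where
  "powB B n q = M (- q) * (act B ^^ n) (M q)"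

lemma powB:
  assumes "\<And>q. B q \<in> A"
  shows "powB B n q \<in> A" "(act B ^^ n) g = act (powB B n) g"
proof -
  have mem: "powB B n q \<in> A" for n q
  proof (rule A_I)
    fix p assume "p \<notin> T"
    moreover have "supp (coef (M q)) = {q}" by (auto simp: supp_def coef_M term_of_def)
    ultimately have "q + p \<notin> sumset (supp (coef (M q))) T"
      unfolding lex.sumset_def by (simp only: singleton_iff mem_Collect_eq) (metis add_left_cancel)
    then have "q + p \<notin> supp (coef ((act B ^^ n) (M q)))"
      using supp_act_iterate[OF sumset_T_closed subset_sumset_T] by blast
    then show "coef (powB B n q) p = 0" by (simp add: powB_def in_supp_iff add.commute)
  qed
  then show "powB B n q \<in> A" .
  show "(act B ^^ n) g = act (powB B n) g"
  proof (induction n)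
    case 0
    have "powB B 0 = (\<lambda>_. 1)" using M_minus(1)[of _ 1] by (simp add: powB_def fun_eq_iff)
    then show ?case by (simp add: act_trivial)
  next
    case (Suc n)
    have "(act B ^^ Suc n) g = act B (act (powB B n) g)" using Suc by simp
    also have "\<dots> = act (powB B (Suc n)) g"
      by (rule act_act[OF assms mem mem]) (simp add: powB_def)
    finally show ?case .
  qed
qed

text \<open>Each coefficient of \<open>act\<close> is a finite sum over q and commutes with the
  series in n. So the exponential, defined coefficientwise, is again of the form \<open>act\<close>
  and therefore strongly linear.\<close>

lemma act_exp_eq:
  assumes B: "\<And>q. B q \<in> A"
  obtains B' where "\<And>q. B' q \<in> A" "\<And>g p. coef (act B' g) p = (\<Sum>n. coef ((act B ^^ n) g) p / fact n)"
proof -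
  define B' where "B' q = Hahn (\<lambda>r. \<Sum>n. coef (powB B n q) r / fact n)" for q
  have coef_B': "coef (B' q) = (\<lambda>r. \<Sum>n. coef (powB B n q) r / fact n)" for q
    unfolding B'_def by (rule coef_Hahn[OF WO_T]) (rule subsetI, rule ccontr, simp add: in_supp_iff A_coef[OF powB(1)[OF B]])
  have A: "B' q \<in> A" for q by (rule A_I) (simp add: coef_B' A_coef[OF powB(1)[OF B]])
  have "coef (act B' g) p = (\<Sum>n. coef ((act B ^^ n) g) p / fact n)" for g p
  proof -
    let ?Q = "{q \<in> supp (coef g). p - q \<in> T}"
    have s: "summable (\<lambda>n. coef (powB B n q) r / fact n)" for q r
      using act_exp_summable[OF B, where g = "M q" and p = "r + q"] by (simp add: powB_def)
    have "(\<Sum>n. coef ((act B ^^ n) g) p / fact n) = (\<Sum>n. \<Sum>q\<in>?Q. coef g q * (coef (powB B n q) (p - q) / fact n))"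
      by (simp add: powB(2)[OF B] coef_act_raw sum_divide_distrib)
    also have "\<dots> = (\<Sum>q\<in>?Q. \<Sum>n. coef g q * (coef (powB B n q) (p - q) / fact n))"
      by (rule suminf_sum) (intro summable_mult s)
    also have "\<dots> = (\<Sum>q\<in>?Q. coef g q * coef (B' q) (p - q))"
      by (simp only: coef_B' suminf_mult[OF s])
    finally show ?thesis by (simp add: coef_act_raw)
  qed
  then show thesis using that A by blast
qed

end

subsection \<open>Leading exponents\<close>

lemma has_ord_iff: "has_ord f p \<longleftrightarrow> f p \<noteq> 0 \<and> (\<forall>q. f q \<noteq> 0 \<longrightarrow> p \<sqsubseteq> q)"
  by (simp add: has_ord_def supp_def in_lex_le_iff del: split_paired_All)

lemma has_ord_unique: "has_ord f p \<Longrightarrow> has_ord f q \<Longrightarrow> p = q"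
  unfolding has_ord_iff using lex.order.antisym by blast

lemma lead_exp_eq: "has_ord f (\<mu>, 0) \<Longrightarrow> lead_exp f = \<mu>"
  unfolding lead_exp_def by (rule the_equality) (auto dest: has_ord_unique)

lemma pl_LH_D:
  assumes "f \<in> pl_LH"
  shows "has_ord f (lead_exp f, 0)" "lead_exp f > 0" "lead_coeff_of f > 0" "WO (supp f)"
  using assms by (auto simp: pl_LH_def pl_L_def lead_coeff_of_def lead_exp_eq lex_well_ordered_iff)

lemma supp_eps_of:
  assumes "f \<in> pl_LH"
  shows "supp (eps_of f) \<subseteq> (\<lambda>s. s - (lead_exp f, 0)) ` supp f" "\<And>p. p \<in> supp (eps_of f) \<Longrightarrow> 0 \<sqsubset> p"
proof -
  have *: "f (p + (lead_exp f, 0)) \<noteq> 0 \<and> p \<noteq> 0" if "p \<in> supp (eps_of f)" for p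
    using that by (auto simp: supp_def eps_of_def zero_prod_def split: if_splits)
  show "supp (eps_of f) \<subseteq> (\<lambda>s. s - (lead_exp f, 0)) ` supp f"
  proof
    fix p assume "p \<in> supp (eps_of f)"
    then have "p + (lead_exp f, 0) \<in> supp f" using * by (simp add: in_supp_iff)
    moreover have "p = p + (lead_exp f, 0) - (lead_exp f, 0)" by simp
    ultimately show "p \<in> (\<lambda>s. s - (lead_exp f, 0)) ` supp f" by (rule rev_image_eqI)
  qed
  show "0 \<sqsubset> p" if "p \<in> supp (eps_of f)" for p
  proof -
    have "(lead_exp f, 0) \<sqsubseteq> p + (lead_exp f, 0)"
      using pl_LH_D(1)[OF assms] *[OF that] unfolding has_ord_iff by blast
    then have "0 \<sqsubseteq> p" using lex.le_add_right_cancel[of 0 "(lead_exp f, 0)" p] by simp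
    then show ?thesis using *[OF that] by (simp add: lex.less_le)
  qed
qed

lemma WO_translate: "WO S \<Longrightarrow> WO ((\<lambda>s. s - q) ` S)"
  by (rule lex.WO_image) (simp_all add: lex.le_add_right_cancel[of _ "- q", simplified])

lemma eps_of_monoid:
  assumes "f \<in> pl_LH"
  defines "T \<equiv> gen_monoid (supp (eps_of f))"
  shows "supp_monoid T" "eps_of f = coef (Hahn (eps_of f))" "Hahn (eps_of f) \<in> supp_monoid.I T"
proof -
  have wo: "WO (supp (eps_of f))"
    by (rule lex.WO_subset[OF WO_translate[OF pl_LH_D(4)] supp_eps_of(1)]) fact+
  show T: "supp_monoid T" unfolding T_def
    by (rule supp_monoid_gen_monoid[OF wo supp_eps_of(2)[OF assms(1)]])
  interpret supp_monoid T by (rule T)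
  show eq: "eps_of f = coef (Hahn (eps_of f))" using wo by (simp add: coef_Hahn)
  have "supp (eps_of f) \<subseteq> T" unfolding T_def using gen_monoid_gen(1) by blast
  moreover have "eps_of f 0 = 0" by (simp add: eps_of_def zero_prod_def)
  ultimately show "Hahn (eps_of f) \<in> I" by (simp add: I_def A_def flip: eq)
qed

text \<open>A term q of g contributes at (\<mu> \<open>fst q\<close>, \<open>snd q\<close>) plus
  elements of \<open>T\<close>. As \<mu> > 0 preserves the order and \<open>T\<close> is
  nonnegative, only the leading term of g reaches down to (\<mu> \<nu>, 0), where it carries the
  nonzero factor a^\<nu>.\<close>

lemma has_ord_pl_comp:
  assumes f: "f \<in> pl_LH" and g: "g \<in> pl_LH"
  shows "has_ord (pl_comp g f) (lead_exp f * lead_exp g, 0)"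
proof -
  define T where "T = gen_monoid (supp (eps_of f))"
  interpret supp_monoid T unfolding T_def by (rule eps_of_monoid(1)[OF f])
  define e where "e = Hahn (eps_of f)"
  have e: "e \<in> I" "eps_of f = coef e"
    using eps_of_monoid(2,3)[OF f] by (simp_all add: e_def T_def)
  define \<mu> a \<nu> where "\<mu> = lead_exp f" and "a = lead_coeff_of f" and "\<nu> = lead_exp g"
  have pos: "\<mu> > 0" "a > 0" using pl_LH_D[OF f] by (simp_all add: \<mu>_def a_def)
  have g0: "g (\<nu>, 0) \<noteq> 0" "\<And>q. g q \<noteq> 0 \<Longrightarrow> (\<nu>, 0) \<sqsubseteq> q"
    using pl_LH_D(1)[OF g] unfolding has_ord_iff \<nu>_def by blast+
  note sum = pl_comp_eq_sum[where f = f and g = g, OF \<mu>_def[symmetric] a_def[symmetric] pos e(2,1)]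
  have min: "q = (\<nu>, 0) \<and> p = (\<mu> * \<nu>, 0)"
    if "g q \<noteq> 0" "p - (\<mu> * fst q, snd q) \<in> T" "p \<sqsubseteq> (\<mu> * \<nu>, 0)" for p q
    using g0(2)[OF that(1)] nonneg_T[OF that(2)] that(3) pos
    by (auto simp: lle_def prod_eq_iff mult_less_cancel_left_pos) (smt (verit) mult_less_cancel_left_pos)+
  have "pl_comp g f (\<mu> * \<nu>, 0) = (\<Sum>q\<in>{(\<nu>, 0)}. g q * coef (compB \<mu> a e q) ((\<mu> * \<nu>, 0) - (\<mu> * fst q, snd q)))"
    using min[where p = "(\<mu> * \<nu>, 0)"] by (intro sum) auto
  also have "\<dots> = g (\<nu>, 0) * a powr \<nu>"
    using coef_pw_zero[OF e(1)] pw_0[OF shift_in_I[OF e(1)]]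
    by (simp add: compB_def coef_mult_zero A_mult pw_A e coef_C term_of_def flip: zero_prod_def)
  finally have "pl_comp g f (\<mu> * \<nu>, 0) \<noteq> 0" using g0 pos by simp
  moreover have "(\<mu> * \<nu>, 0) \<sqsubseteq> p" if "pl_comp g f p \<noteq> 0" for p
  proof (rule ccontr)
    assume "\<not> (\<mu> * \<nu>, 0) \<sqsubseteq> p"
    then have p: "p \<sqsubset> (\<mu> * \<nu>, 0)" by (simp add: lex.not_le)
    then have "pl_comp g f p = (\<Sum>q\<in>{}. g q * coef (compB \<mu> a e q) (p - (\<mu> * fst q, snd q)))"
      using min[where p = p] by (intro sum) (auto simp: lex.less_le)
    then show False using that by simp
  qed
  ultimately show ?thesis unfolding has_ord_iff \<mu>_def \<nu>_def by blast
qed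

text \<open>Otherwise the leading exponents exceeding 1 have a least element \<open>\<mu> s\<close>, but
  \<open>1 < \<mu> (s / 2) < \<mu> s\<close>.\<close>
lemma flow_lead_exp:
  assumes flow: "is_flow F" and S: "WO S" "\<And>t. supp (F t) \<subseteq> S"
  shows "lead_exp (F t) = 1"
proof -
  define \<mu> where "\<mu> t = lead_exp (F t)" for t
  have LH: "F t \<in> pl_LH" for t using flow by (simp add: is_flow_def)
  have pos: "\<mu> t > 0" for t unfolding \<mu>_def by (rule pl_LH_D(2)[OF LH])
  have add: "\<mu> (s + t) = \<mu> t * \<mu> s" for s t
    using lead_exp_eq[OF has_ord_pl_comp[OF LH LH, of s t]] flow by (simp add: \<mu>_def is_flow_def)
  have no: "\<not> 1 < \<mu> t" for t
  proof
    assume "1 < \<mu> t"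
    define X where "X = {(\<mu> s, 0) |s. 1 < \<mu> s} \<inter> S"
    have memS: "(\<mu> s, 0) \<in> S" for s
      using pl_LH_D(1)[OF LH[of s]] S(2)[of s] by (auto simp: \<mu>_def has_ord_def)
    have "(\<mu> t, 0) \<in> X" using \<open>1 < \<mu> t\<close> memS by (auto simp: X_def)
    then obtain m where m: "m \<in> X" "\<forall>c\<in>X. m \<sqsubseteq> c"
      using lex.WO_Ex[OF S(1), of X] unfolding X_def by blast
    then obtain s where s: "m = (\<mu> s, 0)" "1 < \<mu> s" by (auto simp: X_def)
    have sq: "\<mu> (s / 2) * \<mu> (s / 2) = \<mu> s" using add[of "s / 2" "s / 2"] by simp
    have gt: "1 < \<mu> (s / 2)"
      using sq s(2) pos[of "s / 2"] by (smt (verit) mult_left_le)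
    then have "\<mu> (s / 2) < \<mu> s" using sq pos[of "s / 2"] by (metis mult.right_neutral mult_less_cancel_left_pos)
    moreover have "(\<mu> (s / 2), 0) \<in> X" using gt memS by (auto simp: X_def)
    ultimately show False using m(2) s(1) by (force simp: lle_def)
  qed
  have "has_ord pl_id (1, 0)" by (auto simp: has_ord_iff pl_id_def term_of_def lle_def)
  then have "\<mu> 0 = 1" using flow lead_exp_eq by (simp add: is_flow_def \<mu>_def)
  \<comment> \<open>An exponent below 1 at time t would give one above 1 at time - t.\<close>
  then have "\<mu> (- t) * \<mu> t = 1" using add[of t "- t"] by simp
  moreover have "\<mu> (- t) * \<mu> t < 1 * 1" if "\<mu> t < 1"
    using that no[of "- t"] pos[of t] pos[of "- t"] by (intro mult_le_less_imp_less) simp_all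
  ultimately show ?thesis using no[of t] unfolding \<mu>_def by linarith
qed

subsection \<open>Domains of operators\<close>

lemma add_semigroup_mono: "p \<in> add_semigroup G \<Longrightarrow> G \<subseteq> H \<Longrightarrow> p \<in> add_semigroup H"
  by (induction rule: add_semigroup.induct) (auto intro: add_semigroup.intros)

lemma sumset_gen_monoid:
  assumes "S \<subseteq> add_semigroup (insert (0, 1) G)"
  shows "sumset S (gen_monoid P) \<subseteq> add_semigroup (insert (0, 1) (G \<union> P))"
proof
  fix p assume "p \<in> sumset S (gen_monoid P)"
  then obtain s q where sq: "s \<in> S" "q \<in> gen_monoid P" "p = s + q" unfolding lex.sumset_def by blast
  have "s \<in> add_semigroup (insert (0, 1) G)" using sq(1) assms by (rule subsetD[rotated])
  then have s: "s \<in> add_semigroup (insert (0, 1) (G \<union> P))" by (rule add_semigroup_mono) blast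
  show "p \<in> add_semigroup (insert (0, 1) (G \<union> P))"
  proof (cases "q = 0")
    case False
    then have "q \<in> add_semigroup (insert (0, 1) P)" using sq(2) by (simp add: gen_monoid_def)
    then have "q \<in> add_semigroup (insert (0, 1) (G \<union> P))" by (rule add_semigroup_mono) blast
    then show ?thesis using s sq(3) by (simp add: add_semigroup.add)
  qed (use s sq(3) in simp)
qed

text \<open>Lets one argument serve both series spaces: the monoid absorbs the support of g / x,
  while \<open>D\<close> stays closed under enlarging supports by it. For \<open>pl_LD\<close> this
  takes the finitely many generators of \<open>finitely_generated_shift\<close>.\<close>

lemma domain_monoid:
  assumes D: "D = pl_L \<or> D = pl_LD" and g: "g \<in> D" "has_ord g (1, 0)"
  obtains T where "supp_monoid T" "\<And>s. s \<in> supp g \<Longrightarrow> s - (1, 0) \<in> T"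
    "\<And>f h. f \<in> D \<Longrightarrow> supp h \<subseteq> sumset (supp f) T \<Longrightarrow> h \<in> D"
proof -
  have ge: "(1, 0) \<sqsubseteq> s" if "s \<in> supp g" for s
    using g(2) that unfolding has_ord_iff in_supp_iff by blast
  have L: "h \<in> pl_L" if T: "supp_monoid T" and "f \<in> pl_L" "supp h \<subseteq> sumset (supp f) T" for T f h
  proof -
    interpret supp_monoid T by (rule T)
    have "WO (sumset (supp f) T)"
      using that by (intro lex.WO_sumset WO_T) (simp add: pl_L_def lex_well_ordered_iff)
    then have "lex_well_ordered (supp h)" using that(3) lex.WO_subset lex_well_ordered_iff by blast
    moreover have "p \<in> positive_monoms" if "p \<in> sumset (supp f) T" for p
    proof -
      have "\<exists>s t. s \<in> supp f \<and> t \<in> T \<and> p = s + t" using that unfolding lex.sumset_def by blast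
      then obtain s t where st: "s \<in> supp f" "t \<in> T" "p = s + t" by blast
      have "s \<in> positive_monoms" using st \<open>f \<in> pl_L\<close> by (auto simp: pl_L_def)
      then show ?thesis using nonneg_T[OF st(2)] st(3) by (auto simp: positive_monoms_def lle_def mem_Times_iff)
    qed
    ultimately show ?thesis using that(3) by (auto simp: pl_L_def)
  qed
  from D show thesis
  proof
    assume DL: "D = pl_L"
    define P where "P = (\<lambda>s. s - (1, 0)) ` supp g - {0}"
    have "WO (supp g)" using g(1) DL by (simp add: pl_L_def lex_well_ordered_iff)
    then have wo: "WO P" unfolding P_def by (rule lex.WO_subset[OF WO_translate]) blast
    have pos: "0 \<sqsubset> p" if "p \<in> P" for p
    proof -
      have "p \<in> (\<lambda>s. s - (1, 0)) ` supp g" "p \<noteq> 0"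
        using that unfolding P_def Diff_iff singleton_iff by (rule conjunct1, rule conjunct2)
      then obtain s where "s \<in> supp g" "p = s - (1, 0)" "p \<noteq> 0" by (elim imageE)
      then show ?thesis using ge[of s] lex.le_iff_diff[of "(1, 0)" s] by (simp add: lex.less_le)
    qed
    have T: "supp_monoid (gen_monoid P)" by (rule supp_monoid_gen_monoid[OF wo pos])
    show thesis
    proof (rule that[OF T])
      show "s - (1, 0) \<in> gen_monoid P" if "s \<in> supp g" for s
        using that gen_monoid_gen(1)[of "s - (1, 0)" P] by (cases "s - (1, 0) = 0") (simp_all add: gen_monoid_def P_def)
    qed (use L[OF T] DL in blast)
  next
    assume DL: "D = pl_LD"
    obtain G where G: "finite G" "G \<subseteq> positive_monoms" "supp g \<subseteq> add_semigroup (insert (0, 1) G)"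
      using g(1) DL by (auto simp: pl_LD_def)
    obtain P where P: "finite P" "P \<subseteq> positive_monoms"
      "\<And>s. s \<in> add_semigroup (insert (0, 1) G) \<Longrightarrow> (1, 0) \<sqsubseteq> s \<Longrightarrow> s - (1, 0) \<in> gen_monoid P"
      using finitely_generated_shift[OF G(1,2)] by metis
    have pos: "0 \<sqsubset> p" if "p \<in> P" for p using that P(2) by (auto simp: positive_monoms_def llt_def)
    have T: "supp_monoid (gen_monoid P)"
      by (rule supp_monoid_gen_monoid[OF lex.WO_finite[OF P(1)] pos])
    show thesis
    proof (rule that[OF T])
      show "s - (1, 0) \<in> gen_monoid P" if "s \<in> supp g" for s using P(3) G(3) ge[OF that] that by blast
      show "h \<in> D" if "f \<in> D" "supp h \<subseteq> sumset (supp f) (gen_monoid P)" for f h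
      proof -
        have "\<exists>H. finite H \<and> H \<subseteq> positive_monoms \<and> supp f \<subseteq> add_semigroup (insert (0, 1) H)"
          using that(1) by (simp add: DL pl_LD_def)
        then obtain H where H: "finite H" "H \<subseteq> positive_monoms" "supp f \<subseteq> add_semigroup (insert (0, 1) H)"
          by blast
        have "supp h \<subseteq> add_semigroup (insert (0, 1) (H \<union> P))"
          using that(2) sumset_gen_monoid[OF H(3)] by blast
        moreover have "finite (H \<union> P)" "H \<union> P \<subseteq> positive_monoms" using H P by auto
        moreover have "f \<in> pl_L" using that(1) DL by (simp add: pl_LD_def)
        then have "h \<in> pl_L" using that(2) by (rule L[OF T])
        ultimately show ?thesis using DL unfolding pl_LD_def by blast
      qed
    qed
  qed
qed

lemma coef_M10: "coef (M (1, 0)) = pl_id"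
  by (simp add: coef_M pl_id_def)

lemma supp_pl_id: "supp pl_id = {(1, 0)}"
  by (auto simp: supp_def pl_id_def term_of_def)

lemma pl_id_domain: "D = pl_L \<or> D = pl_LD \<Longrightarrow> pl_id \<in> D"
proof -
  have L: "pl_id \<in> pl_L"
    by (simp add: pl_L_def supp_pl_id lex_well_ordered_iff positive_monoms_def)
  have "supp pl_id \<subseteq> add_semigroup (insert (0, 1) {(1, 0)})"
    by (simp add: supp_pl_id add_semigroup.gen)
  then have "pl_id \<in> pl_LD"
    using L unfolding pl_LD_def by (auto simp: positive_monoms_def intro!: exI[of _ "{(1, 0)}"])
  with L show "D = pl_L \<or> D = pl_LD \<Longrightarrow> pl_id \<in> D" by blast
qed

context supp_monoid
begin

lemma is_operator_act:
  assumes D: "D \<subseteq> pl_L" "\<And>g h. g \<in> D \<Longrightarrow> supp h \<subseteq> sumset (supp g) T \<Longrightarrow> h \<in> D"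
    and B: "\<And>q. B q \<in> A" and Op: "\<And>g. Op (coef g) = coef (act B g)"
  shows "is_operator D Op"
  unfolding is_operator_def
proof (intro ballI conjI)
  fix g assume g: "g \<in> D"
  then have "WO (supp g)" using D(1) by (auto simp: pl_L_def lex_well_ordered_iff)
  then have "g = coef (Hahn g)" by (simp add: coef_Hahn)
  then obtain g' where g': "g = coef g'" by blast
  have monom: "pl_scale (g p) (Op (term_of 1 p)) r = g p * coef (B p) (r - p)" for p r
    using Op[of "M p"] by (simp add: act_M B coef_M pl_scale_def)
  have ne: "p \<in> {q \<in> supp g. r - q \<in> T}" if "pl_scale (g p) (Op (term_of 1 p)) r \<noteq> 0" for p r
    using that A_coef[OF B, of "r - p" p] unfolding monom by (auto simp: in_supp_iff)
  have fin: "finite {q \<in> supp g. r - q \<in> T}" for r unfolding g' by (rule finite_below)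
  show "Op g \<in> D" unfolding g' Op by (rule D(2)[OF g]) (simp add: g' supp_act)
  show "strongly_summable (\<lambda>p. pl_scale (g p) (Op (term_of 1 p)))"
    unfolding strongly_summable_def lex_well_ordered_iff
  proof
    have "r \<in> sumset (supp g) T" if "r \<in> supp (pl_scale (g p) (Op (term_of 1 p)))" for p r
      using ne[of p r] that lex.sumsetI[of p "supp g" "r - p" T] by (simp add: in_supp_iff)
    then have "(\<Union>p. supp (pl_scale (g p) (Op (term_of 1 p)))) \<subseteq> sumset (supp g) T" by blast
    then show "WO (\<Union>p. supp (pl_scale (g p) (Op (term_of 1 p))))"
      using lex.WO_subset lex.WO_sumset[OF \<open>WO (supp g)\<close> WO_T] by blast
    show "\<forall>r. finite {p. pl_scale (g p) (Op (term_of 1 p)) r \<noteq> 0}"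
    proof
      fix r
      have "{p. pl_scale (g p) (Op (term_of 1 p)) r \<noteq> 0} \<subseteq> {q \<in> supp g. r - q \<in> T}" using ne by blast
      then show "finite {p. pl_scale (g p) (Op (term_of 1 p)) r \<noteq> 0}" using fin by (rule finite_subset)
    qed
  qed
  show "Op g = strong_sum (\<lambda>p. pl_scale (g p) (Op (term_of 1 p)))"
  proof
    fix r
    have "strong_sum (\<lambda>p. pl_scale (g p) (Op (term_of 1 p))) r =
        (\<Sum>p\<in>{q \<in> supp g. r - q \<in> T}. pl_scale (g p) (Op (term_of 1 p)) r)"
      using fin ne by (rule strong_sum_eq_sum)
    then show "Op g r = strong_sum (\<lambda>p. pl_scale (g p) (Op (term_of 1 p))) r"
      unfolding monom by (simp add: g' Op coef_act_raw)
  qed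
qed

lemma vf_apply_iterate:
  "\<eta> \<in> A \<Longrightarrow> (vf_apply (coef (M (1, 0) * \<eta>)) ^^ n) (coef g) = coef ((act (fieldB \<eta>) ^^ n) g)"
  by (induction n) (simp_all only: funpow.simps comp_apply id_apply vf_apply_coef)

lemma weakly_well_defined_vf_exp:
  assumes D: "D \<subseteq> pl_L" "\<And>g h. g \<in> D \<Longrightarrow> supp h \<subseteq> sumset (supp g) T \<Longrightarrow> h \<in> D"
    and \<eta>: "\<eta> \<in> A" and \<xi>: "\<xi> = coef (M (1, 0) * \<eta>)"
  shows "weakly_well_defined_by D (vf_exp \<xi>) (vf_exp_term \<xi>)"
proof -
  note B = fieldB_A[OF \<eta>]
  have term_eq: "vf_exp_term \<xi> n (coef g) = coef (C (1 / fact n) * (act (fieldB \<eta>) ^^ n) g)" for n g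
    unfolding vf_exp_term_def \<xi> vf_apply_iterate[OF \<eta>] by (rule pl_scale_coef)
  obtain B' where B': "\<And>q. B' q \<in> A"
    "\<And>g p. coef (act B' g) p = (\<Sum>n. coef ((act (fieldB \<eta>) ^^ n) g) p / fact n)"
    using act_exp_eq[of "fieldB \<eta>"] B by metis
  show ?thesis unfolding weakly_well_defined_by_def
  proof (intro conjI allI ballI)
    show "is_operator D (vf_exp \<xi>)"
    proof (rule is_operator_act[OF D B'(1)])
      show "vf_exp \<xi> (coef g) = coef (act B' g)" for g
        by (rule ext) (simp add: vf_exp_def term_eq B'(2))
    qed
    show "is_operator D (vf_exp_term \<xi> n)" for n
    proof (rule is_operator_act[OF D])
      show "C (1 / fact n) * powB (fieldB \<eta>) n q \<in> A" for q by (intro A_mult A_C powB(1) B)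
      show "vf_exp_term \<xi> n (coef g) = coef (act (\<lambda>q. C (1 / fact n) * powB (fieldB \<eta>) n q) g)" for g
        unfolding term_eq using B by (simp only: act_mult_const[OF A_C powB(1)] powB(2))
    qed
    fix g p assume "g \<in> D"
    then have "WO (supp g)" using D(1) by (auto simp: pl_L_def lex_well_ordered_iff)
    then have "g = coef (Hahn g)" by (simp add: coef_Hahn)
  then obtain g' where g': "g = coef g'" by blast
    have "summable (\<lambda>n. vf_exp_term \<xi> n g p)"
      using act_exp_summable[where B = "fieldB \<eta>" and g = g' and p = p, OF B] by (simp add: g' term_eq)
    then show "(\<lambda>n. vf_exp_term \<xi> n g p) sums vf_exp \<xi> g p" unfolding vf_exp_def by (rule summable_sums)
  qed
qed

subsection \<open>Flows of tangent series\<close>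

lemma coef_ser: "coef (ser a e) p = a * (coef 1 (p - (1, 0)) + coef e (p - (1, 0)))"
  by (simp add: ser_def mult.assoc)

lemma ser_props:
  assumes "e \<in> I" "a > 0"
  shows "coef (ser a e) (1, 0) = a" "has_ord (coef (ser a e)) (1, 0)" "lead_exp (coef (ser a e)) = 1"
    "lead_coeff_of (coef (ser a e)) = a" "eps_of (coef (ser a e)) = coef e"
    "supp (coef (ser a e)) \<subseteq> sumset {(1, 0)} T" "coef (ser a e) \<in> pl_LH"
proof -
  show 1: "coef (ser a e) (1, 0) = a"
    using assms by (simp add: coef_ser I_def coef_one term_of_def flip: zero_prod_def)
  have T: "p - (1, 0) \<in> T" if "coef (ser a e) p \<noteq> 0" for p
  proof (rule ccontr)
    assume "p - (1, 0) \<notin> T"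
    then show False using that A_coef[OF A_one] A_coef[OF I_A[OF assms(1)]] by (simp add: coef_ser)
  qed
  show 2: "has_ord (coef (ser a e)) (1, 0)" unfolding has_ord_iff
  proof (intro conjI allI impI)
    show "(1, 0) \<sqsubseteq> p" if "coef (ser a e) p \<noteq> 0" for p
      using nonneg_T[OF T[OF that]] lex.le_iff_diff by blast
  qed (use 1 assms in simp)
  show 3: "lead_exp (coef (ser a e)) = 1" by (rule lead_exp_eq[OF 2])
  show 4: "lead_coeff_of (coef (ser a e)) = a" unfolding lead_coeff_of_def 3 by (rule 1)
  show "eps_of (coef (ser a e)) = coef e"
  proof
    fix p show "eps_of (coef (ser a e)) p = coef e p"
      using assms unfolding eps_of_def 3 4 coef_ser
      by (simp add: I_def coef_one term_of_def flip: zero_prod_def)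
  qed
  show sub: "supp (coef (ser a e)) \<subseteq> sumset {(1, 0)} T"
  proof
    fix p assume "p \<in> supp (coef (ser a e))"
    then show "p \<in> sumset {(1, 0)} T"
      using T[of p] lex.sumsetI[of "(1, 0)" "{(1, 0)}" "p - (1, 0)" T] by (simp add: in_supp_iff)
  qed
  have "q \<in> positive_monoms" if "q \<in> supp (coef (ser a e))" for q
    using 2 that unfolding has_ord_iff in_supp_iff by (fastforce simp: lle_def positive_monoms_def mem_Times_iff)
  then show "coef (ser a e) \<in> pl_LH"
    using 1 2 assms(2) by (auto simp: pl_LH_def pl_L_def lex_well_ordered_iff intro!: exI[of _ 1])
qed

lemma ser_repr:
  assumes "WO (supp f)" "f (1, 0) \<noteq> 0" "\<And>s. s \<in> supp f \<Longrightarrow> s - (1, 0) \<in> T"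
  obtains e where "e \<in> I" "f = coef (ser (f (1, 0)) e)"
proof -
  define a where "a = f (1, 0)"
  define e where "e = C (inverse a) * (M (- 1, 0) * Hahn f) - 1"
  have coef_f: "coef (Hahn f) = f" using assms(1) by (simp add: coef_Hahn)
  have inv: "M (1, 0) * (M (- 1, 0) * h) = h" for h using M_minus(2)[of "(1, 0)" h] by simp
  have "ser a e = (C a * C (inverse a)) * (M (1, 0) * (M (- 1, 0) * Hahn f))"
    by (simp add: ser_def e_def mult_ac)
  also have "\<dots> = Hahn f" using assms(2) unfolding inv by (simp add: a_def flip: C_mult)
  finally have eq: "f = coef (ser a e)" using coef_f by simp
  have "e \<in> A"
  proof (rule A_I)
    fix p assume p: "p \<notin> T"
    then have "f (p + (1, 0)) = 0" using assms(3)[of "p + (1, 0)"] by (auto simp: in_supp_iff)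
    moreover have "p - (- 1, 0) = p + (1, 0)" by (simp add: prod_eq_iff)
    ultimately show "coef e p = 0" using A_coef[OF A_one p] by (simp only: e_def coef_diff coef_C_mult coef_M_mult coef_f mult_zero_right diff_self)
  qed
  moreover have "0 - (- 1, 0) = ((1, 0) :: pl_monom)" by (simp add: prod_eq_iff)
  then have "coef e 0 = 0"
    using assms(2) by (simp only: e_def coef_diff coef_C_mult coef_M_mult coef_f) (simp add: a_def coef_one term_of_def)
  ultimately have "e \<in> I" by (simp add: I_def)
  then show thesis using eq unfolding a_def by (rule that)
qed

lemma pl_comp_ser:
  assumes "e \<in> I" "a > 0" shows "pl_comp (coef g) (coef (ser a e)) = coef (act (tangB a e) g)"
  by (rule pl_comp_act[where \<mu> = 1])
    (use ser_props[OF assms] assms in simp_all)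

text \<open>Since \<open>flow_lead_exp\<close> fixes the leading exponent, an arbitrary C1-flow can
  be written as a(t) x (1 + E(t)) and passed to \<open>flow_ode\<close>.\<close>

lemma C1_flow_data:
  assumes F: "is_C1_flow_of \<xi> F" and T: "\<forall>t. \<forall>s\<in>supp (F t). s - (1, 0) \<in> T"
  shows "\<exists>\<eta> h. solves \<eta> h \<and> \<xi> = coef (M (1, 0) * \<eta>) \<and> (\<forall>t. F t = coef (M (1, 0) * h t))"
proof -
  have flow: "is_flow F" and C1: "is_C1_flow F" and \<xi>: "\<xi> = (\<lambda>p. deriv (\<lambda>t. F t p) 0)"
    using F by (simp_all add: is_C1_flow_of_def is_C1_flow_def)
  obtain S where S: "WO S" "\<And>t. supp (F t) \<subseteq> S" "\<And>p. p \<in> S \<Longrightarrow> (\<lambda>t. F t p) C1_differentiable_on UNIV"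
    using C1 unfolding is_C1_flow_def lex_well_ordered_iff by blast
  have LH: "F t \<in> pl_LH" for t using flow by (simp add: is_flow_def)
  define a where "a t = F t (1, 0)" for t
  have a: "a t > 0" for t
    using pl_LH_D(3)[OF LH[of t]] flow_lead_exp[OF flow S(1,2)] by (simp add: lead_coeff_of_def a_def)
  have "\<exists>e. e \<in> I \<and> F t = coef (ser (a t) e)" for t
    using ser_repr[OF pl_LH_D(4)[OF LH], of t] a[of t] T unfolding a_def by (metis less_irrefl)
  then obtain E where E: "\<And>t. E t \<in> I" "\<And>t. F t = coef (ser (a t) (E t))" by metis
  have a0: "a 0 = 1" using flow by (simp add: a_def is_flow_def pl_id_def term_of_def)
  have E0: "E 0 = 0"
  proof (rule hahn_eqI)
    fix p
    have "coef (E 0) p = eps_of pl_id p"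
      using ser_props(5)[OF E(1) a] E(2)[of 0] flow by (metis is_flow_def)
    also have "pl_id = coef (ser 1 0)" by (simp add: ser_def coef_M10)
    also have "eps_of (coef (ser 1 0)) p = coef 0 p" by (simp add: ser_props(5))
    finally show "coef (E 0) p = coef 0 p" .
  qed
  have comp: "act (tangB (a t) (E t)) (ser (a s) (E s)) = ser (a (s + t)) (E (s + t))" for s t
  proof -
    have "coef (act (tangB (a t) (E t)) (ser (a s) (E s))) = pl_comp (F s) (F t)"
      by (simp only: E(2) pl_comp_ser[OF E(1) a])
    also have "\<dots> = coef (ser (a (s + t)) (E (s + t)))" using flow E(2) by (simp add: is_flow_def)
    finally show ?thesis by (simp add: coef_inject)
  qed
  have diff: "(\<lambda>t. coef (ser (a t) (E t)) p) differentiable (at 0)" for p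
  proof (cases "p \<in> S")
    case True
    then show ?thesis
      using S(3)[of p] by (auto simp: C1_differentiable_on_def E(2) intro: differentiableI_vector)
  next
    case False
    then have "F t p = 0" for t using S(2)[of t] by (metis in_supp_iff subsetD)
    then show ?thesis by (simp flip: E(2))
  qed
  define h where "h t = C (a t) * (1 + E t)" for t
  have ser_h: "ser (a t) (E t) = M (1, 0) * h t" for t by (simp add: ser_def h_def mult_ac)
  obtain \<eta> where \<eta>: "\<eta> \<in> A" "\<And>p. deriv (\<lambda>t. coef (ser (a t) (E t)) p) 0 = coef (M (1, 0) * \<eta>) p"
    "\<And>s p. ((\<lambda>t. coef (ser (a t) (E t)) p) has_real_derivative
       coef (act (fieldB \<eta>) (ser (a s) (E s))) p) (at s)"
    using flow_ode[of a E, OF a E(1) a0 E0 comp diff] by blast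
  have "solves \<eta> h" unfolding solves_def
  proof (intro conjI allI)
    show "h t \<in> A" for t unfolding h_def by (intro A_mult A_add A_C A_one I_A[OF E(1)])
    show "h 0 = 1" by (simp add: h_def a0 E0)
  qed (use \<eta>(1,3) in \<open>simp_all only: ser_h\<close>)
  moreover have "\<xi> = coef (M (1, 0) * \<eta>)" using \<eta>(2) by (simp only: \<xi> E(2) fun_eq_iff simp_thms)
  moreover have "F t = coef (M (1, 0) * h t)" for t by (simp only: E(2) ser_h)
  ultimately show ?thesis by blast
qed

end

text \<open>Comparing two flows takes one triangular system, hence one monoid for both. Its
  generators come from the common supports of the flows, divided by x; nothing lies below x because
  the leading exponents are 1.\<close>

lemma flow_monoid:
  assumes "is_C1_flow F" "is_C1_flow G"
  obtains T where "supp_monoid T" "\<forall>t. \<forall>s\<in>supp (F t). s - (1, 0) \<in> T"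
    "\<forall>t. \<forall>s\<in>supp (G t). s - (1, 0) \<in> T"
proof -
  have "\<exists>S. WO S \<and> (\<forall>t. supp (F t) \<subseteq> S \<and> (\<forall>s\<in>supp (F t). (1, 0) \<sqsubseteq> s))" if F: "is_C1_flow F" for F
  proof -
    have flow: "is_flow F" using F by (simp add: is_C1_flow_def)
    obtain S where S: "WO S" "\<And>t. supp (F t) \<subseteq> S"
      using F unfolding is_C1_flow_def lex_well_ordered_iff by blast
    have "has_ord (F t) (1, 0)" for t
      using pl_LH_D(1)[of "F t"] flow_lead_exp[OF flow S] flow by (simp add: is_flow_def)
    then have "\<forall>s\<in>supp (F t). (1, 0) \<sqsubseteq> s" for t
      unfolding has_ord_def in_lex_le_iff by (rule conjunct2)
    then show ?thesis using S by (intro exI[of _ S] conjI allI)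
  qed
  then obtain S S' where S: "WO S" "\<And>t. supp (F t) \<subseteq> S" "\<And>t s. s \<in> supp (F t) \<Longrightarrow> (1, 0) \<sqsubseteq> s"
    and S': "WO S'" "\<And>t. supp (G t) \<subseteq> S'" "\<And>t s. s \<in> supp (G t) \<Longrightarrow> (1, 0) \<sqsubseteq> s"
    using assms by meson
  define P where "P = (\<lambda>s. s - (1, 0)) ` {s \<in> S \<union> S'. (1, 0) \<sqsubset> s}"
  have "WO {s \<in> S \<union> S'. (1, 0) \<sqsubset> s}" by (rule lex.WO_subset[OF lex.WO_Un[OF S(1) S'(1)]]) blast
  then have "WO P" unfolding P_def by (rule WO_translate)
  moreover have "0 \<sqsubset> p" if "p \<in> P" for p
    using that lex.lt_iff_diff[of "(1, 0)"] unfolding P_def by blast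
  ultimately have T: "supp_monoid (gen_monoid P)" by (rule supp_monoid_gen_monoid)
  have mem: "s - (1, 0) \<in> gen_monoid P" if "s \<in> S \<union> S'" "(1, 0) \<sqsubseteq> s" for s
  proof (cases "s = (1, 0)")
    case False
    then have "s - (1, 0) \<in> P" using that unfolding P_def by (simp add: lex.less_le)
    then show ?thesis by (rule gen_monoid_gen(1))
  qed (simp add: gen_monoid_def)
  show thesis using that[OF T] mem S(2,3) S'(2,3) by blast
qed

lemma C1_flow_unique:
  assumes "is_C1_flow_of \<xi> F" "is_C1_flow_of \<zeta> G" "F 1 = G 1" shows "\<xi> = \<zeta>"
proof -
  obtain T where T: "supp_monoid T" "\<forall>t. \<forall>s\<in>supp (F t). s - (1, 0) \<in> T"
    "\<forall>t. \<forall>s\<in>supp (G t). s - (1, 0) \<in> T"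
    using flow_monoid[of F G] assms unfolding is_C1_flow_of_def by metis
  interpret supp_monoid T by (rule T)
  obtain \<eta> h where \<eta>: "solves \<eta> h" "\<xi> = coef (M (1, 0) * \<eta>)" "\<forall>t. F t = coef (M (1, 0) * h t)"
    using C1_flow_data[OF assms(1) T(2)] by blast
  obtain \<theta> k where \<theta>: "solves \<theta> k" "\<zeta> = coef (M (1, 0) * \<theta>)" "\<forall>t. G t = coef (M (1, 0) * k t)"
    using C1_flow_data[OF assms(2) T(3)] by blast
  have "M (1, 0) * h 1 = M (1, 0) * k 1"
    using assms(3) \<eta>(3)[rule_format, of 1] \<theta>(3)[rule_format, of 1] by (simp only: coef_inject)
  then have "h 1 = k 1" using M_minus(1)[of "(1, 0)"] by metis
  then have "\<eta> = \<theta>" by (rule flow_unique[OF \<eta>(1) \<theta>(1)])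
  then show ?thesis by (simp only: \<eta>(2) \<theta>(2))
qed

text \<open>By \<open>lead_exponential\<close> the multiplier of \<open>F 1\<close> is the
  exponential of the coefficient of \<xi> at x; a multiplier other than 1 makes that coefficient
  nonzero.\<close>

lemma C1_flow_exp:
  assumes F: "is_C1_flow_of \<xi> F" and "F 1 (1, 0) \<noteq> 1"
  shows "has_ord \<xi> (1, 0)" "F 1 = vf_exp \<xi> pl_id"
proof -
  obtain T where T: "supp_monoid T" "\<forall>t. \<forall>s\<in>supp (F t). s - (1, 0) \<in> T"
    using flow_monoid[of F F] F unfolding is_C1_flow_of_def by metis
  interpret supp_monoid T by (rule T)
  obtain \<eta> h where sol: "solves \<eta> h" and \<xi>: "\<xi> = coef (M (1, 0) * \<eta>)"
    and F_eq: "\<forall>t. F t = coef (M (1, 0) * h t)"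
    using C1_flow_data[OF F T(2)] by blast
  note \<eta> = solvesD(1)[OF sol] \<xi> and h = solvesD(2,3)[OF sol] F_eq[rule_format] and ode = solvesD(4)[OF sol]
  have "coef (h 1) 0 = exp (coef \<eta> 0 * 1)" by (rule lead_exponential[OF sol])
  then have \<eta>0: "coef \<eta> 0 \<noteq> 0" using assms(2) by (auto simp: h(3) simp flip: zero_prod_def)
  show "has_ord \<xi> (1, 0)" unfolding has_ord_iff \<eta>(2)
  proof (intro conjI allI impI)
    fix p assume "coef (M (1, 0) * \<eta>) p \<noteq> 0"
    then have "p - (1, 0) \<in> T" using A_coef[OF \<eta>(1), of "p - (1, 0)"] by auto
    then show "(1, 0) \<sqsubseteq> p" using nonneg_T lex.le_iff_diff by blast
  qed (use \<eta>0 in \<open>simp flip: zero_prod_def\<close>)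
  have W: "WO (sumset {(1, 0)} T)" "sumset (sumset {(1, 0)} T) T \<subseteq> sumset {(1, 0)} T"
    by (simp_all add: lex.WO_sumset WO_T sumset_T_closed)
  have sub: "supp (coef (M (1, 0) * h t)) \<subseteq> sumset {(1, 0)} T" for t
  proof
    fix p assume "p \<in> supp (coef (M (1, 0) * h t))"
    then have "p - (1, 0) \<in> T" using A_coef[OF h(1), of "p - (1, 0)" t] by (auto simp: in_supp_iff)
    then show "p \<in> sumset {(1, 0)} T" using lex.sumsetI[of "(1, 0)" "{(1, 0)}" "p - (1, 0)" T] by simp
  qed
  show "F 1 = vf_exp \<xi> pl_id"
  proof
    fix p
    have "(\<lambda>n. coef ((act (fieldB \<eta>) ^^ n) (M (1, 0) * h 0)) p / fact n) sums coef (M (1, 0) * h 1) p"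
      by (rule flow_eq_exp[OF fieldB_A[OF \<eta>(1)] W sub ode])
    moreover have "vf_exp_term \<xi> n pl_id p = coef ((act (fieldB \<eta>) ^^ n) (M (1, 0) * h 0)) p / fact n" for n
      unfolding vf_exp_term_def \<eta>(2) coef_M10[symmetric] vf_apply_iterate[OF \<eta>(1)]
      by (simp add: pl_scale_def h(2))
    ultimately show "F 1 p = vf_exp \<xi> pl_id p"
      unfolding vf_exp_def by (simp only: h(3) sums_unique)
  qed
qed

lemma C1_flow_exists:
  assumes D: "D = pl_L \<or> D = pl_LD" and f: "f \<in> pl_LH \<inter> D" "hyperbolic f"
  shows "\<exists>\<xi>\<in>D. embeds_in_C1_flow_of f \<xi>"
proof -
  have ord: "has_ord f (1, 0)" using f(2) by (simp add: hyperbolic_def)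
  obtain T where T: "supp_monoid T" "\<And>s. s \<in> supp f \<Longrightarrow> s - (1, 0) \<in> T"
    "\<And>g h. g \<in> D \<Longrightarrow> supp h \<subseteq> sumset (supp g) T \<Longrightarrow> h \<in> D"
    using domain_monoid[OF D _ ord] f(1) by blast
  interpret supp_monoid T by (rule T)
  define a where "a = f (1, 0)"
  have a: "a > 0" using pl_LH_D(3)[of f] f(1) lead_exp_eq[OF ord] by (simp add: lead_coeff_of_def a_def)
  obtain e where e: "e \<in> I" "f = coef (ser a e)"
    using ser_repr[of f, OF pl_LH_D(4) _ T(2)] f(1) a unfolding a_def by (metis IntD1 less_irrefl)
  obtain E where E: "EPfam E" "\<And>t. E t \<in> I" "E 0 = 0" "E 1 = e"
    "\<And>s t. act (tangB (a powr t) (E t)) (ser (a powr s) (E s)) = ser (a powr (s + t)) (E (s + t))"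
    using flow_exists[OF e(1) a] by blast
  define F where "F t = coef (ser (a powr t) (E t))" for t
  have pos: "a powr t > 0" for t using a by simp
  define S where "S = sumset {(1, 0)} T"
  have suppF: "supp (F t) \<subseteq> S" for t unfolding F_def S_def by (rule ser_props(6)[OF E(2) pos])
  have flow: "is_flow F" unfolding is_flow_def
  proof (intro conjI allI)
    show "F t \<in> pl_LH" for t unfolding F_def by (rule ser_props(7)[OF E(2) pos])
    show "F 0 = pl_id" using a by (simp add: F_def E(3) ser_def coef_M10)
    show "pl_comp (F s) (F t) = F (s + t)" for s t
      unfolding F_def by (simp only: pl_comp_ser[OF E(2) pos] E(5))
  qed
  have EP: "EP (\<lambda>t. F t p)" for p
    unfolding F_def coef_ser using EP_powr[OF a, of 1] E(1)
    by (intro EP_mult EP_add EP_const) (simp_all add: EPfam_def del: split_paired_All)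
  have C1: "is_C1_flow F" unfolding is_C1_flow_def
  proof (intro conjI exI[of _ S] flow)
    show "lex_well_ordered S" by (simp add: lex_well_ordered_iff S_def lex.WO_sumset WO_T)
    show "S \<subseteq> positive_monoms"
      using nonneg_T by (fastforce simp: S_def lex.sumset_def positive_monoms_def lle_def mem_Times_iff)
  qed (use suppF EP EP_C1 in blast)+
  define \<xi> where "\<xi> = (\<lambda>p. deriv (\<lambda>t. F t p) 0)"
  have "supp \<xi> \<subseteq> S"
  proof
    fix p assume p: "p \<in> supp \<xi>"
    show "p \<in> S"
    proof (rule ccontr)
      assume "p \<notin> S"
      then have "(\<lambda>t. F t p) = (\<lambda>_. 0)" using suppF by (metis in_supp_iff subsetD)
      then show False using p by (simp add: in_supp_iff \<xi>_def)
    qed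
  qed
  \<comment> \<open>\<open>S\<close> is the support of \<open>pl_id\<close> enlarged by
    \<open>T\<close>, so membership of \<xi> in \<open>D\<close> follows from that of
    \<open>pl_id\<close>.\<close>
  then have "\<xi> \<in> D" using T(3)[OF pl_id_domain[OF D]] by (simp add: supp_pl_id S_def)
  moreover have "F 1 = f" using a by (simp add: F_def E(4) e(2))
  then have "embeds_in_C1_flow_of f \<xi>"
    unfolding embeds_in_C1_flow_of_def is_C1_flow_of_def using C1 \<xi>_def by blast
  ultimately show ?thesis by blast
qed

theorem mainTheorem4:
  fixes D :: "pl_series set" and f :: pl_series
  assumes "D = pl_L \<or> D = pl_LD"
    and "f \<in> pl_LH \<inter> D"
    and "hyperbolic f"
  shows "(\<exists>!\<xi>. \<xi> \<in> D \<and> embeds_in_C1_flow_of f \<xi>) \<and>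
         (\<forall>\<xi>. \<xi> \<in> D \<and> embeds_in_C1_flow_of f \<xi> \<longrightarrow>
            has_ord \<xi> (1, 0) \<and>
            weakly_well_defined_by D (vf_exp \<xi>) (vf_exp_term \<xi>) \<and>
            f = vf_exp \<xi> pl_id)"
proof (intro conjI allI impI)
  show "\<exists>!\<xi>. \<xi> \<in> D \<and> embeds_in_C1_flow_of f \<xi>"
    using C1_flow_exists[OF assms] C1_flow_unique unfolding embeds_in_C1_flow_of_def by metis
next
  fix \<xi> assume \<xi>: "\<xi> \<in> D \<and> embeds_in_C1_flow_of f \<xi>"
  then obtain F where F: "is_C1_flow_of \<xi> F" "F 1 = f" unfolding embeds_in_C1_flow_of_def by blast
  have f1: "F 1 (1, 0) \<noteq> 1" using assms(3) F(2) by (simp add: hyperbolic_def)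
  note exp = C1_flow_exp[OF F(1) f1]
  show "has_ord \<xi> (1, 0)" by (rule exp(1))
  show "f = vf_exp \<xi> pl_id" using exp(2) F(2) by simp
  have DL: "D \<subseteq> pl_L" using assms(1) by (auto simp: pl_LD_def)
  \<comment> \<open>The monoid is rebuilt from \<xi> instead of the supports of the flow: for
    \<open>pl_LD\<close> it must preserve \<open>D\<close>, whereas the common support of a flow is
    only known to be well-ordered.\<close>
  obtain T where T: "supp_monoid T" "\<And>s. s \<in> supp \<xi> \<Longrightarrow> s - (1, 0) \<in> T"
    "\<And>g h. g \<in> D \<Longrightarrow> supp h \<subseteq> sumset (supp g) T \<Longrightarrow> h \<in> D"
    using domain_monoid[OF assms(1) conjunct1[OF \<xi>] exp(1)] by blast
  interpret supp_monoid T by (rule T)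
  have "WO (supp \<xi>)" using \<xi> DL by (auto simp: pl_L_def lex_well_ordered_iff)
  moreover have "\<xi> (1, 0) \<noteq> 0" using exp(1) by (simp add: has_ord_iff)
  ultimately obtain e where e: "e \<in> I" "\<xi> = coef (ser (\<xi> (1, 0)) e)" using ser_repr T(2) by metis
  have \<eta>: "C (\<xi> (1, 0)) * (1 + e) \<in> A" by (intro A_mult A_add A_C A_one I_A[OF e(1)])
  have "ser (\<xi> (1, 0)) e = M (1, 0) * (C (\<xi> (1, 0)) * (1 + e))" by (simp add: ser_def mult_ac)
  note \<xi>_eq = e(2)[unfolded this]
  show "weakly_well_defined_by D (vf_exp \<xi>) (vf_exp_term \<xi>)"
  proof (rule weakly_well_defined_vf_exp[OF DL _ \<eta> \<xi>_eq])
    show "h \<in> D" if "g \<in> D" "supp h \<subseteq> sumset (supp g) T" for g h using T(3) that by blast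
  qed
qed

end
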